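(* Consider an exponential family $p_\theta(x)=\exp\left(\langle\theta,T(x)\rangle-A(\theta)\right)h(x)$ with natural parameter $\theta\in\Theta$, $\Theta\subset\mathbb{R}^d$ convex, and log-partition $A$. Let a prediction $\theta_{W,D}$ in the natural parameter space depend on $W$ and $D$ as two sources of variability, and let $$\hat\theta_D^{(n)}=2^{-n}\sum_{i=1}^{2^n}\theta_{W_i,D}$$ be the ensemble prediction computed by sampling $W$ (giving $W_1,\dots,W_{2^n}$) while keeping $D$ fixed; $n=0$ is the case of a single prediction. Let $Y$ be the target, and assume that the respective expectations exist. Then $$\mathbb{B}_A\left[\hat\theta_D^{(n)}\right]=\mathbb{B}_A\left[\mathbb{E}[\theta_{W,D}\mid D]\right]+\mathbb{E}\left[\mathbb{B}_A\left[\hat\theta_D^{(n)}\mid D\right]\right],$$ where $\mathbb{E}\left[\mathbb{B}_A\left[\hat\theta_D^{(n)}\mid D\right]\right]\longrightarrow0$ as $n\to\infty$; that is, the uncertainty in the prediction stemming from $W$ is marginalized out. Since $n$ does not influence the bias term of the expected negative log-likelihood, the latter reduces by the amount of conditional Bregman Information of $W$, and $$\mathbb{E}\left[-\ln p_{\hat\theta_D^{(n)}}(Y)\right]<\mathbb{E}\left[-\ln p_{\hat\theta_D^{(n-1)}}(Y)\right].$$ Hence an ensemble always has better expected performance than a single model, as long as the ensemble members are generated by a true source of uncertainty.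
   Context: The log-partition $A$ of an exponential family is strictly convex, and $\mathbb{E}[T(X)]=\nabla A(\theta)$ for $X\sim p_\theta$; $T$ is the sufficient statistic and $h$ the reference function. Sampling $W$ while keeping $D$ fixed means that, given $D$, the $W_i$ are i.i.d. copies of $W$. For example, for ensembles of neural networks $D$ is the training data and $W$ the weight initialization. For a random vector $X$ with values in $\Theta$, the Bregman Information is $\mathbb{B}_A[X]=\mathbb{E}[A(X)]-A(\mathbb{E}[X])$, and the conditional Bregman Information given $D$ is $\mathbb{B}_A[X\mid D]=\mathbb{E}[A(X)\mid D]-A(\mathbb{E}[X\mid D])$. The bias term refers to the decomposition, for $Y\sim p_\theta$ and a random natural parameter prediction $\hat\theta$, $\mathbb{E}[-\ln p_{\hat\theta}(Y)]=n(\theta)+\mathbb{B}_A[\hat\theta]+d_A(\theta,\mathbb{E}[\hat\theta])$, with noise $n(\theta)=-A^*(\nabla A(\theta))-\mathbb{E}[\ln h(Y)]$ (here $n(\cdot)$ is a function, unrelated to the ensemble index $n$), variance term $\mathbb{B}_A[\hat\theta]$, and bias $d_A(\theta,\mathbb{E}[\hat\theta])$, where $A^*$ is the convex conjugate of $A$ and $d_A(x,y)=A(y)-A(x)-\langle\nabla A(x),y-x\rangle$. *)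

theory Defs
  imports "HOL-Probability.Probability"
begin

section \<open>Exponential families\<close>

definition log_partition ::
  "'x measure \<Rightarrow> ('x \<Rightarrow> 'e::euclidean_space) \<Rightarrow> ('x \<Rightarrow> real) \<Rightarrow> 'e \<Rightarrow> real" where
  "log_partition \<nu> T h \<theta> = ln (\<integral>x. exp (\<theta> \<bullet> T x) * h x \<partial>\<nu>)"

definition expfam_density ::
  "'x measure \<Rightarrow> ('x \<Rightarrow> 'e::euclidean_space) \<Rightarrow> ('x \<Rightarrow> real) \<Rightarrow> 'e \<Rightarrow> 'x \<Rightarrow> real" where
  "expfam_density \<nu> T h \<theta> x = exp (\<theta> \<bullet> T x - log_partition \<nu> T h \<theta>) * h x"

text \<open>
  The last condition says exactly that the partition function is finite and positive on
  \<open>\<Theta>\<close>: otherwise the Bochner integral or the logarithm takes a default value, and the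
  density does not have total mass 1. The set \<open>\<Theta>\<close> need not be open or measurable.
\<close>

definition exponential_family ::
  "'x measure \<Rightarrow> ('x \<Rightarrow> 'e::euclidean_space) \<Rightarrow> ('x \<Rightarrow> real) \<Rightarrow> 'e set \<Rightarrow> bool" where
  "exponential_family \<nu> T h \<Theta> \<longleftrightarrow>
     sigma_finite_measure \<nu> \<and> T \<in> borel_measurable \<nu> \<and> h \<in> borel_measurable \<nu> \<and>
     (\<forall>x\<in>space \<nu>. 0 \<le> h x) \<and> convex \<Theta> \<and>
     (\<forall>\<theta>\<in>\<Theta>. prob_space (density \<nu> (\<lambda>x. ennreal (expfam_density \<nu> T h \<theta> x))))"

section \<open>Convex analysis\<close>

definition strictly_convex_on :: "'e::real_vector set \<Rightarrow> ('e \<Rightarrow> real) \<Rightarrow> bool" where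
  "strictly_convex_on S f \<longleftrightarrow>
     convex S \<and>
     (\<forall>x\<in>S. \<forall>y\<in>S. \<forall>t. x \<noteq> y \<longrightarrow> 0 < t \<longrightarrow> t < 1 \<longrightarrow>
        f ((1 - t) *\<^sub>R x + t *\<^sub>R y) < (1 - t) * f x + t * f y)"

definition grad :: "('e::euclidean_space \<Rightarrow> real) \<Rightarrow> 'e \<Rightarrow> 'e" where
  "grad f x = (THE g. GDERIV f x :> g)"

definition convex_conjugate :: "'e::euclidean_space set \<Rightarrow> ('e \<Rightarrow> real) \<Rightarrow> 'e \<Rightarrow> real" where
  "convex_conjugate S f y = (SUP x\<in>S. x \<bullet> y - f x)"

definition bregman_div :: "('e::euclidean_space \<Rightarrow> real) \<Rightarrow> 'e \<Rightarrow> 'e \<Rightarrow> real" where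
  "bregman_div f x y = f y - f x - grad f x \<bullet> (y - x)"

section \<open>Conditioning\<close>

definition generated :: "'a measure \<Rightarrow> 'b measure \<Rightarrow> ('a \<Rightarrow> 'b) \<Rightarrow> 'a measure" where
  "generated M N X = vimage_algebra (space M) X N"

text \<open>The library's conditional expectation is real-valued; vectors are treated coordinatewise.\<close>

definition vec_cond_exp ::
  "'a measure \<Rightarrow> 'a measure \<Rightarrow> ('a \<Rightarrow> 'e::euclidean_space) \<Rightarrow> 'a \<Rightarrow> 'e" where
  "vec_cond_exp M F X \<omega> = (\<Sum>b\<in>Basis. real_cond_exp M F (\<lambda>\<omega>'. X \<omega>' \<bullet> b) \<omega> *\<^sub>R b)"

definition cond_probability :: "'a measure \<Rightarrow> 'a measure \<Rightarrow> 'a set \<Rightarrow> 'a \<Rightarrow> real" where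
  "cond_probability M F E = real_cond_exp M F (indicator E)"

text \<open>Given \<open>F\<close>, the variables \<open>Ws 0, Ws 1, \<dots>\<close> are independent and each distributed like \<open>W\<close>.\<close>

definition cond_iid_copies ::
  "'a measure \<Rightarrow> 'a measure \<Rightarrow> 'w measure \<Rightarrow> ('a \<Rightarrow> 'w) \<Rightarrow> (nat \<Rightarrow> 'a \<Rightarrow> 'w) \<Rightarrow> bool" where
  "cond_iid_copies M F N W Ws \<longleftrightarrow>
     W \<in> measurable M N \<and> (\<forall>i. Ws i \<in> measurable M N) \<and>
     (\<forall>i. \<forall>B\<in>sets N. AE \<omega> in M.
        cond_probability M F (Ws i -` B \<inter> space M) \<omega> =
        cond_probability M F (W -` B \<inter> space M) \<omega>) \<and>
     (\<forall>J B. finite J \<longrightarrow> (\<forall>j\<in>J. B j \<in> sets N) \<longrightarrow>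
        (AE \<omega> in M.
           cond_probability M F {\<omega>' \<in> space M. \<forall>j\<in>J. Ws j \<omega>' \<in> B j} \<omega> =
           (\<Prod>j\<in>J. cond_probability M F (Ws j -` B j \<inter> space M) \<omega>)))"

section \<open>Bregman information\<close>

definition bregman_info ::
  "'a measure \<Rightarrow> ('e::euclidean_space \<Rightarrow> real) \<Rightarrow> ('a \<Rightarrow> 'e) \<Rightarrow> real" where
  "bregman_info M A X = (\<integral>\<omega>. A (X \<omega>) \<partial>M) - A (\<integral>\<omega>. X \<omega> \<partial>M)"

definition cond_bregman_info ::
  "'a measure \<Rightarrow> 'a measure \<Rightarrow> ('e::euclidean_space \<Rightarrow> real) \<Rightarrow> ('a \<Rightarrow> 'e) \<Rightarrow> 'a \<Rightarrow> real" where
  "cond_bregman_info M F A X \<omega> =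
     real_cond_exp M F (\<lambda>\<omega>'. A (X \<omega>')) \<omega> - A (vec_cond_exp M F X \<omega>)"

section \<open>Ensembles and their negative log-likelihood\<close>

definition ensemble ::
  "('w \<Rightarrow> 'd \<Rightarrow> 'e::euclidean_space) \<Rightarrow> (nat \<Rightarrow> 'a \<Rightarrow> 'w) \<Rightarrow> ('a \<Rightarrow> 'd) \<Rightarrow> nat \<Rightarrow> 'a \<Rightarrow> 'e" where
  "ensemble \<phi> Ws D n \<omega> = (1 / 2 ^ n) *\<^sub>R (\<Sum>i<2 ^ n. \<phi> (Ws i \<omega>) (D \<omega>))"

definition expected_nll ::
  "'a measure \<Rightarrow> 'x measure \<Rightarrow> ('x \<Rightarrow> 'e::euclidean_space) \<Rightarrow> ('x \<Rightarrow> real) \<Rightarrow>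
   ('a \<Rightarrow> 'x) \<Rightarrow> ('a \<Rightarrow> 'e) \<Rightarrow> real" where
  "expected_nll M \<nu> T h Y X = (\<integral>\<omega>. - ln (expfam_density \<nu> T h (X \<omega>) (Y \<omega>)) \<partial>M)"

definition noise_term ::
  "'a measure \<Rightarrow> ('x \<Rightarrow> real) \<Rightarrow> 'e::euclidean_space set \<Rightarrow> ('e \<Rightarrow> real) \<Rightarrow>
   ('a \<Rightarrow> 'x) \<Rightarrow> 'e \<Rightarrow> real" where
  "noise_term M h \<Theta> A Y \<theta> =
     - convex_conjugate \<Theta> A (grad A \<theta>) - (\<integral>\<omega>. ln (h (Y \<omega>)) \<partial>M)"

definition bias_term ::
  "'a measure \<Rightarrow> ('e::euclidean_space \<Rightarrow> real) \<Rightarrow> 'e \<Rightarrow> ('a \<Rightarrow> 'e) \<Rightarrow> real" where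
  "bias_term M A \<theta> X = bregman_div A \<theta> (\<integral>\<omega>. X \<omega> \<partial>M)"

text \<open>
  The predictions \<open>\<phi> (W \<omega>) (D \<omega>)\<close> have a true source of uncertainty \<open>W\<close> besides \<open>D\<close> if they
  are not almost surely a function of \<open>D\<close> alone. Randomness of \<open>W\<close> itself is not enough, since
  \<open>\<phi>\<close> may ignore it.
\<close>

definition true_source ::
  "'a measure \<Rightarrow> 'd measure \<Rightarrow> ('w \<Rightarrow> 'd \<Rightarrow> 'e::euclidean_space) \<Rightarrow> ('a \<Rightarrow> 'w) \<Rightarrow> ('a \<Rightarrow> 'd) \<Rightarrow> bool" where
  "true_source M N \<phi> W D \<longleftrightarrow>
     \<not> (\<exists>g \<in> borel_measurable N. AE \<omega> in M. \<phi> (W \<omega>) (D \<omega>) = g (D \<omega>))"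

end

theory Submission
  imports Defs
begin

text \<open>
  Let \<open>X i\<close> be the prediction of member \<open>i\<close>, let \<open>f\<close> be the conditional expectation of the
  prediction given \<open>D\<close>, and let \<open>\<mu>\<close> be the expectation of \<open>T (Y)\<close>. As \<open>Y\<close> is independent of the
  ensemble, the expected negative log-likelihood is \<open>E A(ens n)\<close> plus a term free of \<open>n\<close>, and all
  claims concern the sequence \<open>E A(ens n)\<close>.

  Its limit is \<open>E A(f)\<close>. Along a subsequence the ensemble means converge to \<open>f\<close> almost surely.
  Every basic open set that is hit by one member is hit with positive limiting frequency, so a
  hyperplane supporting the convex hull of the \<open>X i\<close> at \<open>f\<close> would push the means away from \<open>f\<close>;
  hence \<open>f\<close> lies in the relative interior of that hull. There \<open>A\<close> is continuous, and expectations
  converge because \<open>A(ens n)\<close> is squeezed between an affine minorant and the mean of the \<open>A(X i)\<close>,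
  both of which obey the law of large numbers. The minorant is \<open>A(\<theta>) + (\<eta> - \<theta>) \<bullet> \<mu>\<close>, by
  \<open>exp t \<ge> 1 + t\<close>.

  The sequence decreases since \<open>ens (n + 1)\<close> is the midpoint of two equally distributed means. In
  case of equality the two means coincide almost surely by strict convexity; conditioning their
  difference on \<open>(W 0, D)\<close> then gives \<open>X 0 = f\<close>, so the prediction is a function of \<open>D\<close> alone.
\<close>

section \<open>Integration lemmas\<close>

text \<open>Three obstacles shape the argument. First, \<open>SW\<close> is an arbitrary measurable
  space, so no regular conditional law of \<open>W\<close> is at hand. Conditional independence is
  used as an identity of integrals on rectangles, extended to joint laws by uniqueness of measures.
  Second, only first moments of the predictions are assumed. Bounded functions have variances of
  order \<open>1 / 2 ^ n\<close>, summable along the ensemble sizes, and so obey an almost sure law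
  along all of them. Integrable functions are handled in L1 by truncation, hence almost surely along
  a subsequence. This loses nothing, as monotonicity already makes the expectations converge.
  Hitting frequencies of open sets belong to the bounded case and cost no further subsequence.
  Third, \<open>\<Theta>\<close> is merely convex, so continuity of \<open>A\<close> at its relative
  boundary is not guaranteed, and the limit prediction may lie there. The relative interior is
  therefore taken in the hull of the sampled predictions. No fixed dominating function is available
  for the expectations; the squeezing functions vary with \<open>n\<close>, which calls for Pratt's
  lemma.\<close>

lemma nn_integral_pair_eqI:
  fixes a b :: "'a \<Rightarrow> ennreal"
  assumes [measurable]: "a \<in> borel_measurable M" "b \<in> borel_measurable M"
    and [measurable]: "V \<in> measurable M N" "V' \<in> measurable M N" "D \<in> measurable M S"
    and fin: "(\<integral>\<^sup>+\<omega>. a \<omega> \<partial>M) \<noteq> \<infinity>"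
    and eq: "\<And>B C. B \<in> sets N \<Longrightarrow> C \<in> sets S \<Longrightarrow>
      (\<integral>\<^sup>+\<omega>. a \<omega> * (indicator B (V \<omega>) * indicator C (D \<omega>)) \<partial>M) =
      (\<integral>\<^sup>+\<omega>. b \<omega> * (indicator B (V' \<omega>) * indicator C (D \<omega>)) \<partial>M)"
    and [measurable]: "\<psi> \<in> borel_measurable (N \<Otimes>\<^sub>M S)"
  shows "(\<integral>\<^sup>+\<omega>. a \<omega> * \<psi> (V \<omega>, D \<omega>) \<partial>M) = (\<integral>\<^sup>+\<omega>. b \<omega> * \<psi> (V' \<omega>, D \<omega>) \<partial>M)"
proof -
  \<comment> \<open>With the weights as densities, \<open>eq\<close> compares two measures on
    rectangles, a generator closed under intersection. By \<open>fin\<close> the measures are finite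
    on the one rectangle that exhausts the space.\<close>
  define P where "P = distr (density M a) (N \<Otimes>\<^sub>M S) (\<lambda>\<omega>. (V \<omega>, D \<omega>))"
  define Q where "Q = distr (density M b) (N \<Otimes>\<^sub>M S) (\<lambda>\<omega>. (V' \<omega>, D \<omega>))"
  have nnP: "(\<integral>\<^sup>+x. g x \<partial>P) = (\<integral>\<^sup>+\<omega>. a \<omega> * g (V \<omega>, D \<omega>) \<partial>M)"
    if [measurable]: "g \<in> borel_measurable (N \<Otimes>\<^sub>M S)" for g
    unfolding P_def by (simp add: nn_integral_distr nn_integral_density)
  have nnQ: "(\<integral>\<^sup>+x. g x \<partial>Q) = (\<integral>\<^sup>+\<omega>. b \<omega> * g (V' \<omega>, D \<omega>) \<partial>M)"
    if [measurable]: "g \<in> borel_measurable (N \<Otimes>\<^sub>M S)" for g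
    unfolding Q_def by (simp add: nn_integral_distr nn_integral_density)
  have rect: "emeasure P (B \<times> C) = emeasure Q (B \<times> C)" if "B \<in> sets N" "C \<in> sets S" for B C
  proof -
    have [measurable]: "B \<in> sets N" "C \<in> sets S" by fact+
    have ind: "indicator (B \<times> C) (v, d) = (indicator B v * indicator C d :: ennreal)" for v d
      by (auto split: split_indicator)
    have "emeasure P (B \<times> C) = (\<integral>\<^sup>+x. indicator (B \<times> C) x \<partial>P)"
      by (rule nn_integral_indicator[symmetric]) (simp add: P_def)
    also have "\<dots> = (\<integral>\<^sup>+x. indicator (B \<times> C) x \<partial>Q)"
      using eq[OF that] by (subst nnP, simp) (subst nnQ, simp_all add: ind)
    also have "\<dots> = emeasure Q (B \<times> C)"
      by (rule nn_integral_indicator) (simp add: Q_def)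
    finally show ?thesis .
  qed
  have "P = Q"
  proof (rule measure_eqI_generator_eq[OF Int_stable_pair_measure_generator[of N S]])
    let ?A = "\<lambda>_::nat. space N \<times> space S"
    show "{a \<times> b |a b. a \<in> sets N \<and> b \<in> sets S} \<subseteq> Pow (space N \<times> space S)"
      by (rule pair_measure_closed)
    show "sets P = sigma_sets (space N \<times> space S) {a \<times> b |a b. a \<in> sets N \<and> b \<in> sets S}"
      by (simp add: P_def sets_pair_measure)
    show "sets Q = sigma_sets (space N \<times> space S) {a \<times> b |a b. a \<in> sets N \<and> b \<in> sets S}"
      by (simp add: Q_def sets_pair_measure)
    show "range ?A \<subseteq> {a \<times> b |a b. a \<in> sets N \<and> b \<in> sets S}" by auto
    show "(\<Union>i. ?A i) = space N \<times> space S" by simp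
    have "emeasure P (space N \<times> space S) \<le> (\<integral>\<^sup>+x. 1 \<partial>P)"
      by (simp add: P_def emeasure_space space_pair_measure)
    also have "\<dots> = (\<integral>\<^sup>+\<omega>. a \<omega> \<partial>M)" by (subst nnP) auto
    finally show "emeasure P (?A i) \<noteq> \<infinity>" for i
      using fin by (auto simp: top_unique)
    show "emeasure P X = emeasure Q X"
      if "X \<in> {a \<times> b |a b. a \<in> sets N \<and> b \<in> sets S}" for X
      using that rect by auto
  qed
  then show ?thesis
    using nnP[of \<psi>] nnQ[of \<psi>] by simp
qed

section \<open>Factorization through a generating map\<close>

text \<open>Doob-Dynkin for values in \<open>ennreal\<close>. Extended values make the monotone step
  unconditional: the supremum of the factors exists also at points outside the range of
  \<open>D\<close>.\<close>

lemma nn_doob_dynkin: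
  fixes f :: "'a \<Rightarrow> ennreal"
  assumes D: "D \<in> X \<rightarrow> space S" and f: "f \<in> borel_measurable (vimage_algebra X D S)"
  shows "\<exists>g\<in>borel_measurable S. \<forall>x\<in>X. f x = g (D x)"
  using f
proof (induction rule: borel_measurable_induct)
  case (cong f g) then show ?case by simp
next
  case (set A)
  then obtain B where "B \<in> sets S" "A = D -` B \<inter> X"
    using D by (auto simp: sets_vimage_algebra2)
  then show ?case
    by (intro bexI[of _ "indicator B"]) (auto split: split_indicator)
next
  case (mult u c)
  then obtain g where "g \<in> borel_measurable S" "\<forall>x\<in>X. u x = g (D x)" by blast
  then show ?case by (intro bexI[of _ "\<lambda>x. c * g x"]) auto
next
  case (add u v)
  then obtain g g' where "g \<in> borel_measurable S" "\<forall>x\<in>X. u x = g (D x)"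
    "g' \<in> borel_measurable S" "\<forall>x\<in>X. v x = g' (D x)" by blast
  then show ?case by (intro bexI[of _ "\<lambda>x. g' x + g x"]) auto
next
  case (seq U)
  have "\<forall>i. \<exists>g. g \<in> borel_measurable S \<and> (\<forall>x\<in>X. U i x = g (D x))"
    using seq.IH seq.hyps by blast
  then obtain g where "\<And>i. g i \<in> borel_measurable S" "\<And>i x. x \<in> X \<Longrightarrow> U i x = g i (D x)"
    by metis
  then show ?case by (intro bexI[of _ "\<lambda>x. SUP i. g i x"]) (auto simp: image_comp)
qed

lemma doob_dynkin_real:
  fixes f :: "'a \<Rightarrow> real"
  assumes D: "D \<in> X \<rightarrow> space S" and [measurable]: "f \<in> borel_measurable (vimage_algebra X D S)"
  shows "\<exists>g\<in>borel_measurable S. \<forall>x\<in>X. f x = g (D x)"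
proof -
  obtain g h where [measurable]: "g \<in> borel_measurable S" "h \<in> borel_measurable S"
    and gh: "\<forall>x\<in>X. ennreal (f x) = g (D x)" "\<forall>x\<in>X. ennreal (- f x) = h (D x)"
    using nn_doob_dynkin[OF D, of "\<lambda>x. ennreal (f x)"] nn_doob_dynkin[OF D, of "\<lambda>x. ennreal (- f x)"]
    by auto
  \<comment> \<open>\<open>ennreal\<close> sends negative numbers to 0, so \<open>g\<close> and
    \<open>h\<close> factor the positive and the negative part of \<open>f\<close>.\<close>
  have "f x = enn2real (g (D x)) - enn2real (h (D x))" if "x \<in> X" for x
  proof -
    have "g (D x) = ennreal (f x)" "h (D x) = ennreal (- f x)" using gh that by auto
    then show ?thesis by (cases "f x \<ge> 0") (simp_all add: ennreal_neg)
  qed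
  then show ?thesis
    by (intro bexI[of _ "\<lambda>d. enn2real (g d) - enn2real (h d)"]) auto
qed

section \<open>Passing to the limit under the integral\<close>

text \<open>Fatou's lemma in a form where integrability of the limit is part of the conclusion: the
  limit is nonnegative and its nonnegative integral is at most the real number
  \<open>c\<close>.\<close>

lemma integral_lower_semicontinuous:
  fixes u :: "nat \<Rightarrow> 'a \<Rightarrow> real"
  assumes int: "\<And>n. integrable M (u n)" and nonneg: "\<And>n. AE x in M. 0 \<le> u n x"
    and lim: "AE x in M. (\<lambda>n. u n x) \<longlonglongrightarrow> v x" and [measurable]: "v \<in> borel_measurable M"
    and c: "(\<lambda>n. \<integral>x. u n x \<partial>M) \<longlonglongrightarrow> c"
  shows "integrable M v \<and> (\<integral>x. v x \<partial>M) \<le> c"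
proof -
  have [measurable]: "u n \<in> borel_measurable M" for n using int by auto
  have v0: "AE x in M. 0 \<le> v x"
  proof -
    have "AE x in M. \<forall>n. 0 \<le> u n x" using nonneg by (simp add: AE_all_countable)
    with lim show ?thesis
      by eventually_elim (blast intro: LIMSEQ_le_const)
  qed
  have c0: "0 \<le> c"
    using c by (rule LIMSEQ_le_const) (auto intro!: exI integral_nonneg_AE nonneg)
  have "(\<integral>\<^sup>+x. ennreal (v x) \<partial>M) = (\<integral>\<^sup>+x. liminf (\<lambda>n. ennreal (u n x)) \<partial>M)"
  proof (rule nn_integral_cong_AE)
    show "AE x in M. ennreal (v x) = liminf (\<lambda>n. ennreal (u n x))"
      using lim
      by eventually_elim (simp add: lim_imp_Liminf[OF sequentially_bot tendsto_ennrealI])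
  qed
  also have "\<dots> \<le> liminf (\<lambda>n. \<integral>\<^sup>+x. ennreal (u n x) \<partial>M)"
    by (rule nn_integral_liminf) auto
  also have "\<dots> = liminf (\<lambda>n. ennreal (\<integral>x. u n x \<partial>M))"
    by (simp add: nn_integral_eq_integral[OF int nonneg])
  also have "\<dots> = ennreal c"
    by (rule lim_imp_Liminf[OF sequentially_bot tendsto_ennrealI[OF c]])
  finally have le: "(\<integral>\<^sup>+x. ennreal (v x) \<partial>M) \<le> ennreal c" .
  then have "(\<integral>\<^sup>+x. ennreal (v x) \<partial>M) < \<infinity>"
    using ennreal_less_top le_less_trans by force
  then have i: "integrable M v"
    using v0 by (intro integrableI_nonneg) auto
  moreover have "(\<integral>x. v x \<partial>M) \<le> c"
    using le c0 by (simp add: nn_integral_eq_integral[OF i v0])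
  ultimately show ?thesis by simp
qed

text \<open>Pratt's version of dominated convergence, with bounds that move with \<open>n\<close>.
  Fatou applied to \<open>u n - l n\<close> bounds the integral of \<open>u'\<close> from above by
  the limit of the integrals, and applied to \<open>h n - u n\<close> bounds it from below. Since
  \<open>conv\<close> is given, both bounds are the same number.\<close>

lemma pratt_convergence:
  fixes u :: "nat \<Rightarrow> 'a \<Rightarrow> real"
  assumes intl: "\<And>n. integrable M (l n)" and intu: "\<And>n. integrable M (u n)"
    and inth: "\<And>n. integrable M (h n)"
    and lu: "\<And>n. AE x in M. l n x \<le> u n x" and uh: "\<And>n. AE x in M. u n x \<le> h n x"
    and liml: "AE x in M. (\<lambda>n. l n x) \<longlonglongrightarrow> l' x" and limu: "AE x in M. (\<lambda>n. u n x) \<longlonglongrightarrow> u' x"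
    and limh: "AE x in M. (\<lambda>n. h n x) \<longlonglongrightarrow> h' x"
    and intl': "integrable M l'" and inth': "integrable M h'"
    and [measurable]: "u' \<in> borel_measurable M"
    and cl: "(\<lambda>n. \<integral>x. l n x \<partial>M) \<longlonglongrightarrow> (\<integral>x. l' x \<partial>M)"
    and ch: "(\<lambda>n. \<integral>x. h n x \<partial>M) \<longlonglongrightarrow> (\<integral>x. h' x \<partial>M)"
    and conv: "convergent (\<lambda>n. \<integral>x. u n x \<partial>M)"
  shows "integrable M u' \<and> (\<lambda>n. \<integral>x. u n x \<partial>M) \<longlonglongrightarrow> (\<integral>x. u' x \<partial>M)"
proof -
  obtain c where c: "(\<lambda>n. \<integral>x. u n x \<partial>M) \<longlonglongrightarrow> c"
    using conv by (auto simp: convergent_def)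
  have [measurable]: "l' \<in> borel_measurable M" "h' \<in> borel_measurable M" using intl' inth' by auto
  have 1: "integrable M (\<lambda>x. u' x - l' x) \<and> (\<integral>x. u' x - l' x \<partial>M) \<le> c - (\<integral>x. l' x \<partial>M)"
  proof (rule integral_lower_semicontinuous[of M "\<lambda>n x. u n x - l n x"])
    show "AE x in M. (\<lambda>n. u n x - l n x) \<longlonglongrightarrow> u' x - l' x"
      using limu liml by eventually_elim (rule tendsto_diff)
    show "(\<lambda>n. \<integral>x. u n x - l n x \<partial>M) \<longlonglongrightarrow> c - (\<integral>x. l' x \<partial>M)"
      using tendsto_diff[OF c cl] by (simp add: intu intl)
  qed (use lu intl intu in auto)
  then have "integrable M (\<lambda>x. (u' x - l' x) + l' x)"
    using intl' by (intro Bochner_Integration.integrable_add) auto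
  then have i: "integrable M u'" by simp
  have 2: "integrable M (\<lambda>x. h' x - u' x) \<and> (\<integral>x. h' x - u' x \<partial>M) \<le> (\<integral>x. h' x \<partial>M) - c"
  proof (rule integral_lower_semicontinuous[of M "\<lambda>n x. h n x - u n x"])
    show "AE x in M. (\<lambda>n. h n x - u n x) \<longlonglongrightarrow> h' x - u' x"
      using limu limh by eventually_elim (intro tendsto_diff)
    show "(\<lambda>n. \<integral>x. h n x - u n x \<partial>M) \<longlonglongrightarrow> (\<integral>x. h' x \<partial>M) - c"
      using tendsto_diff[OF ch c] by (simp add: intu inth)
  qed (use uh inth intu in auto)
  have "(\<integral>x. u' x \<partial>M) = c"
    using 1 2 i intl' inth' by simp
  then show ?thesis using c i by simp
qed

section \<open>Convex functions along sample means\<close>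

lemma strictly_convex_on_imp_convex_on:
  assumes "strictly_convex_on S f"
  shows "convex_on S f"
proof (rule convex_onI)
  show "convex S" using assms by (simp add: strictly_convex_on_def)
  fix t :: real and x y assume t: "0 < t" "t < 1" "x \<in> S" "y \<in> S"
  then show "f ((1 - t) *\<^sub>R x + t *\<^sub>R y) \<le> (1 - t) * f x + t * f y"
  proof (cases "x = y")
    case True
    have "(1 - t) *\<^sub>R y + t *\<^sub>R y = y" by (simp add: algebra_simps)
    then show ?thesis using True by (simp add: algebra_simps)
  next
    case False
    then show ?thesis using assms t by (simp add: strictly_convex_on_def less_imp_le)
  qed
qed

text \<open>Composing with the orthogonal projection onto the direction space of the affine hull
  reduces the claim to continuity of convex functions on open sets.\<close>

lemma convex_on_tendsto_rel_interior:
  fixes f :: "'e::euclidean_space \<Rightarrow> real"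
  assumes f: "convex_on C f" and p: "p \<in> rel_interior C"
    and y: "\<And>n. y n \<in> C" and lim: "y \<longlonglongrightarrow> p"
  shows "(\<lambda>n. f (y n)) \<longlonglongrightarrow> f p"
proof -
  define S where "S = span ((\<lambda>x. - p + x) ` C)"
  have C: "convex C" using f by (rule convex_on_imp_convex)
  have pC: "p \<in> C" using p rel_interior_subset by auto
  have aff: "affine hull C = (\<lambda>x. p + x) ` S"
    unfolding S_def using pC by (intro affine_hull_span_gen hull_inc)
  obtain B where B: "B \<subseteq> S" "pairwise orthogonal B" "\<And>b. b \<in> B \<Longrightarrow> norm b = 1"
      "independent B" "card B = dim S" "span B = S"
    using orthonormal_basis_subspace[of S] by (auto simp: S_def)
  have finB: "finite B" using B(4) by (rule independent_imp_finite)
  define P where "P x = (\<Sum>b\<in>B. (x \<bullet> b) *\<^sub>R b)" for x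
  have linP: "linear P"
    unfolding P_def by (intro linearI) (auto simp: inner_add_left scaleR_add_left sum.distrib scaleR_sum_right)
  have PS: "P x \<in> S" for x
    unfolding P_def B(6)[symmetric] by (intro span_sum span_mul span_base)
  have Pid: "P x = x" if "x \<in> S" for x
  proof -
    have "P b = id b" if "b \<in> B" for b
    proof -
      have "P b = (\<Sum>b'\<in>B. if b' = b then b else 0)"
        unfolding P_def
      proof (rule sum.cong)
        fix b' assume "b' \<in> B"
        then show "(b \<bullet> b') *\<^sub>R b' = (if b' = b then b else 0)"
          using B(2,3) that by (cases "b' = b") (auto simp: pairwise_def orthogonal_def norm_eq_1)
      qed simp
      then show ?thesis using that finB by simp
    qed
    then have "P x = id x"
      using that B(6) linP by (intro linear_eq_on_span[of P id B x]) (auto intro: linear_id)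
    then show ?thesis by simp
  qed
  have contP: "continuous_on UNIV (\<lambda>x. p + P x)"
    unfolding P_def by (intro continuous_intros)
  define U where "U = {x. p + P x \<in> rel_interior C}"
  obtain T where T: "open T" "rel_interior C = affine hull C \<inter> T"
    using openin_rel_interior[of C] by (auto simp: openin_open)
  \<comment> \<open>\<open>p + P x\<close> always lies in the affine hull, so being in the relative
    interior reduces to being in the ambient open set \<open>T\<close>.\<close>
  have "U = (\<lambda>x. p + P x) -` T"
    using PS by (auto simp: U_def T(2) aff)
  then have openU: "open U"
    using contP T(1) by (simp add: open_vimage)
  have combine: "p + P (s *\<^sub>R u + t *\<^sub>R v) = s *\<^sub>R (p + P u) + t *\<^sub>R (p + P v)" if "s + t = 1" for s t u v
  proof -
    have "p = (s + t) *\<^sub>R p" using that by simp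
    then show ?thesis
      by (simp add: linear_add[OF linP] linear_scale[OF linP] algebra_simps)
  qed
  have cU: "convex U"
    unfolding convex_def U_def
    using convex_rel_interior[OF C] by (auto simp: combine convex_def)
  have "convex_on U (\<lambda>x. f (p + P x))"
    unfolding convex_on_def
  proof (intro conjI cU ballI allI impI)
    fix u v s t assume *: "u \<in> U" "v \<in> U" "0 \<le> (s::real)" "0 \<le> t" "s + t = 1"
    then have "p + P u \<in> C" "p + P v \<in> C" using rel_interior_subset by (auto simp: U_def)
    then show "f (p + P (s *\<^sub>R u + t *\<^sub>R v)) \<le> s * f (p + P u) + t * f (p + P v)"
      using f * by (simp add: combine convex_on_def)
  qed
  then have "continuous_on U (\<lambda>x. f (p + P x))"
    by (rule convex_on_continuous[OF openU])
  moreover have "0 \<in> U" using p by (simp add: U_def linear_0[OF linP])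
  ultimately have "isCont (\<lambda>x. f (p + P x)) 0"
    using openU by (simp add: continuous_on_eq_continuous_at)
  moreover have "(\<lambda>n. y n - p) \<longlonglongrightarrow> 0" using lim by (simp add: LIM_zero_iff)
  ultimately have "(\<lambda>n. f (p + P (y n - p))) \<longlonglongrightarrow> f (p + P 0)"
    by (rule isCont_tendsto_compose)
  moreover have "P (y n - p) = y n - p" for n
    using y by (intro Pid) (auto simp: S_def intro!: span_base)
  ultimately show ?thesis by (simp add: linear_0[OF linP])
qed

lemma mean_in_convex_hull:
  fixes x :: "nat \<Rightarrow> 'e::real_vector"
  assumes "0 < k"
  shows "(1 / real k) *\<^sub>R (\<Sum>i<k. x i) \<in> convex hull (range x)"
  unfolding scaleR_sum_right using assms
  by (intro convex_sum) (auto intro: hull_inc)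

text \<open>The hypothesis \<open>freq\<close> speaks of basic sets only, because it will come from
  almost sure statements, of which only countably many can be combined.\<close>

lemma limit_of_means_in_rel_interior:
  fixes x :: "nat \<Rightarrow> 'e::euclidean_space"
  assumes N: "\<And>n. 0 < N n"
    and avg: "(\<lambda>n. (1 / real (N n)) *\<^sub>R (\<Sum>i<N n. x i)) \<longlonglongrightarrow> p"
    and basis: "topological_basis \<B>"
    and freq: "\<And>B j. B \<in> \<B> \<Longrightarrow> x j \<in> B \<Longrightarrow>
      \<exists>c>0. (\<lambda>n. (1 / real (N n)) * (\<Sum>i<N n. indicator B (x i))) \<longlonglongrightarrow> c"
  shows "p \<in> rel_interior (convex hull (range x))"
proof (rule ccontr)
  let ?C = "convex hull (range x)"
  assume nin: "p \<notin> rel_interior ?C"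
  have "p \<in> closure ?C"
    unfolding closure_sequential
    by (intro exI[of _ "\<lambda>n. (1 / real (N n)) *\<^sub>R (\<Sum>i<N n. x i)"] conjI allI mean_in_convex_hull N avg)
  then obtain a where a: "\<And>y. y \<in> closure ?C \<Longrightarrow> a \<bullet> p \<le> a \<bullet> y"
    "\<And>y. y \<in> rel_interior ?C \<Longrightarrow> a \<bullet> p < a \<bullet> y"
    using supporting_hyperplane_relative_frontier[OF convex_convex_hull _ nin] by metis
  have xa: "a \<bullet> p \<le> a \<bullet> x i" for i
    by (intro a(1)) (meson closure_subset hull_inc rangeI subsetD)
  \<comment> \<open>If no sample were strictly beyond the hyperplane, the whole hull would lie in
    the opposite closed halfspace, against strictness on its nonempty relative interior.\<close>
  obtain j where j: "a \<bullet> p < a \<bullet> x j"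
  proof (rule ccontr)
    assume "\<not> thesis"
    then have "range x \<subseteq> {y. a \<bullet> y \<le> a \<bullet> p}" using that not_le by blast
    then have "?C \<subseteq> {y. a \<bullet> y \<le> a \<bullet> p}"
      by (intro hull_minimal) (auto simp: convex_halfspace_le)
    moreover have "rel_interior ?C \<noteq> {}"
      by (simp add: rel_interior_eq_empty)
    ultimately show False using a(2) rel_interior_subset[of ?C] by (force simp: not_le)
  qed
  \<comment> \<open>Half the gap keeps \<open>x j\<close> strictly inside an open halfspace. Each
    sample in \<open>B\<close> then exceeds \<open>a \<bullet> p\<close> by at least
    \<open>\<delta>\<close>, and no sample falls below it, so the means stay away by
    \<open>\<delta>\<close> times the frequency of \<open>B\<close>.\<close>
  define \<delta> where "\<delta> = (a \<bullet> x j - a \<bullet> p) / 2"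
  have \<delta>: "\<delta> > 0" using j by (simp add: \<delta>_def)
  have "open {y. a \<bullet> y > a \<bullet> p + \<delta>}" by (rule open_halfspace_gt)
  moreover have "x j \<in> {y. a \<bullet> y > a \<bullet> p + \<delta>}" using j by (simp add: \<delta>_def field_simps)
  ultimately obtain B where B: "B \<in> \<B>" "x j \<in> B" "B \<subseteq> {y. a \<bullet> y > a \<bullet> p + \<delta>}"
    using topological_basisE[OF basis] by metis
  obtain c where c: "c > 0" "(\<lambda>n. (1 / real (N n)) * (\<Sum>i<N n. indicator B (x i))) \<longlonglongrightarrow> c"
    using freq[OF B(1,2)] by auto
  have "(\<lambda>n. a \<bullet> ((1 / real (N n)) *\<^sub>R (\<Sum>i<N n. x i)) - a \<bullet> p) \<longlonglongrightarrow> a \<bullet> p - a \<bullet> p"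
    by (intro tendsto_intros avg)
  moreover have "(\<lambda>n. \<delta> * ((1 / real (N n)) * (\<Sum>i<N n. indicator B (x i)))) \<longlonglongrightarrow> \<delta> * c"
    by (intro tendsto_intros c)
  moreover have "\<delta> * ((1 / real (N n)) * (\<Sum>i<N n. indicator B (x i)))
      \<le> a \<bullet> ((1 / real (N n)) *\<^sub>R (\<Sum>i<N n. x i)) - a \<bullet> p" for n
  proof -
    have "(\<Sum>i<N n. \<delta> * indicator B (x i)) \<le> (\<Sum>i<N n. a \<bullet> x i - a \<bullet> p)"
      using xa B(3) \<delta> by (intro sum_mono) (force split: split_indicator)
    then have "(1 / real (N n)) * (\<Sum>i<N n. \<delta> * indicator B (x i)) \<le> (1 / real (N n)) * (\<Sum>i<N n. a \<bullet> x i - a \<bullet> p)"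
      by (intro mult_left_mono) auto
    then show ?thesis
      using N[of n] by (simp add: sum_distrib_left[symmetric] sum_subtractf inner_sum_right field_simps)
  qed
  ultimately have "\<delta> * c \<le> a \<bullet> p - a \<bullet> p"
    by (intro LIMSEQ_le) auto
  then show False using \<delta> c(1) by (simp add: mult_le_0_iff)
qed

section \<open>Conditionally independent copies\<close>

text \<open>\<open>real_cond_exp\<close> is a difference of two \<open>enn2real\<close> values, and
  \<open>enn2real\<close> sends \<infinity> to 0. Agreement therefore rests on almost sure
  finiteness, which follows from the finite integral of \<open>u\<close>.\<close>

lemma (in finite_measure_subalgebra) nn_cond_exp_eq_real_cond_exp:
  assumes u: "integrable M u" and nonneg: "\<And>x. 0 \<le> u x"
  shows "AE x in M. nn_cond_exp M F (\<lambda>x. ennreal (u x)) x = ennreal (real_cond_exp M F u x)"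
proof -
  have [measurable]: "u \<in> borel_measurable M" using u by auto
  have "(\<integral>\<^sup>+x. nn_cond_exp M F (\<lambda>x. ennreal (u x)) x \<partial>M) = (\<integral>\<^sup>+x. ennreal (u x) \<partial>M)"
    using nn_cond_exp_intg[of "\<lambda>_. 1" "\<lambda>x. ennreal (u x)"] by simp
  also have "\<dots> = ennreal (\<integral>x. u x \<partial>M)"
    using u nonneg by (intro nn_integral_eq_integral) auto
  finally have "AE x in M. nn_cond_exp M F (\<lambda>x. ennreal (u x)) x \<noteq> \<infinity>"
    by (intro nn_integral_PInf_AE) auto
  moreover have "AE x in M. 0 = nn_cond_exp M F (\<lambda>x. 0) x"
    by (rule nn_cond_exp_F_meas) auto
  moreover have "(\<lambda>x. ennreal (- u x)) = (\<lambda>x. 0)"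
    using nonneg by (auto simp: ennreal_neg)
  ultimately show ?thesis
    unfolding real_cond_exp_def
    by (auto elim!: AE_mp simp: less_top)
qed

text \<open>In the nonnegative integral the weight \<open>f\<close> may be unbounded or infinite, so
  later swaps of an indicator for its conditional probability need no integrability check.\<close>

lemma (in finite_measure_subalgebra) nn_integral_cond_probability:
  assumes [measurable]: "E \<in> sets M" "f \<in> borel_measurable F"
  shows "(\<integral>\<^sup>+x. f x * indicator E x \<partial>M) = (\<integral>\<^sup>+x. f x * ennreal (cond_probability M F E x) \<partial>M)"
proof -
  have "AE x in M. nn_cond_exp M F (\<lambda>x. ennreal (indicator E x)) x = ennreal (cond_probability M F E x)"
    unfolding cond_probability_def
    by (rule nn_cond_exp_eq_real_cond_exp) (auto simp: integrable_indicator_iff emeasure_finite less_top[symmetric])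
  then have "(\<integral>\<^sup>+x. f x * ennreal (cond_probability M F E x) \<partial>M)
      = (\<integral>\<^sup>+x. f x * nn_cond_exp M F (\<lambda>x. ennreal (indicator E x)) x \<partial>M)"
    by (intro nn_integral_cong_AE) auto
  also have "\<dots> = (\<integral>\<^sup>+x. f x * indicator E x \<partial>M)"
    by (subst nn_cond_exp_intg) (auto simp: ennreal_indicator)
  finally show ?thesis by simp
qed

lemma (in finite_measure) generated_subalgebra:
  assumes "X \<in> measurable M N"
  shows "finite_measure_subalgebra M (generated M N X)"
proof
  show "subalgebra M (generated M N X)"
    using assms by (auto simp: subalgebra_def generated_def sets_vimage_algebra2 measurable_space
        intro: measurable_sets)
qed

lemma measurable_generated:
  assumes "X \<in> measurable M N"
  shows "X \<in> measurable (generated M N X) N"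
  using assms by (auto simp: generated_def intro!: measurable_vimage_algebra1 dest: measurable_space)

lemma sets_generatedE:
  assumes "A \<in> sets (generated M N X)" "X \<in> measurable M N"
  obtains B where "B \<in> sets N" "A = X -` B \<inter> space M"
proof -
  have "A \<in> {X -` B \<inter> space M | B. B \<in> sets N}"
    using assms by (subst (asm) generated_def, subst (asm) sets_vimage_algebra2) (auto dest: measurable_space)
  then show ?thesis using that by auto
qed

section \<open>Joint laws of the copies with the data\<close>

locale conditional_sampling = prob_space M
  for M :: "'a measure" and SD :: "'d measure" and SW :: "'w measure"
    and D :: "'a \<Rightarrow> 'd" and W :: "'a \<Rightarrow> 'w" and Ws :: "nat \<Rightarrow> 'a \<Rightarrow> 'w" +
  assumes D_meas [measurable]: "D \<in> measurable M SD"
    and copies: "cond_iid_copies M (generated M SD D) SW W Ws"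

sublocale conditional_sampling \<subseteq> finite_measure_subalgebra M "generated M SD D"
  using generated_subalgebra[OF D_meas] .

context conditional_sampling
begin

abbreviation F :: "'a measure" where "F \<equiv> generated M SD D"

lemma W_meas [measurable]: "W \<in> measurable M SW"
  and Ws_meas [measurable]: "Ws i \<in> measurable M SW"
  using copies by (auto simp: cond_iid_copies_def)

lemma D_meas_F [measurable]: "D \<in> measurable F SD"
  by (rule measurable_generated) (rule D_meas)

text \<open>Stands in for the conditional law of \<open>W\<close> given \<open>D\<close>. It is not
  a kernel: for each fixed \<open>B\<close> it is one version of a conditional probability, used
  only almost surely and under integrals.\<close>

definition cpW :: "'w set \<Rightarrow> 'a \<Rightarrow> real" where
  "cpW B = cond_probability M F (W -` B \<inter> space M)"

lemma cpW_meas [measurable]: "cpW B \<in> borel_measurable F" "cpW B \<in> borel_measurable M"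
  unfolding cpW_def cond_probability_def by auto

lemma cpW_nonneg:
  assumes "B \<in> sets SW"
  shows "AE \<omega> in M. 0 \<le> cpW B \<omega>"
  unfolding cpW_def cond_probability_def using assms
  by (intro real_cond_exp_pos) auto

text \<open>The right-hand side does not mention \<open>\<sigma>\<close>. The identity thus contains
  conditional independence and exchangeability at once; injectivity ensures that different factors
  use different copies.\<close>

lemma nn_integral_rectangle:
  fixes \<sigma> :: "nat \<Rightarrow> nat"
  assumes J: "finite J" and inj: "inj_on \<sigma> J" and B: "\<And>i. i \<in> J \<Longrightarrow> B i \<in> sets SW"
    and [measurable]: "f \<in> borel_measurable F"
  shows "(\<integral>\<^sup>+\<omega>. f \<omega> * (\<Prod>i\<in>J. indicator (B i) (Ws (\<sigma> i) \<omega>)) \<partial>M)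
       = (\<integral>\<^sup>+\<omega>. f \<omega> * ennreal (\<Prod>i\<in>J. cpW (B i) \<omega>) \<partial>M)"
proof -
  \<comment> \<open>\<open>cond_iid_copies\<close> indexes the sets by the copies themselves, so the
    family \<open>B\<close> is carried along \<open>\<sigma>\<close>.\<close>
  define B' where "B' j = B (inv_into J \<sigma> j)" for j
  have B': "B' (\<sigma> i) = B i" if "i \<in> J" for i
    using that inj by (simp add: B'_def)
  define E where "E = {\<omega> \<in> space M. \<forall>j\<in>\<sigma> ` J. Ws j \<omega> \<in> B' j}"
  have B'm: "B' j \<in> sets SW" if "j \<in> \<sigma> ` J" for j
    using that B B' by auto
  have E[measurable]: "E \<in> sets M"
    unfolding E_def using J B'm by measurable
  have "AE \<omega> in M. cond_probability M F E \<omega> =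
      (\<Prod>j\<in>\<sigma> ` J. cond_probability M F (Ws j -` B' j \<inter> space M) \<omega>)"
    using copies J B'm unfolding cond_iid_copies_def E_def by blast
  moreover have "AE \<omega> in M. \<forall>j\<in>\<sigma> ` J. cond_probability M F (Ws j -` B' j \<inter> space M) \<omega> = cpW (B' j) \<omega>"
    using J B'm copies unfolding cond_iid_copies_def cpW_def
    by (intro AE_finite_allI) auto
  ultimately have ae: "AE \<omega> in M. cond_probability M F E \<omega> = (\<Prod>i\<in>J. cpW (B i) \<omega>)"
  proof eventually_elim
    case (elim \<omega>)
    then have "cond_probability M F E \<omega> = (\<Prod>j\<in>\<sigma> ` J. cpW (B' j) \<omega>)" by simp
    also have "\<dots> = (\<Prod>i\<in>J. cpW (B i) \<omega>)"
      using inj B' by (simp add: prod.reindex)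
    finally show ?case .
  qed
  have "(\<Prod>i\<in>J. indicator (B i) (Ws (\<sigma> i) \<omega>)) = (indicator E \<omega> :: ennreal)"
    if "\<omega> \<in> space M" for \<omega>
  proof (cases "\<omega> \<in> E")
    case True
    then have "\<And>i. i \<in> J \<Longrightarrow> Ws (\<sigma> i) \<omega> \<in> B i" by (auto simp: E_def B')
    then show ?thesis using True by (simp add: prod.neutral)
  next
    case False
    then obtain i where "i \<in> J" "Ws (\<sigma> i) \<omega> \<notin> B i"
      using \<open>\<omega> \<in> space M\<close> by (auto simp: E_def B')
    then show ?thesis using J False by (auto intro!: prod_zero bexI[of _ i])
  qed
  then have "(\<integral>\<^sup>+\<omega>. f \<omega> * (\<Prod>i\<in>J. indicator (B i) (Ws (\<sigma> i) \<omega>)) \<partial>M) = (\<integral>\<^sup>+\<omega>. f \<omega> * indicator E \<omega> \<partial>M)"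
    by (intro nn_integral_cong) auto
  also have "\<dots> = (\<integral>\<^sup>+\<omega>. f \<omega> * ennreal (cond_probability M F E \<omega>) \<partial>M)"
    by (rule nn_integral_cond_probability) auto
  also have "\<dots> = (\<integral>\<^sup>+\<omega>. f \<omega> * ennreal (\<Prod>i\<in>J. cpW (B i) \<omega>) \<partial>M)"
    using ae by (intro nn_integral_cong_AE) auto
  finally show ?thesis .
qed

text \<open>Exchangeability jointly with the data. For a fixed event \<open>C\<close> of the data,
  boxes determine a finite measure on the product space, and \<open>nn_integral_rectangle\<close>
  gives it the same value on boxes for every injective choice of copies. Letting \<open>C\<close>
  vary then settles the pair of tuple and data.\<close>

lemma nn_integral_tuple:
  fixes \<sigma> :: "nat \<Rightarrow> nat"
  assumes inj: "inj_on \<sigma> {..<k}"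
    and \<Psi>: "\<Psi> \<in> borel_measurable (PiM {..<k} (\<lambda>_. SW) \<Otimes>\<^sub>M SD)"
  shows "(\<integral>\<^sup>+\<omega>. \<Psi> (\<lambda>i\<in>{..<k}. Ws (\<sigma> i) \<omega>, D \<omega>) \<partial>M) = (\<integral>\<^sup>+\<omega>. \<Psi> (\<lambda>i\<in>{..<k}. Ws i \<omega>, D \<omega>) \<partial>M)"
proof -
  define V where "V \<tau> \<omega> = (\<lambda>i\<in>{..<k}. Ws (\<tau> i) \<omega>)" for \<tau> \<omega>
  have Vm[measurable]: "V \<tau> \<in> measurable M (PiM {..<k} (\<lambda>_. SW))" for \<tau>
    unfolding V_def by (rule measurable_restrict) simp
  have main: "(\<integral>\<^sup>+\<omega>. 1 * (indicator B (V \<sigma> \<omega>) * indicator C (D \<omega>)) \<partial>M) =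
      (\<integral>\<^sup>+\<omega>. 1 * (indicator B (V (\<lambda>i. i) \<omega>) * indicator C (D \<omega>)) \<partial>M)"
    if [measurable]: "B \<in> sets (PiM {..<k} (\<lambda>_. SW))" "C \<in> sets SD" for B C
  proof -
    define P where "P \<tau> = distr (density M (\<lambda>\<omega>. indicator C (D \<omega>))) (PiM {..<k} (\<lambda>_. SW)) (V \<tau>)" for \<tau>
    have eP: "emeasure (P \<tau>) A = (\<integral>\<^sup>+\<omega>. indicator C (D \<omega>) * indicator A (V \<tau> \<omega>) \<partial>M)"
      if [measurable]: "A \<in> sets (PiM {..<k} (\<lambda>_. SW))" for A \<tau>
    proof -
      have "emeasure (P \<tau>) A = (\<integral>\<^sup>+x. indicator A x \<partial>P \<tau>)"
        by (rule nn_integral_indicator[symmetric]) (simp add: P_def)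
      also have "\<dots> = (\<integral>\<^sup>+\<omega>. indicator C (D \<omega>) * indicator A (V \<tau> \<omega>) \<partial>M)"
        unfolding P_def by (simp add: nn_integral_distr nn_integral_density del: nn_integral_indicator)
      finally show ?thesis .
    qed
    have rect: "emeasure (P \<tau>) (Pi\<^sub>E {..<k} A) =
        (\<integral>\<^sup>+\<omega>. indicator C (D \<omega>) * ennreal (\<Prod>i<k. cpW (A i) \<omega>) \<partial>M)"
      if \<tau>: "inj_on \<tau> {..<k}" and A: "\<And>i. i \<in> {..<k} \<Longrightarrow> A i \<in> sets SW" for A \<tau>
    proof -
      have ind: "indicator (Pi\<^sub>E {..<k} A) (V \<tau> \<omega>) = (\<Prod>i<k. indicator (A i) (Ws (\<tau> i) \<omega>) :: ennreal)" for \<omega>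
      proof (cases "\<forall>i<k. Ws (\<tau> i) \<omega> \<in> A i")
        case True
        then have "V \<tau> \<omega> \<in> Pi\<^sub>E {..<k} A" by (auto simp: V_def)
        then show ?thesis using True by (simp add: prod.neutral)
      next
        case False
        then obtain i where i: "i < k" "Ws (\<tau> i) \<omega> \<notin> A i" by auto
        then have "V \<tau> \<omega> \<notin> Pi\<^sub>E {..<k} A" by (auto simp: V_def PiE_def Pi_def)
        moreover have "(\<Prod>i<k. indicator (A i) (Ws (\<tau> i) \<omega>)) = (0 :: ennreal)"
          using i by (intro prod_zero bexI[of _ i]) auto
        ultimately show ?thesis by simp
      qed
      have "emeasure (P \<tau>) (Pi\<^sub>E {..<k} A) = (\<integral>\<^sup>+\<omega>. indicator C (D \<omega>) * indicator (Pi\<^sub>E {..<k} A) (V \<tau> \<omega>) \<partial>M)"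
        by (intro eP sets_PiM_I_finite) (use A in auto)
      also have "\<dots> = (\<integral>\<^sup>+\<omega>. indicator C (D \<omega>) * ennreal (\<Prod>i<k. cpW (A i) \<omega>) \<partial>M)"
        unfolding ind by (rule nn_integral_rectangle) (use \<tau> A in auto)
      finally show ?thesis .
    qed
    have "P \<sigma> = P (\<lambda>i. i)"
    proof (rule measure_eqI_PiM_finite[of "{..<k}" _ "\<lambda>_. SW" _ "\<lambda>_. \<Pi>\<^sub>E i\<in>{..<k}. space SW"])
      show "emeasure (P \<sigma>) (Pi\<^sub>E {..<k} A) = emeasure (P (\<lambda>i. i)) (Pi\<^sub>E {..<k} A)"
        if "\<And>i. i \<in> {..<k} \<Longrightarrow> A i \<in> sets SW" for A
        using rect[OF inj that] rect[OF _ that, of "\<lambda>i. i"] by simp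
      show "range (\<lambda>_. \<Pi>\<^sub>E i\<in>{..<k}. space SW) \<subseteq> prod_algebra {..<k} (\<lambda>_. SW)"
        by (auto intro!: prod_algebraI_finite)
      show "(\<Union>i. \<Pi>\<^sub>E i\<in>{..<k}. space SW) = space (PiM {..<k} (\<lambda>_. SW))"
        by (simp add: space_PiM)
      have "emeasure (P \<sigma>) (\<Pi>\<^sub>E i\<in>{..<k}. space SW) \<le> (\<integral>\<^sup>+\<omega>. 1 \<partial>M)"
        unfolding eP[OF sets_PiM_I_finite[OF finite_lessThan sets.top]]
        by (intro nn_integral_mono) (auto split: split_indicator)
      then show "emeasure (P \<sigma>) (\<Pi>\<^sub>E i\<in>{..<k}. space SW) \<noteq> \<infinity>"
        by (auto simp: emeasure_space_1 top_unique)
    qed (auto simp: P_def)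
    then have "emeasure (P \<sigma>) B = emeasure (P (\<lambda>i. i)) B" by simp
    then show ?thesis by (simp add: eP mult.commute)
  qed
  have "(\<integral>\<^sup>+\<omega>. 1 * \<Psi> (V \<sigma> \<omega>, D \<omega>) \<partial>M) = (\<integral>\<^sup>+\<omega>. 1 * \<Psi> (V (\<lambda>i. i) \<omega>, D \<omega>) \<partial>M)"
    by (rule nn_integral_pair_eqI[where N="PiM {..<k} (\<lambda>_. SW)" and S=SD])
       (use main \<Psi> in \<open>auto simp: emeasure_space_1\<close>)
  then show ?thesis by (simp add: V_def)
qed

text \<open>Joint laws with \<open>D\<close> are needed, not just marginal laws. They agree on
  rectangles because \<open>cpW\<close> is the conditional law given \<open>D\<close> of every copy
  and of \<open>W\<close>.\<close>

lemma distr_Ws: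
  "distr M (SW \<Otimes>\<^sub>M SD) (\<lambda>\<omega>. (Ws i \<omega>, D \<omega>)) = distr M (SW \<Otimes>\<^sub>M SD) (\<lambda>\<omega>. (W \<omega>, D \<omega>))"
proof (rule measure_eqI)
  fix E assume "E \<in> sets (distr M (SW \<Otimes>\<^sub>M SD) (\<lambda>\<omega>. (Ws i \<omega>, D \<omega>)))"
  then have [measurable]: "E \<in> sets (SW \<Otimes>\<^sub>M SD)" by simp
  have e: "emeasure (distr M (SW \<Otimes>\<^sub>M SD) (\<lambda>\<omega>. (V \<omega>, D \<omega>))) E = (\<integral>\<^sup>+\<omega>. 1 * indicator E (V \<omega>, D \<omega>) \<partial>M)"
    if [measurable]: "V \<in> measurable M SW" for V
  proof -
    have "emeasure (distr M (SW \<Otimes>\<^sub>M SD) (\<lambda>\<omega>. (V \<omega>, D \<omega>))) E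
        = (\<integral>\<^sup>+x. indicator E x \<partial>distr M (SW \<Otimes>\<^sub>M SD) (\<lambda>\<omega>. (V \<omega>, D \<omega>)))"
      by (rule nn_integral_indicator[symmetric]) simp
    then show ?thesis by (simp add: nn_integral_distr del: nn_integral_indicator)
  qed
  have c: "(\<integral>\<^sup>+\<omega>. 1 * (indicator B (Ws i \<omega>) * indicator C (D \<omega>)) \<partial>M) =
      (\<integral>\<^sup>+\<omega>. 1 * (indicator B (W \<omega>) * indicator C (D \<omega>)) \<partial>M)"
    if [measurable]: "B \<in> sets SW" "C \<in> sets SD" for B C
  proof -
    \<comment> \<open>A product over \<open>{0}\<close> writes a single factor in the shape of
      \<open>nn_integral_rectangle\<close>.\<close>
    have "(\<integral>\<^sup>+\<omega>. 1 * (indicator B (Ws i \<omega>) * indicator C (D \<omega>)) \<partial>M) =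
       (\<integral>\<^sup>+\<omega>. indicator C (D \<omega>) * (\<Prod>j\<in>{0::nat}. indicator B (Ws i \<omega>)) \<partial>M)"
      by (simp add: mult.commute)
    also have "\<dots> = (\<integral>\<^sup>+\<omega>. indicator C (D \<omega>) * ennreal (\<Prod>j\<in>{0::nat}. cpW B \<omega>) \<partial>M)"
      by (rule nn_integral_rectangle[where \<sigma>="\<lambda>_. i"]) auto
    also have "\<dots> = (\<integral>\<^sup>+\<omega>. indicator C (D \<omega>) * ennreal (cpW B \<omega>) \<partial>M)" by simp
    also have "\<dots> = (\<integral>\<^sup>+\<omega>. indicator C (D \<omega>) * indicator (W -` B \<inter> space M) \<omega> \<partial>M)"
      unfolding cpW_def by (rule nn_integral_cond_probability[symmetric]) auto
    also have "\<dots> = (\<integral>\<^sup>+\<omega>. 1 * (indicator B (W \<omega>) * indicator C (D \<omega>)) \<partial>M)"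
      by (intro nn_integral_cong) (auto split: split_indicator)
    finally show ?thesis .
  qed
  show "emeasure (distr M (SW \<Otimes>\<^sub>M SD) (\<lambda>\<omega>. (Ws i \<omega>, D \<omega>))) E
      = emeasure (distr M (SW \<Otimes>\<^sub>M SD) (\<lambda>\<omega>. (W \<omega>, D \<omega>))) E"
    unfolding e[OF Ws_meas] e[OF W_meas]
    by (rule nn_integral_pair_eqI[where N=SW and S=SD]) (use c in \<open>auto simp: emeasure_space_1\<close>)
qed simp

lemma integrable_Ws:
  fixes \<psi> :: "'w \<times> 'd \<Rightarrow> 'b::{banach, second_countable_topology}"
  assumes [measurable]: "\<psi> \<in> borel_measurable (SW \<Otimes>\<^sub>M SD)"
  shows "integrable M (\<lambda>\<omega>. \<psi> (Ws i \<omega>, D \<omega>)) \<longleftrightarrow> integrable M (\<lambda>\<omega>. \<psi> (W \<omega>, D \<omega>))"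
  using arg_cong[OF distr_Ws[of i], of "\<lambda>P. integrable P \<psi>"]
  by (simp add: integrable_distr_eq)

lemma integral_Ws:
  fixes \<psi> :: "'w \<times> 'd \<Rightarrow> 'b::{banach, second_countable_topology}"
  assumes [measurable]: "\<psi> \<in> borel_measurable (SW \<Otimes>\<^sub>M SD)"
  shows "(\<integral>\<omega>. \<psi> (Ws i \<omega>, D \<omega>) \<partial>M) = (\<integral>\<omega>. \<psi> (W \<omega>, D \<omega>) \<partial>M)"
  using arg_cong[OF distr_Ws[of i], of "\<lambda>P. integral\<^sup>L P \<psi>"]
  by (simp add: integral_distr)

lemma AE_Ws:
  assumes [measurable]: "Measurable.pred (SW \<Otimes>\<^sub>M SD) P"
  shows "(AE \<omega> in M. P (Ws i \<omega>, D \<omega>)) \<longleftrightarrow> (AE \<omega> in M. P (W \<omega>, D \<omega>))"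
  using arg_cong[OF distr_Ws[of i], of "\<lambda>Q. AE x in Q. P x"]
  by (simp add: AE_distr_iff)

text \<open>Events of \<open>F\<close> are preimages under \<open>D\<close>, so their indicators can
  be absorbed into a function of the pair, where equality of the joint laws applies.\<close>

lemma real_cond_exp_Ws:
  fixes \<psi> :: "'w \<times> 'd \<Rightarrow> real"
  assumes [measurable]: "\<psi> \<in> borel_measurable (SW \<Otimes>\<^sub>M SD)"
    and int: "integrable M (\<lambda>\<omega>. \<psi> (W \<omega>, D \<omega>))"
  shows "AE \<omega> in M. real_cond_exp M F (\<lambda>\<omega>. \<psi> (Ws i \<omega>, D \<omega>)) \<omega> =
    real_cond_exp M F (\<lambda>\<omega>. \<psi> (W \<omega>, D \<omega>)) \<omega>"
proof (rule real_cond_exp_charact)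
  fix A assume A: "A \<in> sets F"
  obtain C where [measurable]: "C \<in> sets SD" and AC: "A = D -` C \<inter> space M"
    using sets_generatedE[OF A D_meas] .
  have "(\<integral>\<omega>\<in>A. \<psi> (Ws i \<omega>, D \<omega>) \<partial>M) = (\<integral>\<omega>. (\<lambda>(w, d). indicator C d * \<psi> (w, d)) (Ws i \<omega>, D \<omega>) \<partial>M)"
    unfolding set_lebesgue_integral_def AC
    by (intro Bochner_Integration.integral_cong) (auto split: split_indicator)
  also have "\<dots> = (\<integral>\<omega>. (\<lambda>(w, d). indicator C d * \<psi> (w, d)) (W \<omega>, D \<omega>) \<partial>M)"
    by (rule integral_Ws) measurable
  also have "\<dots> = (\<integral>\<omega>\<in>A. \<psi> (W \<omega>, D \<omega>) \<partial>M)"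
    unfolding set_lebesgue_integral_def AC
    by (intro Bochner_Integration.integral_cong) (auto split: split_indicator)
  also have "\<dots> = (\<integral>\<omega>\<in>A. real_cond_exp M F (\<lambda>\<omega>. \<psi> (W \<omega>, D \<omega>)) \<omega> \<partial>M)"
    using int A by (rule real_cond_exp_intA)
  finally show "(\<integral>\<omega>\<in>A. \<psi> (Ws i \<omega>, D \<omega>) \<partial>M) =
    (\<integral>\<omega>\<in>A. real_cond_exp M F (\<lambda>\<omega>. \<psi> (W \<omega>, D \<omega>)) \<omega> \<partial>M)" .
qed (use int in \<open>auto simp: integrable_Ws\<close>)

section \<open>Conditioning on one member together with the data\<close>

text \<open>Given \<open>G i\<close>, member \<open>i\<close> is known while every other member
  still averages to its conditional mean given \<open>D\<close>. This serves both the variance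
  estimate and the case of equality.\<close>

abbreviation G :: "nat \<Rightarrow> 'a measure" where
  "G i \<equiv> generated M (SW \<Otimes>\<^sub>M SD) (\<lambda>\<omega>. (Ws i \<omega>, D \<omega>))"

lemma subalg_G: "finite_measure_subalgebra M (G i)"
  by (rule generated_subalgebra) measurable

lemma measurable_G:
  assumes "f \<in> measurable (SW \<Otimes>\<^sub>M SD) N"
  shows "(\<lambda>\<omega>. f (Ws i \<omega>, D \<omega>)) \<in> measurable (G i) N"
  using measurable_compose[OF measurable_generated assms, of "\<lambda>\<omega>. (Ws i \<omega>, D \<omega>)" M] by simp

lemma subalgebra_G_F: "subalgebra (G i) F"
  unfolding subalgebra_def
proof (intro conjI subsetI)
  show "space F = space (G i)" by (simp add: generated_def)
  fix A assume "A \<in> sets F"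
  then obtain C where [measurable]: "C \<in> sets SD" and AC: "A = D -` C \<inter> space M"
    by (rule sets_generatedE[OF _ D_meas])
  have "(\<lambda>\<omega>. (Ws i \<omega>, D \<omega>)) -` (space SW \<times> C) \<inter> space M \<in> sets (G i)"
    unfolding generated_def by (rule in_vimage_algebra) simp
  moreover have "(\<lambda>\<omega>. (Ws i \<omega>, D \<omega>)) -` (space SW \<times> C) \<inter> space M = A"
    using measurable_space[OF Ws_meas[of i]] by (auto simp: AC)
  ultimately show "A \<in> sets (G i)" by simp
qed

text \<open>It suffices to let \<open>\<kappa>\<close> be the indicator of a rectangle. Then three
  swaps do it: \<open>indicator B (Ws i \<omega>)\<close> becomes \<open>cpW B \<omega>\<close> (by
  \<open>rect\<close>, a comparison of laws in the variable \<open>Ws j\<close>); the remaining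
  weight is \<open>F\<close>-measurable, so the \<open>\<psi>\<close> term may be replaced by its
  conditional mean; finally \<open>cpW B \<omega>\<close> is turned back into the indicator.\<close>

lemma nn_integral_cond_indep:
  fixes \<psi> :: "'w \<times> 'd \<Rightarrow> real"
  assumes ij: "i \<noteq> j" and [measurable]: "\<psi> \<in> borel_measurable (SW \<Otimes>\<^sub>M SD)"
    and nonneg: "\<And>x. 0 \<le> \<psi> x" and int: "integrable M (\<lambda>\<omega>. \<psi> (W \<omega>, D \<omega>))"
    and [measurable]: "\<kappa> \<in> borel_measurable (SW \<Otimes>\<^sub>M SD)"
  shows "(\<integral>\<^sup>+\<omega>. ennreal (\<psi> (Ws j \<omega>, D \<omega>)) * \<kappa> (Ws i \<omega>, D \<omega>) \<partial>M) =
    (\<integral>\<^sup>+\<omega>. ennreal (real_cond_exp M F (\<lambda>\<omega>. \<psi> (W \<omega>, D \<omega>)) \<omega>) * \<kappa> (Ws i \<omega>, D \<omega>) \<partial>M)"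
proof (rule nn_integral_pair_eqI[where N=SW and S=SD])
  let ?g = "real_cond_exp M F (\<lambda>\<omega>. \<psi> (W \<omega>, D \<omega>))"
  have intj: "integrable M (\<lambda>\<omega>. \<psi> (Ws j \<omega>, D \<omega>))" using int by (simp add: integrable_Ws)
  show "(\<integral>\<^sup>+\<omega>. ennreal (\<psi> (Ws j \<omega>, D \<omega>)) \<partial>M) \<noteq> \<infinity>"
    using nonneg by (subst nn_integral_eq_integral[OF intj]) auto
  fix B C assume B[measurable]: "B \<in> sets SW" and C[measurable]: "C \<in> sets SD"
  have rect: "(\<integral>\<^sup>+\<omega>. (indicator B (Ws i \<omega>) * indicator C (D \<omega>)) * (indicator B' (Ws j \<omega>) * indicator C' (D \<omega>)) \<partial>M)
     = (\<integral>\<^sup>+\<omega>. (ennreal (cpW B \<omega>) * indicator C (D \<omega>)) * (indicator B' (Ws j \<omega>) * indicator C' (D \<omega>)) \<partial>M)"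
    if [measurable]: "B' \<in> sets SW" "C' \<in> sets SD" for B' C'
  proof -
    define \<sigma> where "\<sigma> k = (if k = (0::nat) then i else j)" for k
    define BB where "BB k = (if k = (0::nat) then B else B')" for k
    have "(\<integral>\<^sup>+\<omega>. (indicator B (Ws i \<omega>) * indicator C (D \<omega>)) * (indicator B' (Ws j \<omega>) * indicator C' (D \<omega>)) \<partial>M)
        = (\<integral>\<^sup>+\<omega>. (indicator C (D \<omega>) * indicator C' (D \<omega>)) * (\<Prod>k\<in>{0,1}. indicator (BB k) (Ws (\<sigma> k) \<omega>)) \<partial>M)"
      by (simp add: \<sigma>_def BB_def ac_simps)
    also have "\<dots> = (\<integral>\<^sup>+\<omega>. (indicator C (D \<omega>) * indicator C' (D \<omega>)) * ennreal (\<Prod>k\<in>{0,1}. cpW (BB k) \<omega>) \<partial>M)"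
      by (rule nn_integral_rectangle) (use ij in \<open>auto simp: \<sigma>_def BB_def\<close>)
    also have "\<dots> = (\<integral>\<^sup>+\<omega>. (ennreal (cpW B \<omega>) * indicator C (D \<omega>) * indicator C' (D \<omega>)) * ennreal (\<Prod>k\<in>{0::nat}. cpW B' \<omega>) \<partial>M)"
    proof (rule nn_integral_cong_AE)
      show "AE \<omega> in M. (indicator C (D \<omega>) * indicator C' (D \<omega>)) * ennreal (\<Prod>k\<in>{0,1}. cpW (BB k) \<omega>) =
        (ennreal (cpW B \<omega>) * indicator C (D \<omega>) * indicator C' (D \<omega>)) * ennreal (\<Prod>k\<in>{0::nat}. cpW B' \<omega>)"
        using cpW_nonneg[OF B]
        by eventually_elim (simp add: BB_def ennreal_mult' mult.assoc mult.left_commute)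
    qed
    also have "\<dots> = (\<integral>\<^sup>+\<omega>. (ennreal (cpW B \<omega>) * indicator C (D \<omega>) * indicator C' (D \<omega>)) * (\<Prod>k\<in>{0::nat}. indicator B' (Ws j \<omega>)) \<partial>M)"
      by (rule nn_integral_rectangle[where \<sigma>="\<lambda>_. j", symmetric]) auto
    finally show ?thesis by (simp add: ac_simps)
  qed
  have fin: "(\<integral>\<^sup>+\<omega>. indicator B (Ws i \<omega>) * indicator C (D \<omega>) \<partial>M) \<noteq> \<infinity>"
  proof -
    have "(\<integral>\<^sup>+\<omega>. indicator B (Ws i \<omega>) * indicator C (D \<omega>) \<partial>M) \<le> (\<integral>\<^sup>+\<omega>. 1 \<partial>M)"
      by (intro nn_integral_mono) (auto split: split_indicator)
    then show ?thesis by (auto simp: emeasure_space_1 top_unique)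
  qed
  have "(\<integral>\<^sup>+\<omega>. ennreal (\<psi> (Ws j \<omega>, D \<omega>)) * (indicator B (Ws i \<omega>) * indicator C (D \<omega>)) \<partial>M)
      = (\<integral>\<^sup>+\<omega>. (indicator B (Ws i \<omega>) * indicator C (D \<omega>)) * ennreal (\<psi> (Ws j \<omega>, D \<omega>)) \<partial>M)"
    by (simp add: mult.commute)
  also have "\<dots> = (\<integral>\<^sup>+\<omega>. (ennreal (cpW B \<omega>) * indicator C (D \<omega>)) * ennreal (\<psi> (Ws j \<omega>, D \<omega>)) \<partial>M)"
    by (rule nn_integral_pair_eqI[where N=SW and S=SD and \<psi>="\<lambda>x. ennreal (\<psi> x)"]) (use rect fin in auto)
  also have "\<dots> = (\<integral>\<^sup>+\<omega>. (ennreal (cpW B \<omega>) * indicator C (D \<omega>)) * nn_cond_exp M F (\<lambda>\<omega>. ennreal (\<psi> (Ws j \<omega>, D \<omega>))) \<omega> \<partial>M)"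
    by (rule nn_cond_exp_intg[symmetric]) auto
  also have "\<dots> = (\<integral>\<^sup>+\<omega>. (ennreal (?g \<omega>) * indicator C (D \<omega>)) * ennreal (\<Prod>k\<in>{0::nat}. cpW B \<omega>) \<partial>M)"
  proof (rule nn_integral_cong_AE)
    have "AE \<omega> in M. nn_cond_exp M F (\<lambda>\<omega>. ennreal (\<psi> (Ws j \<omega>, D \<omega>))) \<omega>
        = ennreal (real_cond_exp M F (\<lambda>\<omega>. \<psi> (Ws j \<omega>, D \<omega>)) \<omega>)"
      by (rule nn_cond_exp_eq_real_cond_exp[OF intj nonneg])
    then show "AE \<omega> in M. (ennreal (cpW B \<omega>) * indicator C (D \<omega>)) * nn_cond_exp M F (\<lambda>\<omega>. ennreal (\<psi> (Ws j \<omega>, D \<omega>))) \<omega>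
        = (ennreal (?g \<omega>) * indicator C (D \<omega>)) * ennreal (\<Prod>k\<in>{0::nat}. cpW B \<omega>)"
      using real_cond_exp_Ws[OF _ int, of j] by (auto simp: ac_simps)
  qed
  also have "\<dots> = (\<integral>\<^sup>+\<omega>. (ennreal (?g \<omega>) * indicator C (D \<omega>)) * (\<Prod>k\<in>{0::nat}. indicator B (Ws i \<omega>)) \<partial>M)"
    by (rule nn_integral_rectangle[where \<sigma>="\<lambda>_. i", symmetric]) auto
  finally show "(\<integral>\<^sup>+\<omega>. ennreal (\<psi> (Ws j \<omega>, D \<omega>)) * (indicator B (Ws i \<omega>) * indicator C (D \<omega>)) \<partial>M) =
      (\<integral>\<^sup>+\<omega>. ennreal (?g \<omega>) * (indicator B (Ws i \<omega>) * indicator C (D \<omega>)) \<partial>M)"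
    by (simp add: ac_simps)
qed auto

lemma real_cond_exp_G_nonneg:
  fixes \<psi> :: "'w \<times> 'd \<Rightarrow> real"
  assumes ij: "i \<noteq> j" and [measurable]: "\<psi> \<in> borel_measurable (SW \<Otimes>\<^sub>M SD)"
    and nonneg: "\<And>x. 0 \<le> \<psi> x" and int: "integrable M (\<lambda>\<omega>. \<psi> (W \<omega>, D \<omega>))"
  shows "AE \<omega> in M. real_cond_exp M (G i) (\<lambda>\<omega>. \<psi> (Ws j \<omega>, D \<omega>)) \<omega> =
    real_cond_exp M F (\<lambda>\<omega>. \<psi> (W \<omega>, D \<omega>)) \<omega>"
proof -
  interpret G: finite_measure_subalgebra M "G i" by (rule subalg_G)
  let ?g = "real_cond_exp M F (\<lambda>\<omega>. \<psi> (W \<omega>, D \<omega>))"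
  have intj: "integrable M (\<lambda>\<omega>. \<psi> (Ws j \<omega>, D \<omega>))" using int by (simp add: integrable_Ws)
  have g0: "AE \<omega> in M. 0 \<le> ?g \<omega>" using nonneg by (intro real_cond_exp_pos) auto
  show ?thesis
  proof (rule G.real_cond_exp_charact)
    fix A assume A: "A \<in> sets (G i)"
    then have [measurable]: "A \<in> sets M" using G.subalg by (auto simp: subalgebra_def)
    obtain E where [measurable]: "E \<in> sets (SW \<Otimes>\<^sub>M SD)" and AE: "A = (\<lambda>\<omega>. (Ws i \<omega>, D \<omega>)) -` E \<inter> space M"
      by (rule sets_generatedE[OF A]) measurable
    have nn: "ennreal (\<integral>\<omega>\<in>A. u \<omega> \<partial>M) = (\<integral>\<^sup>+\<omega>. ennreal (u \<omega>) * indicator E (Ws i \<omega>, D \<omega>) \<partial>M)"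
      if "integrable M u" "AE \<omega> in M. 0 \<le> u \<omega>" for u
    proof -
      have "ennreal (\<integral>\<omega>. indicator A \<omega> * u \<omega> \<partial>M) = (\<integral>\<^sup>+\<omega>. ennreal (indicator A \<omega> * u \<omega>) \<partial>M)"
        using that integrable_mult_indicator[of A M u]
        by (intro nn_integral_eq_integral[symmetric]) auto
      also have "\<dots> = (\<integral>\<^sup>+\<omega>. ennreal (u \<omega>) * indicator E (Ws i \<omega>, D \<omega>) \<partial>M)"
        by (intro nn_integral_cong) (auto simp: AE split: split_indicator)
      finally show ?thesis by (simp add: set_lebesgue_integral_def)
    qed
    have "ennreal (\<integral>\<omega>\<in>A. \<psi> (Ws j \<omega>, D \<omega>) \<partial>M) = ennreal (\<integral>\<omega>\<in>A. ?g \<omega> \<partial>M)"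
      using nn[OF intj] nn[OF real_cond_exp_int(1)[OF int] g0]
        nn_integral_cond_indep[OF ij _ nonneg int, of "indicator E"] nonneg by simp
    moreover have "0 \<le> (\<integral>\<omega>\<in>A. \<psi> (Ws j \<omega>, D \<omega>) \<partial>M)" "0 \<le> (\<integral>\<omega>\<in>A. ?g \<omega> \<partial>M)"
      unfolding set_lebesgue_integral_def using g0 nonneg by (auto intro!: integral_nonneg_AE)
    ultimately show "(\<integral>\<omega>\<in>A. \<psi> (Ws j \<omega>, D \<omega>) \<partial>M) = (\<integral>\<omega>\<in>A. ?g \<omega> \<partial>M)" by simp
  qed (use intj int in \<open>auto intro!: measurable_from_subalg[OF subalgebra_G_F]\<close>)
qed

lemma real_cond_exp_G:
  fixes \<psi> :: "'w \<times> 'd \<Rightarrow> real"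
  assumes ij: "i \<noteq> j" and [measurable]: "\<psi> \<in> borel_measurable (SW \<Otimes>\<^sub>M SD)"
    and int: "integrable M (\<lambda>\<omega>. \<psi> (W \<omega>, D \<omega>))"
  shows "AE \<omega> in M. real_cond_exp M (G i) (\<lambda>\<omega>. \<psi> (Ws j \<omega>, D \<omega>)) \<omega> =
    real_cond_exp M F (\<lambda>\<omega>. \<psi> (W \<omega>, D \<omega>)) \<omega>"
proof -
  interpret G: finite_measure_subalgebra M "G i" by (rule subalg_G)
  let ?p = "\<lambda>x. max 0 (\<psi> x)" and ?m = "\<lambda>x. max 0 (- \<psi> x)"
  have split: "\<psi> x = ?p x - ?m x" for x by auto
  have p: "integrable M (\<lambda>\<omega>. ?p (W \<omega>, D \<omega>))" and m: "integrable M (\<lambda>\<omega>. ?m (W \<omega>, D \<omega>))"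
    using int by auto
  have pj: "integrable M (\<lambda>\<omega>. ?p (Ws j \<omega>, D \<omega>))" and mj: "integrable M (\<lambda>\<omega>. ?m (Ws j \<omega>, D \<omega>))"
    using p m by (simp_all add: integrable_Ws[of ?p] integrable_Ws[of ?m])
  have "AE \<omega> in M. real_cond_exp M (G i) (\<lambda>\<omega>. ?p (Ws j \<omega>, D \<omega>)) \<omega> = real_cond_exp M F (\<lambda>\<omega>. ?p (W \<omega>, D \<omega>)) \<omega>"
    using p by (intro real_cond_exp_G_nonneg[OF ij, of ?p]) auto
  moreover have "AE \<omega> in M. real_cond_exp M (G i) (\<lambda>\<omega>. ?m (Ws j \<omega>, D \<omega>)) \<omega> = real_cond_exp M F (\<lambda>\<omega>. ?m (W \<omega>, D \<omega>)) \<omega>"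
    using m by (intro real_cond_exp_G_nonneg[OF ij, of ?m]) auto
  moreover have "AE \<omega> in M. real_cond_exp M (G i) (\<lambda>\<omega>. ?p (Ws j \<omega>, D \<omega>) - ?m (Ws j \<omega>, D \<omega>)) \<omega> =
      real_cond_exp M (G i) (\<lambda>\<omega>. ?p (Ws j \<omega>, D \<omega>)) \<omega> - real_cond_exp M (G i) (\<lambda>\<omega>. ?m (Ws j \<omega>, D \<omega>)) \<omega>"
    by (rule G.real_cond_exp_diff[OF pj mj])
  moreover have "AE \<omega> in M. real_cond_exp M F (\<lambda>\<omega>. ?p (W \<omega>, D \<omega>) - ?m (W \<omega>, D \<omega>)) \<omega> =
      real_cond_exp M F (\<lambda>\<omega>. ?p (W \<omega>, D \<omega>)) \<omega> - real_cond_exp M F (\<lambda>\<omega>. ?m (W \<omega>, D \<omega>)) \<omega>"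
    by (rule real_cond_exp_diff[OF p m])
  ultimately show ?thesis
    unfolding split[symmetric] by eventually_elim simp
qed

end

section \<open>Law of large numbers\<close>

context conditional_sampling
begin

text \<open>The function \<open>\<psi>\<close> is left general because the law of large numbers is
  applied to the coordinates of the prediction, to \<open>A\<close> of the prediction, and to
  indicators of basic open sets.\<close>

definition sample_mean :: "('w \<times> 'd \<Rightarrow> 'b::real_vector) \<Rightarrow> nat \<Rightarrow> 'a \<Rightarrow> 'b" where
  "sample_mean \<psi> k \<omega> = (1 / real k) *\<^sub>R (\<Sum>i<k. \<psi> (Ws i \<omega>, D \<omega>))"

abbreviation cmean :: "('w \<times> 'd \<Rightarrow> real) \<Rightarrow> 'a \<Rightarrow> real" where
  "cmean \<psi> \<equiv> real_cond_exp M F (\<lambda>\<omega>. \<psi> (W \<omega>, D \<omega>))"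

lemma sample_mean_measurable [measurable]:
  fixes \<psi> :: "'w \<times> 'd \<Rightarrow> 'b::euclidean_space"
  assumes [measurable]: "\<psi> \<in> borel_measurable (SW \<Otimes>\<^sub>M SD)"
  shows "sample_mean \<psi> k \<in> borel_measurable M"
  unfolding sample_mean_def by measurable

lemma integrable_sample_mean:
  fixes \<psi> :: "'w \<times> 'd \<Rightarrow> 'b::euclidean_space"
  assumes "\<psi> \<in> borel_measurable (SW \<Otimes>\<^sub>M SD)" "integrable M (\<lambda>\<omega>. \<psi> (W \<omega>, D \<omega>))"
  shows "integrable M (sample_mean \<psi> k)"
  unfolding sample_mean_def[abs_def] using assms by (simp add: integrable_Ws)

lemma integral_sample_mean:
  fixes \<psi> :: "'w \<times> 'd \<Rightarrow> 'b::euclidean_space"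
  assumes "\<psi> \<in> borel_measurable (SW \<Otimes>\<^sub>M SD)" "integrable M (\<lambda>\<omega>. \<psi> (W \<omega>, D \<omega>))" "0 < k"
  shows "(\<integral>\<omega>. sample_mean \<psi> k \<omega> \<partial>M) = (\<integral>\<omega>. \<psi> (W \<omega>, D \<omega>) \<partial>M)"
proof -
  have "(\<integral>\<omega>. sample_mean \<psi> k \<omega> \<partial>M) = (1 / real k) *\<^sub>R (\<Sum>i<k. \<integral>\<omega>. \<psi> (Ws i \<omega>, D \<omega>) \<partial>M)"
    unfolding sample_mean_def using assms by (simp add: integrable_Ws)
  also have "\<dots> = (\<integral>\<omega>. \<psi> (W \<omega>, D \<omega>) \<partial>M)"
    using assms by (simp add: integral_Ws sum_constant_scaleR del: sum_constant)
  finally show ?thesis .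
qed

lemma cmean_bounded:
  assumes [measurable]: "\<psi> \<in> borel_measurable (SW \<Otimes>\<^sub>M SD)" and K: "\<And>x. \<bar>\<psi> x\<bar> \<le> K"
  shows "AE \<omega> in M. \<bar>cmean \<psi> \<omega>\<bar> \<le> K"
proof -
  have i: "integrable M (\<lambda>\<omega>. \<psi> (W \<omega>, D \<omega>))"
    using K by (intro integrable_const_bound[of _ K]) auto
  have "AE \<omega> in M. cmean \<psi> \<omega> \<le> K"
    using K by (intro real_cond_exp_le_c[OF i]) (auto simp: abs_le_iff)
  moreover have "AE \<omega> in M. cmean \<psi> \<omega> \<ge> - K"
  proof (intro real_cond_exp_ge_c[OF i] AE_I2)
    show "- K \<le> \<psi> (W \<omega>, D \<omega>)" for \<omega>
      using K[of "(W \<omega>, D \<omega>)"] by linarith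
  qed
  ultimately show ?thesis by eventually_elim auto
qed

text \<open>Conditioned on \<open>G i\<close>, the first factor is known, since \<open>F\<close> is
  contained in \<open>G i\<close>, and the second has conditional mean 0.\<close>

lemma centered_orthogonal:
  assumes ij: "i \<noteq> j" and [measurable]: "\<psi> \<in> borel_measurable (SW \<Otimes>\<^sub>M SD)" and K: "\<And>x. \<bar>\<psi> x\<bar> \<le> K"
  shows "(\<integral>\<omega>. (\<psi> (Ws i \<omega>, D \<omega>) - cmean \<psi> \<omega>) * (\<psi> (Ws j \<omega>, D \<omega>) - cmean \<psi> \<omega>) \<partial>M) = 0"
proof -
  interpret G: finite_measure_subalgebra M "G i" by (rule subalg_G)
  let ?c = "\<lambda>j \<omega>. \<psi> (Ws j \<omega>, D \<omega>) - cmean \<psi> \<omega>"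
  have i: "integrable M (\<lambda>\<omega>. \<psi> (W \<omega>, D \<omega>))"
    using K by (intro integrable_const_bound[of _ K]) auto
  have gG: "cmean \<psi> \<in> borel_measurable (G i)"
    by (rule measurable_from_subalg[OF subalgebra_G_F]) measurable
  have "AE \<omega> in M. real_cond_exp M (G i) (?c j) \<omega> =
      real_cond_exp M (G i) (\<lambda>\<omega>. \<psi> (Ws j \<omega>, D \<omega>)) \<omega> - real_cond_exp M (G i) (cmean \<psi>) \<omega>"
    using i by (intro G.real_cond_exp_diff real_cond_exp_int) (auto simp: integrable_Ws)
  moreover have "AE \<omega> in M. real_cond_exp M (G i) (cmean \<psi>) \<omega> = cmean \<psi> \<omega>"
    using i gG by (intro G.real_cond_exp_F_meas real_cond_exp_int)
  moreover have "AE \<omega> in M. real_cond_exp M (G i) (\<lambda>\<omega>. \<psi> (Ws j \<omega>, D \<omega>)) \<omega> = cmean \<psi> \<omega>"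
    by (rule real_cond_exp_G[OF ij _ i]) measurable
  ultimately have ae0: "AE \<omega> in M. real_cond_exp M (G i) (?c j) \<omega> = 0"
    by eventually_elim simp
  have bd: "AE \<omega> in M. \<bar>?c i \<omega> * ?c j \<omega>\<bar> \<le> (2 * K) * (2 * K)"
    using cmean_bounded[OF assms(2) K]
  proof eventually_elim
    fix \<omega> assume elim: "\<bar>cmean \<psi> \<omega>\<bar> \<le> K"
    have "\<bar>?c i \<omega>\<bar> \<le> 2 * K" "\<bar>?c j \<omega>\<bar> \<le> 2 * K"
      using elim K[of "(Ws i \<omega>, D \<omega>)"] K[of "(Ws j \<omega>, D \<omega>)"] by linarith+
    then show "\<bar>?c i \<omega> * ?c j \<omega>\<bar> \<le> (2 * K) * (2 * K)"
      unfolding abs_mult by (intro mult_mono) auto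
  qed
  have "(\<integral>\<omega>. ?c i \<omega> * ?c j \<omega> \<partial>M) = (\<integral>\<omega>. ?c i \<omega> * real_cond_exp M (G i) (?c j) \<omega> \<partial>M)"
  proof (rule G.real_cond_exp_intg(2)[symmetric])
    show "integrable M (\<lambda>\<omega>. ?c i \<omega> * ?c j \<omega>)"
      using bd by (intro integrable_const_bound[of _ "(2 * K) * (2 * K)"]) auto
    show "?c i \<in> borel_measurable (G i)"
      using gG measurable_G[of \<psi> borel i] by (intro borel_measurable_diff) auto
  qed measurable
  also have "\<dots> = (\<integral>\<omega>. 0 \<partial>M)"
    using ae0 by (intro integral_cong_AE) auto
  finally show ?thesis by simp
qed

text \<open>By orthogonality only the \<open>k\<close> diagonal terms of the double sum survive.
  Each is at most \<open>(2 * K)\<^sup>2\<close>, as a value and its conditional mean are both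
  bounded by \<open>K\<close>; the factor \<open>1 / k\<^sup>2\<close> leaves the stated
  bound.\<close>

lemma sample_mean_L2:
  assumes [measurable]: "\<psi> \<in> borel_measurable (SW \<Otimes>\<^sub>M SD)" and K: "\<And>x. \<bar>\<psi> x\<bar> \<le> K" and k: "0 < k"
  shows "integrable M (\<lambda>\<omega>. (sample_mean \<psi> k \<omega> - cmean \<psi> \<omega>)\<^sup>2)"
    and "(\<integral>\<omega>. (sample_mean \<psi> k \<omega> - cmean \<psi> \<omega>)\<^sup>2 \<partial>M) \<le> (2 * K)\<^sup>2 / real k"
proof -
  let ?c = "\<lambda>j \<omega>. \<psi> (Ws j \<omega>, D \<omega>) - cmean \<psi> \<omega>"
  have bd: "AE \<omega> in M. \<bar>?c i \<omega> * ?c j \<omega>\<bar> \<le> (2 * K)\<^sup>2" for i j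
    using cmean_bounded[OF assms(1) K]
  proof eventually_elim
    fix \<omega> assume elim: "\<bar>cmean \<psi> \<omega>\<bar> \<le> K"
    have "\<bar>?c i \<omega>\<bar> \<le> 2 * K" "\<bar>?c j \<omega>\<bar> \<le> 2 * K"
      using elim K[of "(Ws i \<omega>, D \<omega>)"] K[of "(Ws j \<omega>, D \<omega>)"] by linarith+
    then show "\<bar>?c i \<omega> * ?c j \<omega>\<bar> \<le> (2 * K)\<^sup>2"
      unfolding abs_mult power2_eq_square by (intro mult_mono) auto
  qed
  have int: "integrable M (\<lambda>\<omega>. ?c i \<omega> * ?c j \<omega>)" for i j
    using bd[of i j] by (intro integrable_const_bound[of _ "(2 * K)\<^sup>2"]) auto
  have expand: "(sample_mean \<psi> k \<omega> - cmean \<psi> \<omega>)\<^sup>2 = (1 / (real k)\<^sup>2) * (\<Sum>i<k. \<Sum>j<k. ?c i \<omega> * ?c j \<omega>)" for \<omega>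
  proof -
    have "sample_mean \<psi> k \<omega> - cmean \<psi> \<omega> = (1 / real k) * (\<Sum>i<k. ?c i \<omega>)"
      using k by (simp add: sample_mean_def sum_subtractf field_simps)
    then show ?thesis
      by (simp add: power2_eq_square sum_product)
  qed
  show "integrable M (\<lambda>\<omega>. (sample_mean \<psi> k \<omega> - cmean \<psi> \<omega>)\<^sup>2)"
    unfolding expand using int by (intro integrable_mult_right Bochner_Integration.integrable_sum) auto
  have "(\<integral>\<omega>. (sample_mean \<psi> k \<omega> - cmean \<psi> \<omega>)\<^sup>2 \<partial>M) =
      (1 / (real k)\<^sup>2) * (\<Sum>i<k. \<Sum>j<k. \<integral>\<omega>. ?c i \<omega> * ?c j \<omega> \<partial>M)"
    unfolding expand using int by simp
  also have "\<dots> \<le> (1 / (real k)\<^sup>2) * (\<Sum>i<k. \<Sum>j<k. if i = j then (2 * K)\<^sup>2 else 0)"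
  proof (intro mult_left_mono sum_mono)
    fix i j
    show "(\<integral>\<omega>. ?c i \<omega> * ?c j \<omega> \<partial>M) \<le> (if i = j then (2 * K)\<^sup>2 else 0)"
    proof (cases "i = j")
      case True
      have "(\<integral>\<omega>. ?c i \<omega> * ?c j \<omega> \<partial>M) \<le> (\<integral>\<omega>. (2 * K)\<^sup>2 \<partial>M)"
        using int bd[of i j] by (intro integral_mono_AE) (auto elim!: AE_mp)
      then show ?thesis using True by (simp add: prob_space)
    next
      case False
      then show ?thesis using centered_orthogonal[OF False assms(1) K] by simp
    qed
  qed simp
  also have "\<dots> = (2 * K)\<^sup>2 / real k"
    using k by (simp add: power2_eq_square)
  finally show "(\<integral>\<omega>. (sample_mean \<psi> k \<omega> - cmean \<psi> \<omega>)\<^sup>2 \<partial>M) \<le> (2 * K)\<^sup>2 / real k" .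
qed

text \<open>Along the sizes \<open>2 ^ n\<close> the mean squares are dominated by a geometric
  series. Hence the series of squared errors is almost surely finite, and its terms tend to 0
  without passing to a subsequence.\<close>

lemma bounded_sample_mean_AE:
  assumes [measurable]: "\<psi> \<in> borel_measurable (SW \<Otimes>\<^sub>M SD)" and K: "\<And>x. \<bar>\<psi> x\<bar> \<le> K"
  shows "AE \<omega> in M. (\<lambda>n. sample_mean \<psi> (2 ^ n) \<omega>) \<longlonglongrightarrow> cmean \<psi> \<omega>"
proof -
  let ?q = "\<lambda>n \<omega>. (sample_mean \<psi> (2 ^ n) \<omega> - cmean \<psi> \<omega>)\<^sup>2"
  have sm: "summable (\<lambda>n. (2 * K)\<^sup>2 * (1 / 2) ^ n)"
    by (intro summable_mult summable_geometric) simp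
  have "(\<integral>\<^sup>+\<omega>. (\<Sum>n. ennreal (?q n \<omega>)) \<partial>M) = (\<Sum>n. \<integral>\<^sup>+\<omega>. ennreal (?q n \<omega>) \<partial>M)"
    by (rule nn_integral_suminf) measurable
  also have "\<dots> \<le> (\<Sum>n. ennreal ((2 * K)\<^sup>2 * (1 / 2) ^ n))"
  proof (intro suminf_le)
    fix n
    have "(\<integral>\<^sup>+\<omega>. ennreal (?q n \<omega>) \<partial>M) = ennreal (\<integral>\<omega>. ?q n \<omega> \<partial>M)"
      using sample_mean_L2(1)[OF assms(1) K, of "2 ^ n"] by (intro nn_integral_eq_integral) auto
    also have "\<dots> \<le> ennreal ((2 * K)\<^sup>2 * (1 / 2) ^ n)"
      using sample_mean_L2(2)[OF assms(1) K, of "2 ^ n"] by (intro ennreal_leI) (auto simp: power_divide)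
    finally show "(\<integral>\<^sup>+\<omega>. ennreal (?q n \<omega>) \<partial>M) \<le> ennreal ((2 * K)\<^sup>2 * (1 / 2) ^ n)" .
  qed auto
  also have "\<dots> = ennreal (\<Sum>n. (2 * K)\<^sup>2 * (1 / 2) ^ n)"
    using sm by (intro suminf_ennreal_eq) (auto simp: sums_iff)
  also have "\<dots> < \<infinity>" by simp
  finally have "AE \<omega> in M. (\<Sum>n. ennreal (?q n \<omega>)) \<noteq> \<infinity>"
    by (intro nn_integral_PInf_AE) auto
  then show ?thesis
  proof eventually_elim
    case (elim \<omega>)
    then have "summable (\<lambda>n. ?q n \<omega>)" by (intro summable_suminf_not_top) auto
    then have "(\<lambda>n. ?q n \<omega>) \<longlonglongrightarrow> 0" by (rule summable_LIMSEQ_zero)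
    then have "(\<lambda>n. sqrt (?q n \<omega>)) \<longlonglongrightarrow> sqrt 0" by (rule tendsto_real_sqrt)
    then have "(\<lambda>n. sample_mean \<psi> (2 ^ n) \<omega> - cmean \<psi> \<omega>) \<longlonglongrightarrow> 0"
      by (simp add: tendsto_rabs_zero_iff)
    then show ?case by (simp add: LIM_zero_iff)
  qed
qed

lemma sample_mean_abs_le:
  assumes "\<And>x. \<bar>\<psi> x\<bar> \<le> (K::real)" "0 < k"
  shows "\<bar>sample_mean \<psi> k \<omega>\<bar> \<le> K"
proof -
  have "\<bar>\<Sum>i<k. \<psi> (Ws i \<omega>, D \<omega>)\<bar> \<le> (\<Sum>i<k. K)"
    using assms by (intro order_trans[OF sum_abs] sum_mono) auto
  then show ?thesis using assms(2) by (simp add: sample_mean_def field_simps)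
qed

text \<open>Truncate at level \<open>K\<close>. The truncated part converges almost surely and
  boundedly, hence in L1; averaging and conditioning do not increase the L1 norm of the
  remainder.\<close>

lemma sample_mean_L1:
  assumes [measurable]: "\<psi> \<in> borel_measurable (SW \<Otimes>\<^sub>M SD)" and int: "integrable M (\<lambda>\<omega>. \<psi> (W \<omega>, D \<omega>))"
  shows "(\<lambda>n. \<integral>\<omega>. \<bar>sample_mean \<psi> (2 ^ n) \<omega> - cmean \<psi> \<omega>\<bar> \<partial>M) \<longlonglongrightarrow> 0"
proof (rule LIMSEQ_I)
  fix \<epsilon> :: real assume \<epsilon>: "0 < \<epsilon>"
  define t where "t K x = max (- real K) (min (real K) (\<psi> x))" for K x
  have tm[measurable]: "t K \<in> borel_measurable (SW \<Otimes>\<^sub>M SD)" for K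
    unfolding t_def by measurable
  have tK: "\<bar>t K x\<bar> \<le> real K" for K x by (auto simp: t_def)
  have tle: "\<bar>\<psi> x - t K x\<bar> \<le> \<bar>\<psi> x\<bar>" for K x by (auto simp: t_def)
  have inte: "integrable M (\<lambda>\<omega>. \<psi> (W \<omega>, D \<omega>) - t K (W \<omega>, D \<omega>))" for K
    using int tle by (intro Bochner_Integration.integrable_bound[OF int]) auto
  have intt: "integrable M (\<lambda>\<omega>. t K (W \<omega>, D \<omega>))" for K
    using tK by (intro integrable_const_bound[of _ "real K"]) auto
  have "(\<lambda>K. \<integral>\<omega>. \<bar>\<psi> (W \<omega>, D \<omega>) - t K (W \<omega>, D \<omega>)\<bar> \<partial>M) \<longlonglongrightarrow> (\<integral>\<omega>. 0 \<partial>M)"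
  proof (rule integral_dominated_convergence[where w="\<lambda>\<omega>. \<bar>\<psi> (W \<omega>, D \<omega>)\<bar>"])
    show "AE \<omega> in M. (\<lambda>K. \<bar>\<psi> (W \<omega>, D \<omega>) - t K (W \<omega>, D \<omega>)\<bar>) \<longlonglongrightarrow> 0"
    proof (rule AE_I2)
      fix \<omega>
      obtain K0 where K0: "\<bar>\<psi> (W \<omega>, D \<omega>)\<bar> \<le> real K0" using real_arch_simple by blast
      have "\<forall>\<^sub>F K in sequentially. \<bar>\<psi> (W \<omega>, D \<omega>) - t K (W \<omega>, D \<omega>)\<bar> = 0"
        using eventually_ge_at_top[of K0]
        by eventually_elim (use K0 in \<open>auto simp: t_def\<close>)
      then show "(\<lambda>K. \<bar>\<psi> (W \<omega>, D \<omega>) - t K (W \<omega>, D \<omega>)\<bar>) \<longlonglongrightarrow> 0"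
        by (rule tendsto_eventually)
    qed
  qed (use int tle in auto)
  \<comment> \<open>The remainder enters twice, in the sample mean and in the conditional mean. Two
    quarters leave \<open>\<epsilon> / 2\<close> for the truncated part.\<close>
  then have "\<forall>\<^sub>F K in sequentially. (\<integral>\<omega>. \<bar>\<psi> (W \<omega>, D \<omega>) - t K (W \<omega>, D \<omega>)\<bar> \<partial>M) < \<epsilon> / 4"
    using \<epsilon> by (intro order_tendstoD(2)[where y=0]) auto
  then obtain K where K: "(\<integral>\<omega>. \<bar>\<psi> (W \<omega>, D \<omega>) - t K (W \<omega>, D \<omega>)\<bar> \<partial>M) < \<epsilon> / 4"
    by (auto simp: eventually_sequentially)
  let ?e = "\<lambda>x. \<bar>\<psi> x - t K x\<bar>"
  let ?I = "\<integral>\<omega>. ?e (W \<omega>, D \<omega>) \<partial>M"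
  have inte': "integrable M (\<lambda>\<omega>. ?e (W \<omega>, D \<omega>))" using inte by auto
  have "(\<lambda>n. \<integral>\<omega>. \<bar>sample_mean (t K) (2 ^ n) \<omega> - cmean (t K) \<omega>\<bar> \<partial>M) \<longlonglongrightarrow> (\<integral>\<omega>. 0 \<partial>M)"
  proof (rule integral_dominated_convergence[where w="\<lambda>\<omega>. 2 * real K"])
    show "AE \<omega> in M. (\<lambda>n. \<bar>sample_mean (t K) (2 ^ n) \<omega> - cmean (t K) \<omega>\<bar>) \<longlonglongrightarrow> 0"
      using bounded_sample_mean_AE[OF tm tK, of K]
      by eventually_elim (simp add: tendsto_rabs_zero_iff LIM_zero_iff)
    show "AE \<omega> in M. norm \<bar>sample_mean (t K) (2 ^ n) \<omega> - cmean (t K) \<omega>\<bar> \<le> 2 * real K" for n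
      using cmean_bounded[OF tm tK, of K]
    proof eventually_elim
      case (elim \<omega>)
      then show ?case using sample_mean_abs_le[of "t K" "real K" "2 ^ n" \<omega>, OF tK] by auto
    qed
  qed auto
  then have "\<forall>\<^sub>F n in sequentially. (\<integral>\<omega>. \<bar>sample_mean (t K) (2 ^ n) \<omega> - cmean (t K) \<omega>\<bar> \<partial>M) < \<epsilon> / 2"
    using \<epsilon> by (intro order_tendstoD(2)[where y=0]) auto
  then obtain n0 where n0: "\<And>n. n \<ge> n0 \<Longrightarrow>
      (\<integral>\<omega>. \<bar>sample_mean (t K) (2 ^ n) \<omega> - cmean (t K) \<omega>\<bar> \<partial>M) < \<epsilon> / 2"
    by (auto simp: eventually_sequentially)
  have ae: "AE \<omega> in M. \<bar>sample_mean \<psi> k \<omega> - cmean \<psi> \<omega>\<bar> \<le>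
      sample_mean ?e k \<omega> + \<bar>sample_mean (t K) k \<omega> - cmean (t K) \<omega>\<bar> + cmean ?e \<omega>" for k
  proof -
    have "AE \<omega> in M. cmean (\<lambda>x. \<psi> x - t K x) \<omega> = cmean \<psi> \<omega> - cmean (t K) \<omega>"
      by (rule real_cond_exp_diff[OF int intt])
    moreover have "AE \<omega> in M. \<bar>cmean (\<lambda>x. \<psi> x - t K x) \<omega>\<bar> \<le> cmean ?e \<omega>"
    proof -
      have "AE \<omega> in M. cmean (\<lambda>x. \<psi> x - t K x) \<omega> \<le> cmean ?e \<omega>"
        by (rule real_cond_exp_mono) (use inte inte' in auto)
      moreover have "AE \<omega> in M. cmean (\<lambda>x. - ?e x) \<omega> \<le> cmean (\<lambda>x. \<psi> x - t K x) \<omega>"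
        by (rule real_cond_exp_mono) (use inte inte' in auto)
      moreover have "AE \<omega> in M. cmean (\<lambda>x. (-1) * ?e x) \<omega> = (-1) * cmean ?e \<omega>"
        by (rule real_cond_exp_cmult[OF inte'])
      ultimately show ?thesis by eventually_elim auto
    qed
    ultimately show ?thesis
    proof eventually_elim
      case (elim \<omega>)
      have "\<bar>sample_mean \<psi> k \<omega> - sample_mean (t K) k \<omega>\<bar> \<le> sample_mean ?e k \<omega>"
        unfolding sample_mean_def real_scaleR_def right_diff_distrib[symmetric] sum_subtractf[symmetric] abs_mult
        by (intro mult_mono sum_abs) auto
      then show ?case using elim by linarith
    qed
  qed
  have bound: "(\<integral>\<omega>. \<bar>sample_mean \<psi> (2 ^ n) \<omega> - cmean \<psi> \<omega>\<bar> \<partial>M) < \<epsilon>" if "n \<ge> n0" for n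
  proof -
    have i1: "integrable M (sample_mean ?e (2 ^ n))" by (rule integrable_sample_mean[OF _ inte']) measurable
    have i2: "integrable M (\<lambda>\<omega>. \<bar>sample_mean (t K) (2 ^ n) \<omega> - cmean (t K) \<omega>\<bar>)"
      using integrable_sample_mean[OF tm intt] real_cond_exp_int(1)[OF intt] by auto
    have i3: "integrable M (cmean ?e)" by (rule real_cond_exp_int(1)[OF inte'])
    have "(\<integral>\<omega>. \<bar>sample_mean \<psi> (2 ^ n) \<omega> - cmean \<psi> \<omega>\<bar> \<partial>M) \<le>
      (\<integral>\<omega>. sample_mean ?e (2 ^ n) \<omega> + \<bar>sample_mean (t K) (2 ^ n) \<omega> - cmean (t K) \<omega>\<bar> + cmean ?e \<omega> \<partial>M)"
      using integrable_sample_mean[OF _ int, of "2 ^ n"] real_cond_exp_int(1)[OF int] i1 i2 i3 ae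
      by (intro integral_mono_AE) auto
    also have "\<dots> = ?I + (\<integral>\<omega>. \<bar>sample_mean (t K) (2 ^ n) \<omega> - cmean (t K) \<omega>\<bar> \<partial>M) + ?I"
      using i1 i2 i3 real_cond_exp_int(2)[OF inte'] integral_sample_mean[OF _ inte', of "2 ^ n"] by simp
    finally show ?thesis using K n0[OF that] by linarith
  qed
  show "\<exists>n0. \<forall>n\<ge>n0. norm ((\<integral>\<omega>. \<bar>sample_mean \<psi> (2 ^ n) \<omega> - cmean \<psi> \<omega>\<bar> \<partial>M) - 0) < \<epsilon>"
    using bound by (intro exI[of _ n0]) (auto simp: abs_of_nonneg)
qed

text \<open>On the event \<open>Z\<close>, which belongs to \<open>F\<close>, integrating
  \<open>\<psi>\<close> of a member equals integrating \<open>cmean \<psi>\<close>, so the result is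
  at most 0 and \<open>\<psi>\<close> vanishes there. For the indicator of an open set this says
  that a set hit by one member has positive limiting frequency.\<close>

lemma cmean_pos_on_sample:
  assumes [measurable]: "\<psi> \<in> borel_measurable (SW \<Otimes>\<^sub>M SD)" and int: "integrable M (\<lambda>\<omega>. \<psi> (W \<omega>, D \<omega>))"
    and nonneg: "\<And>x. 0 \<le> \<psi> x"
  shows "AE \<omega> in M. 0 < \<psi> (Ws j \<omega>, D \<omega>) \<longrightarrow> 0 < cmean \<psi> \<omega>"
proof -
  define Z where "Z = {\<omega> \<in> space M. cmean \<psi> \<omega> \<le> 0}"
  have "Z = {\<omega> \<in> space F. cmean \<psi> \<omega> \<le> 0}" by (simp add: Z_def generated_def)
  then have Z: "Z \<in> sets F" by simp
  then have Z'[measurable]: "Z \<in> sets M" using subalg by (auto simp: subalgebra_def)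
  have intj: "integrable M (\<lambda>\<omega>. \<psi> (Ws j \<omega>, D \<omega>))" using int by (simp add: integrable_Ws)
  have i: "integrable M (\<lambda>\<omega>. indicator Z \<omega> * \<psi> (Ws j \<omega>, D \<omega>))"
    using integrable_mult_indicator[OF Z' intj] by simp
  have "(\<integral>\<omega>. indicator Z \<omega> * \<psi> (Ws j \<omega>, D \<omega>) \<partial>M) =
      (\<integral>\<omega>. indicator Z \<omega> * real_cond_exp M F (\<lambda>\<omega>. \<psi> (Ws j \<omega>, D \<omega>)) \<omega> \<partial>M)"
    using real_cond_exp_intA[OF intj Z] by (simp add: set_lebesgue_integral_def)
  also have "\<dots> = (\<integral>\<omega>. indicator Z \<omega> * cmean \<psi> \<omega> \<partial>M)"
    using real_cond_exp_Ws[OF _ int, of j] by (intro integral_cong_AE) auto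
  also have "\<dots> \<le> 0"
  proof -
    have "(\<integral>\<omega>. indicator Z \<omega> * cmean \<psi> \<omega> \<partial>M) \<le> (\<integral>\<omega>. 0 \<partial>M)"
      using integrable_mult_indicator[OF Z' real_cond_exp_int(1)[OF int]]
      by (intro integral_mono) (auto simp: Z_def split: split_indicator)
    then show ?thesis by simp
  qed
  finally have "(\<integral>\<omega>. indicator Z \<omega> * \<psi> (Ws j \<omega>, D \<omega>) \<partial>M) = 0"
    using nonneg by (intro antisym integral_nonneg_AE) auto
  then have "AE \<omega> in M. indicator Z \<omega> * \<psi> (Ws j \<omega>, D \<omega>) = 0"
    using i nonneg by (subst (asm) integral_nonneg_eq_0_iff_AE) auto
  then show ?thesis
    by (rule AE_mp) (auto simp: Z_def split: split_indicator_asm)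
qed

end

section \<open>Convex functions of the ensemble mean\<close>

lemma convex_mean_le:
  fixes x :: "nat \<Rightarrow> 'e::real_vector"
  assumes "convex_on C f" "0 < k" "\<And>i. x i \<in> C"
  shows "f ((1 / real k) *\<^sub>R (\<Sum>i<k. x i)) \<le> (1 / real k) * (\<Sum>i<k. f (x i))"
  unfolding scaleR_sum_right sum_distrib_left
  by (rule convex_on_sum) (use assms in auto)

lemma sum_lessThan_add:
  fixes f :: "nat \<Rightarrow> 'b::comm_monoid_add"
  shows "(\<Sum>i<m + k. f i) = (\<Sum>i<m. f i) + (\<Sum>i<k. f (m + i))"
  by (induction k) (auto simp: ac_simps)

text \<open>Isolates what the limit argument uses of the log-partition: convexity on
  \<open>\<Theta>\<close>, measurability as a total function, and one affine minorant. No smoothness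
  enters.\<close>

locale convex_ensemble = conditional_sampling M SD SW D W Ws
  for M :: "'a measure" and SD :: "'d measure" and SW :: "'w measure"
    and D :: "'a \<Rightarrow> 'd" and W :: "'a \<Rightarrow> 'w" and Ws :: "nat \<Rightarrow> 'a \<Rightarrow> 'w" +
  fixes \<Phi> :: "'w \<times> 'd \<Rightarrow> 'e::euclidean_space" and \<Theta> :: "'e set" and A :: "'e \<Rightarrow> real"
    and c m
  assumes \<Phi>_meas [measurable]: "\<Phi> \<in> borel_measurable (SW \<Otimes>\<^sub>M SD)"
    and \<Phi>_range: "\<And>x. x \<in> space (SW \<Otimes>\<^sub>M SD) \<Longrightarrow> \<Phi> x \<in> \<Theta>"
    and A_meas [measurable]: "A \<in> borel_measurable borel"
    and A_convex: "convex_on \<Theta> A"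
    and A_minorant: "\<And>\<eta>. \<eta> \<in> \<Theta> \<Longrightarrow> c + \<eta> \<bullet> m \<le> A \<eta>"
    and int_\<Phi>: "integrable M (\<lambda>\<omega>. \<Phi> (W \<omega>, D \<omega>))"
    and int_A\<Phi>: "integrable M (\<lambda>\<omega>. A (\<Phi> (W \<omega>, D \<omega>)))"
begin

abbreviation limit_prediction :: "'a \<Rightarrow> 'e" where
  "limit_prediction \<equiv> vec_cond_exp M F (\<lambda>\<omega>. \<Phi> (W \<omega>, D \<omega>))"

lemma int_\<Phi>_inner: "integrable M (\<lambda>\<omega>. \<Phi> (W \<omega>, D \<omega>) \<bullet> b)"
  using int_\<Phi> by simp

lemma limit_prediction_inner:
  "b \<in> Basis \<Longrightarrow> limit_prediction \<omega> \<bullet> b = cmean (\<lambda>x. \<Phi> x \<bullet> b) \<omega>"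
  unfolding vec_cond_exp_def by (rule inner_sum_left_Basis)

lemma limit_prediction_measurable [measurable]:
  "limit_prediction \<in> borel_measurable F" "limit_prediction \<in> borel_measurable M"
  unfolding vec_cond_exp_def[abs_def] by (auto intro!: borel_measurable_sum)

lemma integrable_limit_prediction: "integrable M limit_prediction"
  unfolding vec_cond_exp_def[abs_def]
  by (intro Bochner_Integration.integrable_sum integrable_scaleR_left real_cond_exp_int int_\<Phi>_inner)

lemma integral_limit_prediction: "(\<integral>\<omega>. limit_prediction \<omega> \<partial>M) = (\<integral>\<omega>. \<Phi> (W \<omega>, D \<omega>) \<partial>M)"
proof (rule euclidean_eqI)
  fix b :: 'e assume b: "b \<in> Basis"
  have "(\<integral>\<omega>. limit_prediction \<omega> \<partial>M) \<bullet> b = (\<integral>\<omega>. limit_prediction \<omega> \<bullet> b \<partial>M)"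
    using integrable_limit_prediction by simp
  also have "\<dots> = (\<integral>\<omega>. \<Phi> (W \<omega>, D \<omega>) \<bullet> b \<partial>M)"
    using b by (simp add: limit_prediction_inner real_cond_exp_int(2)[OF int_\<Phi>_inner])
  also have "\<dots> = (\<integral>\<omega>. \<Phi> (W \<omega>, D \<omega>) \<partial>M) \<bullet> b"
    using int_\<Phi> by simp
  finally show "(\<integral>\<omega>. limit_prediction \<omega> \<partial>M) \<bullet> b = (\<integral>\<omega>. \<Phi> (W \<omega>, D \<omega>) \<partial>M) \<bullet> b" .
qed

lemma sample_in_\<Theta>: "\<omega> \<in> space M \<Longrightarrow> \<Phi> (Ws i \<omega>, D \<omega>) \<in> \<Theta>"
  using measurable_space[OF Ws_meas[of i]] measurable_space[OF D_meas]
  by (intro \<Phi>_range) (auto simp: space_pair_measure)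

lemma convex_\<Theta>: "convex \<Theta>"
  using A_convex by (rule convex_on_imp_convex)

lemma mean_in_\<Theta>:
  assumes "0 < k" "\<omega> \<in> space M"
  shows "sample_mean \<Phi> k \<omega> \<in> \<Theta>"
  unfolding sample_mean_def scaleR_sum_right using assms sample_in_\<Theta>
  by (intro convex_sum convex_\<Theta>) auto

lemma A_mean_le:
  assumes "0 < k" "\<omega> \<in> space M"
  shows "A (sample_mean \<Phi> k \<omega>) \<le> sample_mean (\<lambda>x. A (\<Phi> x)) k \<omega>"
  unfolding sample_mean_def using convex_mean_le[OF A_convex assms(1) sample_in_\<Theta>[OF assms(2)]] by simp

text \<open>Integrability is assumed for a single prediction only. It passes to the mean because the
  affine minorant and the average of the \<open>A\<close> values, which enclose it, are both
  integrable.\<close>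

lemma integrable_A_mean:
  assumes k: "0 < k"
  shows "integrable M (\<lambda>\<omega>. A (sample_mean \<Phi> k \<omega>))"
proof (rule Bochner_Integration.integrable_bound)
  show "integrable M (\<lambda>\<omega>. \<bar>sample_mean (\<lambda>x. A (\<Phi> x)) k \<omega>\<bar> + \<bar>c + sample_mean \<Phi> k \<omega> \<bullet> m\<bar>)"
    using integrable_sample_mean[of "\<lambda>x. A (\<Phi> x)" k] integrable_sample_mean[of \<Phi> k] int_\<Phi> int_A\<Phi> by auto
  show "AE \<omega> in M. norm (A (sample_mean \<Phi> k \<omega>)) \<le>
      norm (\<bar>sample_mean (\<lambda>x. A (\<Phi> x)) k \<omega>\<bar> + \<bar>c + sample_mean \<Phi> k \<omega> \<bullet> m\<bar>)"
  proof (rule AE_I2)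
    fix \<omega> assume \<omega>: "\<omega> \<in> space M"
    show "norm (A (sample_mean \<Phi> k \<omega>)) \<le>
      norm (\<bar>sample_mean (\<lambda>x. A (\<Phi> x)) k \<omega>\<bar> + \<bar>c + sample_mean \<Phi> k \<omega> \<bullet> m\<bar>)"
      using A_mean_le[OF k \<omega>] A_minorant[OF mean_in_\<Theta>[OF k \<omega>]]
      by (auto simp: abs_if split: if_splits)
  qed
qed measurable

lemma sample_mean_inner: "sample_mean \<Phi> k \<omega> \<bullet> b = sample_mean (\<lambda>x. \<Phi> x \<bullet> b) k \<omega>"
  by (simp add: sample_mean_def inner_sum_left)

text \<open>As a consequence, the conditional Bregman informations of all ensembles subtract the
  same random variable \<open>A (limit_prediction \<omega>)\<close>.\<close>

lemma vec_cond_exp_sample_mean: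
  assumes k: "0 < k"
  shows "AE \<omega> in M. vec_cond_exp M F (sample_mean \<Phi> k) \<omega> = limit_prediction \<omega>"
proof -
  have "AE \<omega> in M. real_cond_exp M F (\<lambda>\<omega>. sample_mean \<Phi> k \<omega> \<bullet> b) \<omega> = cmean (\<lambda>x. \<Phi> x \<bullet> b) \<omega>" for b
  proof -
    let ?\<psi> = "\<lambda>x. \<Phi> x \<bullet> b"
    have ii: "integrable M (\<lambda>\<omega>. ?\<psi> (Ws i \<omega>, D \<omega>))" for i
      using int_\<Phi>_inner by (subst integrable_Ws[of ?\<psi>]) auto
    have "AE \<omega> in M. real_cond_exp M F (\<lambda>\<omega>. (1 / real k) * (\<Sum>i<k. ?\<psi> (Ws i \<omega>, D \<omega>))) \<omega> =
        (1 / real k) * real_cond_exp M F (\<lambda>\<omega>. \<Sum>i<k. ?\<psi> (Ws i \<omega>, D \<omega>)) \<omega>"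
      using ii by (intro real_cond_exp_cmult) auto
    moreover have "AE \<omega> in M. real_cond_exp M F (\<lambda>\<omega>. \<Sum>i<k. ?\<psi> (Ws i \<omega>, D \<omega>)) \<omega> =
        (\<Sum>i<k. real_cond_exp M F (\<lambda>\<omega>. ?\<psi> (Ws i \<omega>, D \<omega>)) \<omega>)"
      using ii by (rule real_cond_exp_sum)
    moreover have "AE \<omega> in M. \<forall>i\<in>{..<k}. real_cond_exp M F (\<lambda>\<omega>. ?\<psi> (Ws i \<omega>, D \<omega>)) \<omega> = cmean ?\<psi> \<omega>"
      using int_\<Phi>_inner by (intro AE_finite_allI real_cond_exp_Ws) auto
    ultimately show ?thesis
      unfolding sample_mean_inner sample_mean_def[of ?\<psi>] real_scaleR_def
      by eventually_elim (use k in simp)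
  qed
  then have "AE \<omega> in M. \<forall>b\<in>Basis. real_cond_exp M F (\<lambda>\<omega>. sample_mean \<Phi> k \<omega> \<bullet> b) \<omega> = cmean (\<lambda>x. \<Phi> x \<bullet> b) \<omega>"
    by (intro AE_finite_allI) auto
  then show ?thesis
    by eventually_elim (simp add: vec_cond_exp_def)
qed

section \<open>Almost sure limits along a subsequence\<close>

text \<open>The L1 errors of all coordinates and of \<open>A\<close> of the prediction are added
  into one \<open>Z\<close>, so a single extraction serves all of them at once.\<close>

lemma subsequence_convergence:
  obtains r where "strict_mono r"
    and "AE \<omega> in M. (\<lambda>n. sample_mean \<Phi> (2 ^ r n) \<omega>) \<longlonglongrightarrow> limit_prediction \<omega>"
    and "AE \<omega> in M. (\<lambda>n. sample_mean (\<lambda>x. A (\<Phi> x)) (2 ^ r n) \<omega>) \<longlonglongrightarrow> cmean (\<lambda>x. A (\<Phi> x)) \<omega>"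
proof -
  define u where "u \<psi> n \<omega> = \<bar>sample_mean \<psi> (2 ^ n) \<omega> - cmean \<psi> \<omega>\<bar>" for \<psi> n \<omega>
  define Z where "Z n \<omega> = (\<Sum>b\<in>Basis. u (\<lambda>x. \<Phi> x \<bullet> b) n \<omega>) + u (\<lambda>x. A (\<Phi> x)) n \<omega>" for n \<omega>
  have iu: "integrable M (u \<psi> n)" "(\<lambda>n. \<integral>\<omega>. u \<psi> n \<omega> \<partial>M) \<longlonglongrightarrow> 0"
    if [measurable]: "\<psi> \<in> borel_measurable (SW \<Otimes>\<^sub>M SD)" and i: "integrable M (\<lambda>\<omega>. \<psi> (W \<omega>, D \<omega>))" for \<psi> n
    unfolding u_def[abs_def]
    using integrable_sample_mean[OF that, of "2 ^ n"] real_cond_exp_int(1)[OF i] sample_mean_L1[OF that] by auto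
  have i1: "integrable M (u (\<lambda>x. \<Phi> x \<bullet> b) n)" and i1': "(\<lambda>n. \<integral>\<omega>. u (\<lambda>x. \<Phi> x \<bullet> b) n \<omega> \<partial>M) \<longlonglongrightarrow> 0" for b n
    using int_\<Phi>_inner by (auto intro!: iu)
  have i2: "integrable M (u (\<lambda>x. A (\<Phi> x)) n)" and i2': "(\<lambda>n. \<integral>\<omega>. u (\<lambda>x. A (\<Phi> x)) n \<omega> \<partial>M) \<longlonglongrightarrow> 0" for n
    using int_A\<Phi> by (auto intro!: iu)
  have u0: "0 \<le> u \<psi> n \<omega>" for \<psi> n \<omega> by (simp add: u_def)
  have Z0: "0 \<le> Z n \<omega>" for n \<omega> unfolding Z_def by (intro add_nonneg_nonneg sum_nonneg u0)
  have "(\<lambda>n. (\<Sum>b\<in>Basis. \<integral>\<omega>. u (\<lambda>x. \<Phi> x \<bullet> b) n \<omega> \<partial>M) + (\<integral>\<omega>. u (\<lambda>x. A (\<Phi> x)) n \<omega> \<partial>M)) \<longlonglongrightarrow> (\<Sum>b\<in>(Basis::'e set). 0) + 0"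
    by (intro tendsto_add tendsto_sum i1' i2')
  then have "(\<lambda>n. \<integral>\<omega>. norm (Z n \<omega>) \<partial>M) \<longlonglongrightarrow> 0"
    using i1 i2 Z0 by (simp add: Z_def)
  moreover have "integrable M (Z n)" for n
    unfolding Z_def[abs_def] using i1 i2 by auto
  ultimately obtain r where r: "strict_mono r" "AE \<omega> in M. (\<lambda>n. Z (r n) \<omega>) \<longlonglongrightarrow> 0"
    using tendsto_L1_AE_subseq[of M Z] by auto
  have conv: "(\<lambda>n. sample_mean \<psi> (2 ^ r n) \<omega>) \<longlonglongrightarrow> cmean \<psi> \<omega>"
    if "(\<lambda>n. Z (r n) \<omega>) \<longlonglongrightarrow> 0" "\<And>n. u \<psi> n \<omega> \<le> Z n \<omega>" for \<psi> \<omega>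
  proof -
    have "(\<lambda>n. u \<psi> (r n) \<omega>) \<longlonglongrightarrow> 0"
      using that u0 by (intro tendsto_sandwich[OF _ _ tendsto_const that(1)]) auto
    then show ?thesis by (simp add: u_def tendsto_rabs_zero_iff LIM_zero_iff)
  qed
  show ?thesis
  proof (rule that[OF r(1)])
    show "AE \<omega> in M. (\<lambda>n. sample_mean \<Phi> (2 ^ r n) \<omega>) \<longlonglongrightarrow> limit_prediction \<omega>"
      using r(2)
    proof eventually_elim
      case (elim \<omega>)
      show ?case
      proof (subst tendsto_componentwise_iff, intro ballI)
        fix b :: 'e assume b: "b \<in> Basis"
        have "u (\<lambda>x. \<Phi> x \<bullet> b) n \<omega> \<le> Z n \<omega>" for n
          unfolding Z_def using b u0
          by (intro add_increasing2 member_le_sum) auto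
        then show "(\<lambda>n. sample_mean \<Phi> (2 ^ r n) \<omega> \<bullet> b) \<longlonglongrightarrow> limit_prediction \<omega> \<bullet> b"
          unfolding sample_mean_inner limit_prediction_inner[OF b] by (rule conv[OF elim])
      qed
    qed
    show "AE \<omega> in M. (\<lambda>n. sample_mean (\<lambda>x. A (\<Phi> x)) (2 ^ r n) \<omega>) \<longlonglongrightarrow> cmean (\<lambda>x. A (\<Phi> x)) \<omega>"
      using r(2)
    proof eventually_elim
      case (elim \<omega>)
      have "u (\<lambda>x. A (\<Phi> x)) n \<omega> \<le> Z n \<omega>" for n
        unfolding Z_def using u0 by (intro add_increasing sum_nonneg) auto
      then show ?case by (rule conv[OF elim])
    qed
  qed
qed

text \<open>Almost surely the limit lies in the relative interior of the convex hull of the sampled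
  predictions. This places it in \<open>\<Theta>\<close> and makes \<open>A\<close> continuous along the ensemble means although
  \<open>\<Theta>\<close> need be neither closed nor open.\<close>

lemma A_sample_mean_tendsto:
  assumes r: "strict_mono r"
    and conv: "AE \<omega> in M. (\<lambda>n. sample_mean \<Phi> (2 ^ r n) \<omega>) \<longlonglongrightarrow> limit_prediction \<omega>"
  shows "AE \<omega> in M. (\<lambda>n. A (sample_mean \<Phi> (2 ^ r n) \<omega>)) \<longlonglongrightarrow> A (limit_prediction \<omega>)"
proof -
  obtain \<B> :: "'e set set" where \<B>: "countable \<B>" "topological_basis \<B>"
    using ex_countable_basis by auto
  define \<psi> where "\<psi> B x = (indicator B (\<Phi> x) :: real)" for B x
  have \<psi>m: "\<psi> B \<in> borel_measurable (SW \<Otimes>\<^sub>M SD)" if "B \<in> \<B>" for B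
  proof -
    have [measurable]: "B \<in> sets borel" using topological_basis_open[OF \<B>(2) that] by auto
    show ?thesis unfolding \<psi>_def by measurable
  qed
  have \<psi>1: "\<bar>\<psi> B x\<bar> \<le> 1" for B x by (auto simp: \<psi>_def split: split_indicator)
  have \<psi>i: "integrable M (\<lambda>\<omega>. \<psi> B (W \<omega>, D \<omega>))" if "B \<in> \<B>" for B
    using \<psi>1 \<psi>m[OF that] by (intro integrable_const_bound[of _ 1]) auto
  \<comment> \<open>A countable basis lets one null set serve all basic sets and all members. As
    indicators are bounded, their frequencies converge along every power of two, in particular along
    \<open>r\<close>.\<close>
  have "AE \<omega> in M. \<forall>B\<in>\<B>. (\<lambda>n. sample_mean (\<psi> B) (2 ^ n) \<omega>) \<longlonglongrightarrow> cmean (\<psi> B) \<omega>"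
    using \<psi>m \<psi>1 by (intro AE_ball_countable' \<B> bounded_sample_mean_AE) auto
  moreover have "AE \<omega> in M. \<forall>B\<in>\<B>. \<forall>j\<in>UNIV. 0 < \<psi> B (Ws j \<omega>, D \<omega>) \<longrightarrow> 0 < cmean (\<psi> B) \<omega>"
    by (intro AE_ball_countable' \<B> cmean_pos_on_sample[OF \<psi>m \<psi>i]) (auto simp: \<psi>_def)
  ultimately show ?thesis
    using conv AE_space
  proof eventually_elim
    case (elim \<omega>)
    let ?x = "\<lambda>i. \<Phi> (Ws i \<omega>, D \<omega>)"
    let ?C = "convex hull (range ?x)"
    have means: "sample_mean \<Phi> (2 ^ r n) \<omega> = (1 / real (2 ^ r n)) *\<^sub>R (\<Sum>i<2 ^ r n. ?x i)" for n
      by (simp add: sample_mean_def)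
    have sub: "?C \<subseteq> \<Theta>"
      using sample_in_\<Theta>[OF elim(4)] by (intro hull_minimal convex_\<Theta>) auto
    have p: "limit_prediction \<omega> \<in> rel_interior ?C"
    proof (rule limit_of_means_in_rel_interior[OF _ _ \<B>(2)])
      show "(\<lambda>n. (1 / real (2 ^ r n)) *\<^sub>R (\<Sum>i<2 ^ r n. ?x i)) \<longlonglongrightarrow> limit_prediction \<omega>"
        using elim(3) by (simp only: means)
      fix B j assume B: "B \<in> \<B>" "?x j \<in> B"
      show "\<exists>c>0. (\<lambda>n. (1 / real (2 ^ r n)) * (\<Sum>i<2 ^ r n. indicator B (?x i))) \<longlonglongrightarrow> c"
      proof (intro exI conjI)
        have "0 < \<psi> B (Ws j \<omega>, D \<omega>)" using B by (simp add: \<psi>_def)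
        then show "0 < cmean (\<psi> B) \<omega>" using elim(2) B by blast
        have "(\<lambda>n. sample_mean (\<psi> B) (2 ^ r n) \<omega>) \<longlonglongrightarrow> cmean (\<psi> B) \<omega>"
          using LIMSEQ_subseq_LIMSEQ[OF _ r] elim(1) B(1) by (auto simp: comp_def)
        then show "(\<lambda>n. (1 / real (2 ^ r n)) * (\<Sum>i<2 ^ r n. indicator B (?x i))) \<longlonglongrightarrow> cmean (\<psi> B) \<omega>"
          by (simp add: sample_mean_def \<psi>_def)
      qed
    qed simp
    show ?case
    \<comment> \<open>Continuity is used relative to \<open>?C\<close>, whose dimension may be
      smaller than that of \<open>\<Theta>\<close>; the limit may lie on the relative boundary of
      \<open>\<Theta>\<close>.\<close>
    proof (rule convex_on_tendsto_rel_interior[OF _ p _ elim(3)])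
      show "convex_on ?C A" using A_convex sub convex_on_subset by blast
      show "sample_mean \<Phi> (2 ^ r n) \<omega> \<in> ?C" for n
        unfolding means by (rule mean_in_convex_hull) simp
    qed
  qed
qed

lemma distr_tuple:
  fixes \<sigma> :: "nat \<Rightarrow> nat"
  assumes inj: "inj_on \<sigma> {..<k}"
  shows "distr M (PiM {..<k} (\<lambda>_. SW) \<Otimes>\<^sub>M SD) (\<lambda>\<omega>. (\<lambda>i\<in>{..<k}. Ws (\<sigma> i) \<omega>, D \<omega>)) =
    distr M (PiM {..<k} (\<lambda>_. SW) \<Otimes>\<^sub>M SD) (\<lambda>\<omega>. (\<lambda>i\<in>{..<k}. Ws i \<omega>, D \<omega>))"
proof (rule measure_eqI)
  let ?N = "PiM {..<k} (\<lambda>_. SW) \<Otimes>\<^sub>M SD"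
  have meas[measurable]: "(\<lambda>\<omega>. (\<lambda>i\<in>{..<k}. Ws (\<tau> i) \<omega>, D \<omega>)) \<in> measurable M ?N" for \<tau>
    by (intro measurable_Pair measurable_restrict) auto
  fix E assume "E \<in> sets (distr M ?N (\<lambda>\<omega>. (\<lambda>i\<in>{..<k}. Ws (\<sigma> i) \<omega>, D \<omega>)))"
  then have [measurable]: "E \<in> sets ?N" by simp
  have e: "emeasure (distr M ?N (\<lambda>\<omega>. (\<lambda>i\<in>{..<k}. Ws (\<tau> i) \<omega>, D \<omega>))) E =
      (\<integral>\<^sup>+\<omega>. indicator E (\<lambda>i\<in>{..<k}. Ws (\<tau> i) \<omega>, D \<omega>) \<partial>M)" for \<tau>
    by (subst nn_integral_distr[OF meas, symmetric]) auto
  show "emeasure (distr M ?N (\<lambda>\<omega>. (\<lambda>i\<in>{..<k}. Ws (\<sigma> i) \<omega>, D \<omega>))) E =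
      emeasure (distr M ?N (\<lambda>\<omega>. (\<lambda>i\<in>{..<k}. Ws i \<omega>, D \<omega>))) E"
    using e[of \<sigma>] e[of "\<lambda>i. i"] nn_integral_tuple[OF inj, of "indicator E"] by simp
qed simp

section \<open>Doubling the ensemble\<close>

definition second_mean :: "nat \<Rightarrow> 'a \<Rightarrow> 'e" where
  "second_mean k \<omega> = (1 / real k) *\<^sub>R (\<Sum>i<k. \<Phi> (Ws (k + i) \<omega>, D \<omega>))"

lemma second_mean_measurable [measurable]: "second_mean k \<in> borel_measurable M"
  unfolding second_mean_def by measurable

lemma sample_mean_double:
  "sample_mean \<Phi> (2 * k) \<omega> = (1 / 2) *\<^sub>R sample_mean \<Phi> k \<omega> + (1 / 2) *\<^sub>R second_mean k \<omega>"
  using sum_lessThan_add[of "\<lambda>i. \<Phi> (Ws i \<omega>, D \<omega>)" k k]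
  by (simp add: sample_mean_def second_mean_def scaleR_add_right flip: mult_2)

lemma second_mean_in_\<Theta>:
  assumes "0 < k" "\<omega> \<in> space M"
  shows "second_mean k \<omega> \<in> \<Theta>"
  unfolding second_mean_def scaleR_sum_right using assms sample_in_\<Theta>
  by (intro convex_sum convex_\<Theta>) auto

text \<open>The shift by \<open>k\<close> is injective, so the tuple of the second half has the same
  joint law with \<open>D\<close> as that of the first; \<open>\<Psi>\<close> reads \<open>A\<close>
  of either mean off its tuple.\<close>

lemma second_mean_law:
  assumes k: "0 < k"
  shows "integrable M (\<lambda>\<omega>. A (second_mean k \<omega>))"
    and "(\<integral>\<omega>. A (second_mean k \<omega>) \<partial>M) = (\<integral>\<omega>. A (sample_mean \<Phi> k \<omega>) \<partial>M)"
proof -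
  let ?N = "PiM {..<k} (\<lambda>_. SW) \<Otimes>\<^sub>M SD"
  define \<Psi> where "\<Psi> x = A ((1 / real k) *\<^sub>R (\<Sum>i<k. \<Phi> (fst x i, snd x)))" for x
  have [measurable]: "\<Psi> \<in> borel_measurable ?N"
    unfolding \<Psi>_def
  proof (intro measurable_compose[OF _ A_meas] borel_measurable_scaleR borel_measurable_const borel_measurable_sum)
    fix i assume i: "i \<in> {..<k}"
    have "(\<lambda>x. fst x i) \<in> measurable ?N SW"
      by (rule measurable_compose[OF measurable_fst measurable_component_singleton]) (rule i)
    then show "(\<lambda>x. \<Phi> (fst x i, snd x)) \<in> borel_measurable ?N"
      by (intro measurable_compose[OF measurable_Pair \<Phi>_meas]) auto
  qed
  have meas[measurable]: "(\<lambda>\<omega>. (\<lambda>i\<in>{..<k}. Ws (\<tau> i) \<omega>, D \<omega>)) \<in> measurable M ?N" for \<tau>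
    by (intro measurable_Pair measurable_restrict) auto
  have eq: "distr M ?N (\<lambda>\<omega>. (\<lambda>i\<in>{..<k}. Ws (k + i) \<omega>, D \<omega>)) = distr M ?N (\<lambda>\<omega>. (\<lambda>i\<in>{..<k}. Ws i \<omega>, D \<omega>))"
    by (rule distr_tuple) (auto simp: inj_on_def)
  have \<Psi>1: "\<Psi> (\<lambda>i\<in>{..<k}. Ws (k + i) \<omega>, D \<omega>) = A (second_mean k \<omega>)" for \<omega>
    by (simp add: \<Psi>_def second_mean_def)
  have \<Psi>2: "\<Psi> (\<lambda>i\<in>{..<k}. Ws i \<omega>, D \<omega>) = A (sample_mean \<Phi> k \<omega>)" for \<omega>
    by (simp add: \<Psi>_def sample_mean_def)
  show "(\<integral>\<omega>. A (second_mean k \<omega>) \<partial>M) = (\<integral>\<omega>. A (sample_mean \<Phi> k \<omega>) \<partial>M)"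
    using arg_cong[OF eq, of "\<lambda>P. integral\<^sup>L P \<Psi>"]
    by (simp add: integral_distr[OF meas] integral_distr[OF meas[of "\<lambda>i. i"]] \<Psi>1 \<Psi>2)
  show "integrable M (\<lambda>\<omega>. A (second_mean k \<omega>))"
    using arg_cong[OF eq, of "\<lambda>P. integrable P \<Psi>"] integrable_A_mean[OF k]
    by (simp add: integrable_distr_eq[OF meas] integrable_distr_eq[OF meas[of "\<lambda>i. i"]] \<Psi>1 \<Psi>2)
qed

text \<open>Since both halves have the same expectation of \<open>A\<close>, the drop from size
  \<open>k\<close> to \<open>2 * k\<close> is the integral of a nonnegative midpoint gap. Equality
  therefore forces the gap to vanish almost surely.\<close>

lemma doubling_gap:
  assumes k: "0 < k"
  shows "AE \<omega> in M. A (sample_mean \<Phi> (2 * k) \<omega>) \<le> (A (sample_mean \<Phi> k \<omega>) + A (second_mean k \<omega>)) / 2"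
    and "(\<integral>\<omega>. (A (sample_mean \<Phi> k \<omega>) + A (second_mean k \<omega>)) / 2 - A (sample_mean \<Phi> (2 * k) \<omega>) \<partial>M) =
      (\<integral>\<omega>. A (sample_mean \<Phi> k \<omega>) \<partial>M) - (\<integral>\<omega>. A (sample_mean \<Phi> (2 * k) \<omega>) \<partial>M)"
    and "integrable M (\<lambda>\<omega>. (A (sample_mean \<Phi> k \<omega>) + A (second_mean k \<omega>)) / 2 - A (sample_mean \<Phi> (2 * k) \<omega>))"
proof -
  show "AE \<omega> in M. A (sample_mean \<Phi> (2 * k) \<omega>) \<le> (A (sample_mean \<Phi> k \<omega>) + A (second_mean k \<omega>)) / 2"
  proof (rule AE_I2)
    fix \<omega> assume \<omega>: "\<omega> \<in> space M"
    show "A (sample_mean \<Phi> (2 * k) \<omega>) \<le> (A (sample_mean \<Phi> k \<omega>) + A (second_mean k \<omega>)) / 2"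
      using convex_onD[OF A_convex, of "1/2" "sample_mean \<Phi> k \<omega>" "second_mean k \<omega>"]
        mean_in_\<Theta>[OF k \<omega>] second_mean_in_\<Theta>[OF k \<omega>]
      by (simp add: sample_mean_double)
  qed
  note ints = integrable_A_mean[OF k] second_mean_law(1)[OF k] integrable_A_mean[of "2 * k"]
  show "integrable M (\<lambda>\<omega>. (A (sample_mean \<Phi> k \<omega>) + A (second_mean k \<omega>)) / 2 - A (sample_mean \<Phi> (2 * k) \<omega>))"
    using ints k by auto
  show "(\<integral>\<omega>. (A (sample_mean \<Phi> k \<omega>) + A (second_mean k \<omega>)) / 2 - A (sample_mean \<Phi> (2 * k) \<omega>) \<partial>M) =
      (\<integral>\<omega>. A (sample_mean \<Phi> k \<omega>) \<partial>M) - (\<integral>\<omega>. A (sample_mean \<Phi> (2 * k) \<omega>) \<partial>M)"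
    using ints k second_mean_law(2)[OF k] by simp
qed

lemma expected_A_doubling_le:
  assumes k: "0 < k"
  shows "(\<integral>\<omega>. A (sample_mean \<Phi> (2 * k) \<omega>) \<partial>M) \<le> (\<integral>\<omega>. A (sample_mean \<Phi> k \<omega>) \<partial>M)"
proof -
  have "0 \<le> (\<integral>\<omega>. (A (sample_mean \<Phi> k \<omega>) + A (second_mean k \<omega>)) / 2 - A (sample_mean \<Phi> (2 * k) \<omega>) \<partial>M)"
    using doubling_gap(1)[OF k] by (intro integral_nonneg_AE) auto
  then show ?thesis using doubling_gap(2)[OF k] by simp
qed

lemma expected_A_decseq: "decseq (\<lambda>n. \<integral>\<omega>. A (sample_mean \<Phi> (2 ^ n) \<omega>) \<partial>M)"
  using expected_A_doubling_le by (intro decseq_SucI) simp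

text \<open>The bound is free of \<open>k\<close>, so the decreasing expectations have a real limit
  before it is known what that limit is.\<close>

lemma expected_A_lower:
  assumes k: "0 < k"
  shows "c + (\<integral>\<omega>. \<Phi> (W \<omega>, D \<omega>) \<partial>M) \<bullet> m \<le> (\<integral>\<omega>. A (sample_mean \<Phi> k \<omega>) \<partial>M)"
proof -
  have i: "integrable M (sample_mean \<Phi> k)" using int_\<Phi> by (intro integrable_sample_mean) auto
  have "c + (\<integral>\<omega>. \<Phi> (W \<omega>, D \<omega>) \<partial>M) \<bullet> m = (\<integral>\<omega>. c + sample_mean \<Phi> k \<omega> \<bullet> m \<partial>M)"
    using i integral_sample_mean[OF \<Phi>_meas int_\<Phi> k] by (simp add: prob_space)
  also have "\<dots> \<le> (\<integral>\<omega>. A (sample_mean \<Phi> k \<omega>) \<partial>M)"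
    using i integrable_A_mean[OF k] A_minorant mean_in_\<Theta>[OF k] by (intro integral_mono) auto
  finally show ?thesis .
qed

text \<open>The whole sequence converges by monotonicity; the subsequence only identifies the limit.
  Integrability of \<open>A\<close> at the limit prediction is a by-product of Pratt's
  lemma.\<close>

lemma expected_A_limit:
  "integrable M (\<lambda>\<omega>. A (limit_prediction \<omega>))"
  "(\<lambda>n. \<integral>\<omega>. A (sample_mean \<Phi> (2 ^ n) \<omega>) \<partial>M) \<longlonglongrightarrow> (\<integral>\<omega>. A (limit_prediction \<omega>) \<partial>M)"
proof -
  let ?L = "\<lambda>n. \<integral>\<omega>. A (sample_mean \<Phi> (2 ^ n) \<omega>) \<partial>M"
  have A\<Phi>m: "(\<lambda>x. A (\<Phi> x)) \<in> borel_measurable (SW \<Otimes>\<^sub>M SD)" by measurable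
  have "\<forall>n. c + (\<integral>\<omega>. \<Phi> (W \<omega>, D \<omega>) \<partial>M) \<bullet> m \<le> ?L n"
    using expected_A_lower by simp
  then obtain L where L: "?L \<longlonglongrightarrow> L"
    using decseq_convergent[OF expected_A_decseq] by blast
  obtain r where r: "strict_mono r"
    "AE \<omega> in M. (\<lambda>n. sample_mean \<Phi> (2 ^ r n) \<omega>) \<longlonglongrightarrow> limit_prediction \<omega>"
    "AE \<omega> in M. (\<lambda>n. sample_mean (\<lambda>x. A (\<Phi> x)) (2 ^ r n) \<omega>) \<longlonglongrightarrow> cmean (\<lambda>x. A (\<Phi> x)) \<omega>"
    by (rule subsequence_convergence)
  have Lr: "(\<lambda>n. ?L (r n)) \<longlonglongrightarrow> L"
    using LIMSEQ_subseq_LIMSEQ[OF L r(1)] by (simp add: comp_def)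
  have im: "integrable M (sample_mean \<Phi> k)" for k using int_\<Phi> by (intro integrable_sample_mean) auto
  \<comment> \<open>The integrals of both squeezing sequences are constant in \<open>n\<close>,
    because averaging preserves expectations; only their pointwise limits along \<open>r\<close>
    require work.\<close>
  have *: "integrable M (\<lambda>\<omega>. A (limit_prediction \<omega>)) \<and> (\<lambda>n. ?L (r n)) \<longlonglongrightarrow> (\<integral>\<omega>. A (limit_prediction \<omega>) \<partial>M)"
  proof (rule pratt_convergence[where l="\<lambda>n \<omega>. c + sample_mean \<Phi> (2 ^ r n) \<omega> \<bullet> m"
        and l'="\<lambda>\<omega>. c + limit_prediction \<omega> \<bullet> m"
        and h="\<lambda>n. sample_mean (\<lambda>x. A (\<Phi> x)) (2 ^ r n)" and h'="cmean (\<lambda>x. A (\<Phi> x))"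
        and u="\<lambda>n \<omega>. A (sample_mean \<Phi> (2 ^ r n) \<omega>)"])
    show "AE \<omega> in M. (\<lambda>n. A (sample_mean \<Phi> (2 ^ r n) \<omega>)) \<longlonglongrightarrow> A (limit_prediction \<omega>)"
      by (rule A_sample_mean_tendsto[OF r(1,2)])
    show "AE \<omega> in M. (\<lambda>n. c + sample_mean \<Phi> (2 ^ r n) \<omega> \<bullet> m) \<longlonglongrightarrow> c + limit_prediction \<omega> \<bullet> m"
      using r(2) by eventually_elim (intro tendsto_intros)
    show "convergent (\<lambda>n. ?L (r n))" using Lr by (auto simp: convergent_def)
    show "(\<lambda>n. \<integral>\<omega>. c + sample_mean \<Phi> (2 ^ r n) \<omega> \<bullet> m \<partial>M) \<longlonglongrightarrow> (\<integral>\<omega>. c + limit_prediction \<omega> \<bullet> m \<partial>M)"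
      using im integral_sample_mean[OF \<Phi>_meas int_\<Phi>] integrable_limit_prediction integral_limit_prediction
      by simp
    show "(\<lambda>n. \<integral>\<omega>. sample_mean (\<lambda>x. A (\<Phi> x)) (2 ^ r n) \<omega> \<partial>M) \<longlonglongrightarrow> (\<integral>\<omega>. cmean (\<lambda>x. A (\<Phi> x)) \<omega> \<partial>M)"
      using integral_sample_mean[OF A\<Phi>m int_A\<Phi>] real_cond_exp_int(2)[OF int_A\<Phi>] by simp
    show "integrable M (cmean (\<lambda>x. A (\<Phi> x)))" by (rule real_cond_exp_int(1)[OF int_A\<Phi>])
    show "integrable M (sample_mean (\<lambda>x. A (\<Phi> x)) (2 ^ r n))" for n
      by (rule integrable_sample_mean[OF A\<Phi>m int_A\<Phi>])
    show "AE \<omega> in M. A (sample_mean \<Phi> (2 ^ r n) \<omega>) \<le> sample_mean (\<lambda>x. A (\<Phi> x)) (2 ^ r n) \<omega>" for n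
      by (intro AE_I2 A_mean_le) auto
    show "AE \<omega> in M. c + sample_mean \<Phi> (2 ^ r n) \<omega> \<bullet> m \<le> A (sample_mean \<Phi> (2 ^ r n) \<omega>)" for n
      by (intro AE_I2 A_minorant mean_in_\<Theta>) auto
    show "integrable M (\<lambda>\<omega>. c + sample_mean \<Phi> (2 ^ r n) \<omega> \<bullet> m)" for n
      using im by simp
    show "integrable M (\<lambda>\<omega>. c + limit_prediction \<omega> \<bullet> m)"
      using integrable_limit_prediction by simp
    show "integrable M (\<lambda>\<omega>. A (sample_mean \<Phi> (2 ^ r n) \<omega>))" for n
      by (rule integrable_A_mean) simp
    show "AE \<omega> in M. (\<lambda>n. sample_mean (\<lambda>x. A (\<Phi> x)) (2 ^ r n) \<omega>) \<longlonglongrightarrow> cmean (\<lambda>x. A (\<Phi> x)) \<omega>"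
      by (rule r(3))
    show "(\<lambda>\<omega>. A (limit_prediction \<omega>)) \<in> borel_measurable M"
      by (intro measurable_compose[OF limit_prediction_measurable(2) A_meas])
  qed
  then show "integrable M (\<lambda>\<omega>. A (limit_prediction \<omega>))" by simp
  have "L = (\<integral>\<omega>. A (limit_prediction \<omega>) \<partial>M)"
    using * Lr LIMSEQ_unique by blast
  then show "?L \<longlonglongrightarrow> (\<integral>\<omega>. A (limit_prediction \<omega>) \<partial>M)" using L by simp
qed

text \<open>Conditioning the difference of the two half means on \<open>(Ws 0, D)\<close> isolates the prediction
  of member \<open>0\<close>.\<close>

lemma degenerate_if_halves_equal:
  assumes k: "0 < k" and eq: "AE \<omega> in M. sample_mean \<Phi> k \<omega> = second_mean k \<omega>"
  shows "AE \<omega> in M. \<Phi> (Ws 0 \<omega>, D \<omega>) = limit_prediction \<omega>"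
proof -
  interpret G: finite_measure_subalgebra M "G 0" by (rule subalg_G)
  \<comment> \<open>The difference of the half means has coefficients of total sum 0. After
    conditioning, all members but number 0 contribute the conditional mean, with total coefficient
    \<open>- s 0\<close>; what remains is \<open>s 0\<close> times the deviation of member 0, and
    \<open>s 0\<close> is not 0.\<close>
  define s where "s i = (if i < k then 1 / real k else - (1 / real k))" for i
  have s_sum: "(\<Sum>i<k + k. s i) = 0"
    unfolding sum_lessThan_add by (simp add: s_def)
  have comp: "AE \<omega> in M. \<Phi> (Ws 0 \<omega>, D \<omega>) \<bullet> b = cmean (\<lambda>x. \<Phi> x \<bullet> b) \<omega>" for b
  proof -
    let ?\<psi> = "\<lambda>x. \<Phi> x \<bullet> b"
    let ?E = "\<lambda>i. real_cond_exp M (G 0) (\<lambda>\<omega>. ?\<psi> (Ws i \<omega>, D \<omega>))"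
    have ii: "integrable M (\<lambda>\<omega>. ?\<psi> (Ws i \<omega>, D \<omega>))" for i
      using int_\<Phi>_inner by (subst integrable_Ws[of ?\<psi>]) auto
    have diff: "(\<Sum>i<k + k. s i * ?\<psi> (Ws i \<omega>, D \<omega>)) = (sample_mean \<Phi> k \<omega> - second_mean k \<omega>) \<bullet> b" for \<omega>
      unfolding sum_lessThan_add
      by (simp add: s_def sample_mean_def second_mean_def inner_diff_left inner_sum_left
          sum_negf sum_divide_distrib)
    have "AE \<omega> in M. real_cond_exp M (G 0) (\<lambda>\<omega>. \<Sum>i<k + k. s i * ?\<psi> (Ws i \<omega>, D \<omega>)) \<omega> = real_cond_exp M (G 0) (\<lambda>\<omega>. 0) \<omega>"
      using eq by (intro G.real_cond_exp_cong) (auto simp: diff elim!: AE_mp)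
    moreover have "AE \<omega> in M. real_cond_exp M (G 0) (\<lambda>\<omega>. 0) \<omega> = 0"
      by (rule G.real_cond_exp_F_meas) auto
    moreover have "AE \<omega> in M. real_cond_exp M (G 0) (\<lambda>\<omega>. \<Sum>i<k + k. s i * ?\<psi> (Ws i \<omega>, D \<omega>)) \<omega> =
        (\<Sum>i<k + k. real_cond_exp M (G 0) (\<lambda>\<omega>. s i * ?\<psi> (Ws i \<omega>, D \<omega>)) \<omega>)"
      using ii by (intro G.real_cond_exp_sum) auto
    moreover have "AE \<omega> in M. \<forall>i\<in>{..<k + k}. real_cond_exp M (G 0) (\<lambda>\<omega>. s i * ?\<psi> (Ws i \<omega>, D \<omega>)) \<omega> = s i * ?E i \<omega>"
      using ii by (intro AE_finite_allI G.real_cond_exp_cmult) auto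
    moreover have "AE \<omega> in M. \<forall>i\<in>{..<k + k} - {0}. ?E i \<omega> = cmean ?\<psi> \<omega>"
      using int_\<Phi>_inner by (intro AE_finite_allI real_cond_exp_G) auto
    moreover have "AE \<omega> in M. ?E 0 \<omega> = ?\<psi> (Ws 0 \<omega>, D \<omega>)"
      using ii by (intro G.real_cond_exp_F_meas measurable_G[of ?\<psi>]) auto
    ultimately show ?thesis
    proof eventually_elim
      case (elim \<omega>)
      have "0 = (\<Sum>i<k + k. s i * ?E i \<omega>)" using elim by simp
      also have "\<dots> = s 0 * ?E 0 \<omega> + (\<Sum>i\<in>{..<k + k} - {0}. s i * ?E i \<omega>)"
        using k by (intro sum.remove) auto
      also have "\<dots> = s 0 * ?\<psi> (Ws 0 \<omega>, D \<omega>) + (\<Sum>i\<in>{..<k + k} - {0}. s i * cmean ?\<psi> \<omega>)"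
        using elim by simp
      also have "(\<Sum>i\<in>{..<k + k} - {0}. s i * cmean ?\<psi> \<omega>) = (\<Sum>i<k + k. s i * cmean ?\<psi> \<omega>) - s 0 * cmean ?\<psi> \<omega>"
        using k by (subst sum.remove[of "{..<k + k}" 0]) auto
      also have "(\<Sum>i<k + k. s i * cmean ?\<psi> \<omega>) = 0"
        using s_sum by (simp add: sum_distrib_right[symmetric])
      finally have "s 0 * (?\<psi> (Ws 0 \<omega>, D \<omega>) - cmean ?\<psi> \<omega>) = 0"
        by (auto simp: algebra_simps)
      then show ?case using k by (simp add: s_def)
    qed
  qed
  have "AE \<omega> in M. \<forall>b\<in>Basis. \<Phi> (Ws 0 \<omega>, D \<omega>) \<bullet> b = cmean (\<lambda>x. \<Phi> x \<bullet> b) \<omega>"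
    using comp by (intro AE_finite_allI) auto
  then show ?thesis
    by eventually_elim (rule euclidean_eqI, simp add: limit_prediction_inner)
qed

lemma limit_prediction_factor:
  obtains g where "g \<in> borel_measurable SD" "\<And>\<omega>. \<omega> \<in> space M \<Longrightarrow> limit_prediction \<omega> = g (D \<omega>)"
proof -
  have "\<exists>g\<in>borel_measurable SD. \<forall>\<omega>\<in>space M. cmean (\<lambda>x. \<Phi> x \<bullet> b) \<omega> = g (D \<omega>)" for b
    using measurable_space[OF D_meas]
    by (intro doob_dynkin_real) (auto simp: generated_def[symmetric])
  then obtain g where g: "\<And>b. g b \<in> borel_measurable SD"
    "\<And>b \<omega>. \<omega> \<in> space M \<Longrightarrow> cmean (\<lambda>x. \<Phi> x \<bullet> b) \<omega> = g b (D \<omega>)"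
    by metis
  show ?thesis
  proof (rule that[of "\<lambda>d. \<Sum>b\<in>Basis. g b d *\<^sub>R b"])
    show "(\<lambda>d. \<Sum>b\<in>Basis. g b d *\<^sub>R b) \<in> borel_measurable SD"
      using g(1) by (intro borel_measurable_sum borel_measurable_scaleR) auto
    show "limit_prediction \<omega> = (\<Sum>b\<in>Basis. g b (D \<omega>) *\<^sub>R b)" if "\<omega> \<in> space M" for \<omega>
      using g(2)[OF that] by (simp add: vec_cond_exp_def)
  qed
qed

lemma expected_A_doubling_less:
  assumes k: "0 < k" and strict: "strictly_convex_on \<Theta> A"
    and source: "\<not> (\<exists>g\<in>borel_measurable SD. AE \<omega> in M. \<Phi> (W \<omega>, D \<omega>) = g (D \<omega>))"
  shows "(\<integral>\<omega>. A (sample_mean \<Phi> (2 * k) \<omega>) \<partial>M) < (\<integral>\<omega>. A (sample_mean \<Phi> k \<omega>) \<partial>M)"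
proof (rule ccontr)
  let ?d = "\<lambda>\<omega>. (A (sample_mean \<Phi> k \<omega>) + A (second_mean k \<omega>)) / 2 - A (sample_mean \<Phi> (2 * k) \<omega>)"
  assume "\<not> ?thesis"
  then have "(\<integral>\<omega>. ?d \<omega> \<partial>M) \<le> 0" using doubling_gap(2)[OF k] by simp
  moreover have d0: "AE \<omega> in M. 0 \<le> ?d \<omega>" using doubling_gap(1)[OF k] by auto
  ultimately have "(\<integral>\<omega>. ?d \<omega> \<partial>M) = 0" using integral_nonneg_AE[OF d0] by linarith
  then have "AE \<omega> in M. ?d \<omega> = 0"
    using integral_nonneg_eq_0_iff_AE[OF doubling_gap(3)[OF k] d0] by simp
  then have "AE \<omega> in M. sample_mean \<Phi> k \<omega> = second_mean k \<omega>"
    using AE_space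
  proof eventually_elim
    case (elim \<omega>)
    show ?case
    proof (rule ccontr)
      assume ne: "sample_mean \<Phi> k \<omega> \<noteq> second_mean k \<omega>"
      have "A ((1 - 1 / 2) *\<^sub>R sample_mean \<Phi> k \<omega> + (1 / 2) *\<^sub>R second_mean k \<omega>) <
          (1 - 1 / 2) * A (sample_mean \<Phi> k \<omega>) + (1 / 2) * A (second_mean k \<omega>)"
        using mean_in_\<Theta>[OF k elim(2)] second_mean_in_\<Theta>[OF k elim(2)]
        by (intro strict[unfolded strictly_convex_on_def, THEN conjunct2, rule_format] ne) auto
      then show False using elim(1) by (simp add: sample_mean_double)
    qed
  qed
  then have ae: "AE \<omega> in M. \<Phi> (Ws 0 \<omega>, D \<omega>) = limit_prediction \<omega>"
    by (rule degenerate_if_halves_equal[OF k])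
  obtain g where [measurable]: "g \<in> borel_measurable SD"
    and g: "\<And>\<omega>. \<omega> \<in> space M \<Longrightarrow> limit_prediction \<omega> = g (D \<omega>)"
    using limit_prediction_factor by metis
  \<comment> \<open>Degeneracy was shown for the copy \<open>Ws 0\<close>. Written as a property of
    the pair with \<open>D\<close>, it transfers to \<open>W\<close> by equality of the joint
    laws.\<close>
  have "AE \<omega> in M. (\<lambda>x. \<Phi> x = g (snd x)) (Ws 0 \<omega>, D \<omega>)"
    using ae AE_space by eventually_elim (simp add: g)
  then have "AE \<omega> in M. (\<lambda>x. \<Phi> x = g (snd x)) (W \<omega>, D \<omega>)"
    by (subst (asm) AE_Ws) measurable
  then show False using source by auto
qed

end

section \<open>Exponential families\<close>

text \<open>Sigma-finiteness of \<open>\<nu>\<close> makes an integral measurable in its parameter.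
  The claim covers the whole space, including points where the integral or the logarithm takes a
  default value.\<close>

lemma log_partition_measurable:
  assumes "exponential_family \<nu> T h \<Theta>"
  shows "log_partition \<nu> T h \<in> borel_measurable borel"
proof -
  interpret sigma_finite_measure \<nu> using assms by (simp add: exponential_family_def)
  have [measurable]: "T \<in> borel_measurable \<nu>" "h \<in> borel_measurable \<nu>"
    using assms by (auto simp: exponential_family_def)
  show ?thesis unfolding log_partition_def[abs_def] by measurable
qed

lemma expfam_density_measurable:
  assumes "exponential_family \<nu> T h \<Theta>"
  shows "expfam_density \<nu> T h \<theta> \<in> borel_measurable \<nu>"
proof -
  have [measurable]: "T \<in> borel_measurable \<nu>" "h \<in> borel_measurable \<nu>"
    using assms by (auto simp: exponential_family_def)
  show ?thesis unfolding expfam_density_def[abs_def] by measurable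
qed

text \<open>Tilting \<open>p\<^sub>\<theta>\<close> by \<open>exp ((\<eta> - \<theta>) \<bullet> T)\<close> gives a multiple of \<open>p\<^sub>\<eta>\<close>, which has total mass 1.\<close>

lemma expfam_mgf:
  assumes family: "exponential_family \<nu> T h \<Theta>" and \<eta>: "\<eta> \<in> \<Theta>"
    and target: "distributed M \<nu> Y (\<lambda>x. ennreal (expfam_density \<nu> T h \<theta> x))"
  shows "integrable M (\<lambda>\<omega>. exp ((\<eta> - \<theta>) \<bullet> T (Y \<omega>)))"
    and "(\<integral>\<omega>. exp ((\<eta> - \<theta>) \<bullet> T (Y \<omega>)) \<partial>M) = exp (log_partition \<nu> T h \<eta> - log_partition \<nu> T h \<theta>)"
proof -
  let ?A = "log_partition \<nu> T h" and ?p = "expfam_density \<nu> T h"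
  have [measurable]: "T \<in> borel_measurable \<nu>" "h \<in> borel_measurable \<nu>"
    using family by (auto simp: exponential_family_def)
  have [measurable]: "Y \<in> measurable M \<nu>" using target by (rule distributed_measurable)
  have [measurable]: "?p \<eta> \<in> borel_measurable \<nu>" by (rule expfam_density_measurable[OF family])
  interpret P: prob_space "density \<nu> (\<lambda>x. ennreal (?p \<eta> x))"
    using family \<eta> by (simp add: exponential_family_def)
  have one: "(\<integral>\<^sup>+x. ennreal (?p \<eta> x) \<partial>\<nu>) = 1"
    using P.emeasure_space_1 by (simp add: emeasure_density cong: nn_integral_cong)
  have tilt: "?p \<theta> x * exp ((\<eta> - \<theta>) \<bullet> T x) = exp (?A \<eta> - ?A \<theta>) * ?p \<eta> x" for x
    by (simp add: expfam_density_def inner_diff_left algebra_simps flip: exp_add)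
  have "(\<integral>\<^sup>+\<omega>. ennreal (exp ((\<eta> - \<theta>) \<bullet> T (Y \<omega>))) \<partial>M) =
      (\<integral>\<^sup>+x. ennreal (?p \<theta> x) * ennreal (exp ((\<eta> - \<theta>) \<bullet> T x)) \<partial>\<nu>)"
    by (rule distributed_nn_integral[OF target, symmetric]) measurable
  also have "\<dots> = (\<integral>\<^sup>+x. ennreal (exp (?A \<eta> - ?A \<theta>)) * ennreal (?p \<eta> x) \<partial>\<nu>)"
    by (intro nn_integral_cong) (simp flip: ennreal_mult' ennreal_mult'' add: tilt)
  also have "\<dots> = ennreal (exp (?A \<eta> - ?A \<theta>))"
    by (subst nn_integral_cmult) (auto simp: one)
  finally have nn: "(\<integral>\<^sup>+\<omega>. ennreal (exp ((\<eta> - \<theta>) \<bullet> T (Y \<omega>))) \<partial>M) = ennreal (exp (?A \<eta> - ?A \<theta>))" .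
  then show int: "integrable M (\<lambda>\<omega>. exp ((\<eta> - \<theta>) \<bullet> T (Y \<omega>)))"
    by (intro integrableI_nonneg) auto
  show "(\<integral>\<omega>. exp ((\<eta> - \<theta>) \<bullet> T (Y \<omega>)) \<partial>M) = exp (?A \<eta> - ?A \<theta>)"
    using nn by (subst (asm) nn_integral_eq_integral[OF int]) auto
qed

text \<open>This is nonnegativity of the Kullback-Leibler divergence of
  \<open>p\<^sub>\<eta>\<close> from \<open>p\<^sub>\<theta>\<close>. Subtracting \<open>?a\<close>
  in the exponent normalizes the tilted expectation to 1. The mean of \<open>T (Y \<omega>)\<close>
  is thus a subgradient at \<open>\<theta>\<close> even on the boundary of
  \<open>\<Theta>\<close>.\<close>

lemma log_partition_minorant:
  assumes "prob_space M" and family: "exponential_family \<nu> T h \<Theta>" and \<eta>: "\<eta> \<in> \<Theta>"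
    and target: "distributed M \<nu> Y (\<lambda>x. ennreal (expfam_density \<nu> T h \<theta> x))"
    and int_T: "integrable M (\<lambda>\<omega>. T (Y \<omega>))"
  shows "log_partition \<nu> T h \<theta> + (\<eta> - \<theta>) \<bullet> (\<integral>\<omega>. T (Y \<omega>) \<partial>M) \<le> log_partition \<nu> T h \<eta>"
proof -
  interpret prob_space M by fact
  let ?a = "log_partition \<nu> T h \<eta> - log_partition \<nu> T h \<theta>"
  have int: "integrable M (\<lambda>\<omega>. exp ((\<eta> - \<theta>) \<bullet> T (Y \<omega>)) * exp (- ?a))"
    using expfam_mgf(1)[OF family \<eta> target] by simp
  have "1 + ((\<eta> - \<theta>) \<bullet> (\<integral>\<omega>. T (Y \<omega>) \<partial>M) - ?a) = (\<integral>\<omega>. 1 + ((\<eta> - \<theta>) \<bullet> T (Y \<omega>) - ?a) \<partial>M)"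
    using int_T by (simp add: prob_space)
  also have "\<dots> \<le> (\<integral>\<omega>. exp ((\<eta> - \<theta>) \<bullet> T (Y \<omega>)) * exp (- ?a) \<partial>M)"
  proof (rule integral_mono[OF _ int])
    show "1 + ((\<eta> - \<theta>) \<bullet> T (Y \<omega>) - ?a) \<le> exp ((\<eta> - \<theta>) \<bullet> T (Y \<omega>)) * exp (- ?a)" for \<omega>
      using exp_ge_add_one_self[of "(\<eta> - \<theta>) \<bullet> T (Y \<omega>) - ?a"] 
      by (simp only: exp_add[symmetric] diff_conv_add_uminus)
  qed (use int_T in simp)
  also have "\<dots> = exp ?a * exp (- ?a)"
    using expfam_mgf[OF family \<eta> target] by simp
  also have "\<dots> = 1" by (simp flip: exp_add)
  finally show ?thesis by simp
qed

section \<open>Differentiability of the log-partition at interior points\<close>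

lemma exp_le_quadratic: "exp x \<le> 1 + x + x\<^sup>2 * exp \<bar>x\<bar>" for x :: real
proof -
  obtain t where t: "\<bar>t\<bar> \<le> \<bar>x\<bar>" "exp x = (\<Sum>m<2. (x ^ m) / fact m) + (exp t / fact 2) * x ^ 2"
    using Maclaurin_exp_le[of x 2] by auto
  have "exp t / 2 \<le> exp \<bar>x\<bar>"
  proof -
    have "exp t \<le> exp \<bar>x\<bar>" using t(1) by simp
    then show ?thesis using exp_ge_zero[of t] by linarith
  qed
  then have "(exp t / 2) * x\<^sup>2 \<le> exp \<bar>x\<bar> * x\<^sup>2" by (intro mult_right_mono) auto
  then show ?thesis using t(2) by (simp add: numeral_2_eq_2 ac_simps)
qed

text \<open>Reduces an exponential moment of the norm to finitely many values of the moment
  generating function. The norm is at most \<open>DIM('e)\<close> times the largest coordinate in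
  modulus, whose sign is covered by the two exponentials.\<close>

lemma exp_norm_le_sum:
  fixes y :: "'e::euclidean_space"
  assumes a: "0 \<le> a"
  shows "exp (a * norm y) \<le>
    (\<Sum>b\<in>Basis. exp ((a * real DIM('e)) *\<^sub>R b \<bullet> y) + exp (- ((a * real DIM('e)) *\<^sub>R b) \<bullet> y))"
proof -
  let ?f = "\<lambda>b. exp ((a * real DIM('e)) *\<^sub>R b \<bullet> y) + exp (- ((a * real DIM('e)) *\<^sub>R b) \<bullet> y)"
  have "Max ((\<lambda>b. \<bar>y \<bullet> b\<bar>) ` Basis) \<in> (\<lambda>b. \<bar>y \<bullet> b\<bar>) ` Basis"
    by (rule Max_in) auto
  then obtain b0 :: 'e where b0: "b0 \<in> Basis" "Max ((\<lambda>b. \<bar>y \<bullet> b\<bar>) ` Basis) = \<bar>y \<bullet> b0\<bar>"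
    by (metis (lifting) imageE)
  have "norm y \<le> (\<Sum>b\<in>Basis. \<bar>y \<bullet> b\<bar>)" by (rule norm_le_l1)
  also have "\<dots> \<le> (\<Sum>b\<in>(Basis::'e set). \<bar>y \<bullet> b0\<bar>)"
    unfolding b0(2)[symmetric] by (intro sum_mono Max_ge) auto
  finally have "a * norm y \<le> a * (real DIM('e) * \<bar>y \<bullet> b0\<bar>)"
    using a by (intro mult_left_mono) auto
  then have "exp (a * norm y) \<le> exp (a * (real DIM('e) * \<bar>y \<bullet> b0\<bar>))" by simp
  also have "\<dots> \<le> ?f b0"
    by (cases "0 \<le> y \<bullet> b0") (simp_all add: inner_commute[of b0] ac_simps abs_if)
  also have "\<dots> \<le> (\<Sum>b\<in>Basis. ?f b)"
    by (rule member_le_sum) (use b0 in \<open>auto intro: add_nonneg_nonneg\<close>)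
  finally show ?thesis .
qed

text \<open>Differentiation under the integral is avoided. The first-order remainder is nonnegative
  by the minorant and at most \<open>K * (norm u)\<^sup>2\<close> by a second-order bound on the
  exponential, so it is negligible against \<open>norm u\<close>.\<close>

lemma gderiv_log_partition:
  fixes T :: "'x \<Rightarrow> 'e::euclidean_space"
  assumes prob: "prob_space M" and family: "exponential_family \<nu> T h \<Theta>" and \<theta>: "\<theta> \<in> interior \<Theta>"
    and target: "distributed M \<nu> Y (\<lambda>x. ennreal (expfam_density \<nu> T h \<theta> x))"
    and int_T: "integrable M (\<lambda>\<omega>. T (Y \<omega>))"
  shows "GDERIV (log_partition \<nu> T h) \<theta> :> (\<integral>\<omega>. T (Y \<omega>) \<partial>M)"
proof -
  interpret prob_space M by fact
  let ?A = "log_partition \<nu> T h" and ?\<mu> = "\<integral>\<omega>. T (Y \<omega>) \<partial>M"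
  obtain \<rho> where \<rho>: "0 < \<rho>" "ball \<theta> \<rho> \<subseteq> \<Theta>"
    using \<theta> by (auto simp: mem_interior)
  \<comment> \<open>With this choice the points at which \<open>exp_norm_le_sum\<close> evaluates
    the moment generating function have norm \<open>\<rho> / 2\<close> and stay inside the
    ball.\<close>
  define a where "a = \<rho> / (2 * real DIM('e))"
  have a: "0 < a" using \<rho>(1) by (simp add: a_def)
  have aD: "a * real DIM('e) = \<rho> / 2" by (simp add: a_def)
  have near: "\<theta> + u \<in> \<Theta>" if "norm u < \<rho>" for u
    using that \<rho>(2) by (auto simp: dist_norm)
  have mgf: "integrable M (\<lambda>\<omega>. exp (u \<bullet> T (Y \<omega>)))"
    "(\<integral>\<omega>. exp (u \<bullet> T (Y \<omega>)) \<partial>M) = exp (?A (\<theta> + u) - ?A \<theta>)" if "norm u < \<rho>" for u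
    using expfam_mgf[OF family near[OF that] target] by simp_all
  have [measurable]: "(\<lambda>\<omega>. T (Y \<omega>)) \<in> borel_measurable M" using int_T by auto
  have int_exp: "integrable M (\<lambda>\<omega>. exp (a * norm (T (Y \<omega>))))"
  proof (rule Bochner_Integration.integrable_bound)
    show "integrable M (\<lambda>\<omega>. \<Sum>b\<in>Basis. exp ((a * real DIM('e)) *\<^sub>R b \<bullet> T (Y \<omega>)) +
        exp (- ((a * real DIM('e)) *\<^sub>R b) \<bullet> T (Y \<omega>)))"
      using \<rho>(1) by (intro Bochner_Integration.integrable_sum Bochner_Integration.integrable_add mgf) (simp_all add: aD)
    show "AE \<omega> in M. norm (exp (a * norm (T (Y \<omega>)))) \<le> norm (\<Sum>b\<in>Basis. exp ((a * real DIM('e)) *\<^sub>R b \<bullet> T (Y \<omega>)) +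
        exp (- ((a * real DIM('e)) *\<^sub>R b) \<bullet> T (Y \<omega>)))"
    proof (rule AE_I2)
      fix \<omega>
      show "norm (exp (a * norm (T (Y \<omega>)))) \<le> norm (\<Sum>b\<in>Basis. exp ((a * real DIM('e)) *\<^sub>R b \<bullet> T (Y \<omega>)) +
        exp (- ((a * real DIM('e)) *\<^sub>R b) \<bullet> T (Y \<omega>)))"
        using exp_norm_le_sum[of a "T (Y \<omega>)"] a by (auto intro: order_trans[OF _ abs_ge_self])
    qed
  qed measurable
  \<comment> \<open>Half of the exponent \<open>a\<close> absorbs the square,
    \<open>(norm t)\<^sup>2 \<le> 8 / a\<^sup>2 * exp (a / 2 * norm t)\<close> from
    \<open>x\<^sup>2 / 2 \<le> exp x\<close>. The other half pays for
    \<open>exp \<bar>u \<bullet> t\<bar>\<close> when \<open>norm u \<le> a / 2\<close>.\<close>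
  define K where "K = 8 / a\<^sup>2 * (\<integral>\<omega>. exp (a * norm (T (Y \<omega>))) \<partial>M)"
  have pointwise: "exp (u \<bullet> t) \<le> 1 + u \<bullet> t + (norm u)\<^sup>2 * (8 / a\<^sup>2 * exp (a * norm t))"
    if u: "norm u \<le> a / 2" for u t :: 'e
  proof -
    have cs: "\<bar>u \<bullet> t\<bar> \<le> norm u * norm t" by (rule Cauchy_Schwarz_ineq2)
    have "(norm t)\<^sup>2 \<le> 8 / a\<^sup>2 * exp (a / 2 * norm t)"
    proof -
      have "(a / 2 * norm t)\<^sup>2 / 2 \<le> exp (a / 2 * norm t)"
        using exp_lower_Taylor_quadratic[of "a / 2 * norm t"] a by (smt (verit) norm_ge_zero mult_nonneg_nonneg half_gt_zero)
      then show ?thesis using a by (simp add: power2_eq_square field_simps)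
    qed
    moreover have "exp \<bar>u \<bullet> t\<bar> \<le> exp (a / 2 * norm t)"
      using cs mult_right_mono[OF u norm_ge_zero[of t]] by simp
    moreover have "(u \<bullet> t)\<^sup>2 \<le> (norm u)\<^sup>2 * (norm t)\<^sup>2"
      using power_mono[OF cs, of 2] by (simp add: power_mult_distrib)
    ultimately have "(u \<bullet> t)\<^sup>2 * exp \<bar>u \<bullet> t\<bar> \<le>
        ((norm u)\<^sup>2 * (8 / a\<^sup>2 * exp (a / 2 * norm t))) * exp (a / 2 * norm t)"
      by (intro mult_mono order_trans[OF \<open>(u \<bullet> t)\<^sup>2 \<le> (norm u)\<^sup>2 * (norm t)\<^sup>2\<close>] mult_left_mono) auto
    also have "\<dots> = (norm u)\<^sup>2 * (8 / a\<^sup>2 * (exp (a / 2 * norm t) * exp (a / 2 * norm t)))" by simp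
    also have "exp (a / 2 * norm t) * exp (a / 2 * norm t) = exp (a * norm t)"
      by (simp flip: exp_add)
    finally show ?thesis using exp_le_quadratic[of "u \<bullet> t"] by simp
  qed
  have upper: "?A (\<theta> + u) - ?A \<theta> - u \<bullet> ?\<mu> \<le> K * (norm u)\<^sup>2" if u: "norm u \<le> a / 2" for u
  proof -
    have "a \<le> \<rho> / 2"
      unfolding a_def using \<rho>(1) DIM_positive[where 'a='e] by (intro divide_left_mono) (auto simp: Suc_le_eq)
    then have u': "norm u < \<rho>" using u \<rho>(1) a by linarith
    have i: "integrable M (\<lambda>\<omega>. (norm u)\<^sup>2 * (8 / a\<^sup>2 * exp (a * norm (T (Y \<omega>)))))"
      by (intro integrable_mult_right int_exp)
    have "1 + (?A (\<theta> + u) - ?A \<theta>) \<le> exp (?A (\<theta> + u) - ?A \<theta>)"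
      by (rule exp_ge_add_one_self)
    also have "\<dots> = (\<integral>\<omega>. exp (u \<bullet> T (Y \<omega>)) \<partial>M)" using mgf(2)[OF u'] by simp
    also have "\<dots> \<le> (\<integral>\<omega>. 1 + u \<bullet> T (Y \<omega>) + (norm u)\<^sup>2 * (8 / a\<^sup>2 * exp (a * norm (T (Y \<omega>)))) \<partial>M)"
      using i int_T by (intro integral_mono mgf(1)[OF u'] pointwise[OF u] Bochner_Integration.integrable_add) auto
    also have "\<dots> = 1 + u \<bullet> ?\<mu> + K * (norm u)\<^sup>2"
      using i int_T by (simp add: prob_space K_def)
    finally show ?thesis by simp
  qed
  have lower: "0 \<le> ?A (\<theta> + u) - ?A \<theta> - u \<bullet> ?\<mu>" if u: "norm u < \<rho>" for u
    using log_partition_minorant[OF prob family near[OF u] target int_T] by simp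
  have "(\<lambda>u. norm (?A (\<theta> + u) - ?A \<theta> - u \<bullet> ?\<mu>) / norm u) \<midarrow>0\<rightarrow> 0"
  proof (rule Lim_null_comparison)
    have "\<forall>\<^sub>F u in at (0::'e). norm u < min \<rho> (a / 2)"
      using eventually_at_ball[of "min \<rho> (a / 2)" "0::'e" UNIV] \<rho>(1) a by (simp add: dist_norm eventually_mono)
    then show "\<forall>\<^sub>F u in at 0. norm (norm (?A (\<theta> + u) - ?A \<theta> - u \<bullet> ?\<mu>) / norm u) \<le> K * norm u"
    proof eventually_elim
      case (elim u)
      then have "\<bar>?A (\<theta> + u) - ?A \<theta> - u \<bullet> ?\<mu>\<bar> \<le> K * (norm u)\<^sup>2"
        using lower[of u] upper[of u] by simp
      then show ?case
        by (cases "u = 0") (simp_all add: divide_simps power2_eq_square mult.assoc)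
    qed
    show "((\<lambda>u. K * norm u) \<longlongrightarrow> 0) (at (0::'e))"
      by (intro tendsto_mult_right_zero tendsto_norm_zero tendsto_ident_at)
  qed
  then show ?thesis
    unfolding gderiv_def has_derivative_at by (simp add: bounded_linear_inner_left)
qed

lemma grad_eqI:
  assumes "GDERIV f x :> g"
  shows "grad f x = g"
  unfolding grad_def
proof (rule the_equality)
  show "GDERIV f x :> g" by (rule assms)
  fix g' assume "GDERIV f x :> g'"
  then have "(\<lambda>h. h \<bullet> g') = (\<lambda>h. h \<bullet> g)"
    using assms unfolding gderiv_def by (rule has_derivative_unique)
  then have "(g' - g) \<bullet> g' = (g' - g) \<bullet> g" by (rule fun_cong)
  then have "(g' - g) \<bullet> (g' - g) = 0" by (simp only: inner_diff_right diff_self)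
  then show "g' = g" by simp
qed

text \<open>Fenchel equality at a subgradient \<open>y\<close>. The supremum is attained at
  \<open>\<theta>\<close>, so the real-valued \<open>SUP\<close> is a genuine supremum and not a
  default value.\<close>

lemma convex_conjugate_eq:
  assumes "\<theta> \<in> S" and "\<And>\<eta>. \<eta> \<in> S \<Longrightarrow> f \<theta> + (\<eta> - \<theta>) \<bullet> y \<le> f \<eta>"
  shows "convex_conjugate S f y = \<theta> \<bullet> y - f \<theta>"
  unfolding convex_conjugate_def
proof (rule cSup_eq_maximum)
  show "\<theta> \<bullet> y - f \<theta> \<in> (\<lambda>x. x \<bullet> y - f x) ` S" using assms(1) by auto
  show "z \<le> \<theta> \<bullet> y - f \<theta>" if "z \<in> (\<lambda>x. x \<bullet> y - f x) ` S" for z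
    using that assms(2) by (auto simp: inner_diff_left algebra_simps)
qed

section \<open>Expected negative log-likelihood under independence\<close>

text \<open>Justifies splitting the logarithm of the density into the exponent and
  \<open>ln (h (Y \<omega>))\<close>, which would fail at zeros of \<open>h\<close>.\<close>

lemma AE_reference_pos:
  assumes family: "exponential_family \<nu> T h \<Theta>"
    and target: "distributed M \<nu> Y (\<lambda>x. ennreal (expfam_density \<nu> T h \<theta> x))"
  shows "AE \<omega> in M. 0 < h (Y \<omega>)"
proof -
  have [measurable]: "h \<in> borel_measurable \<nu>"
    using family by (auto simp: exponential_family_def)
  have [measurable]: "expfam_density \<nu> T h \<theta> \<in> borel_measurable \<nu>" "Y \<in> measurable M \<nu>"
    using expfam_density_measurable[OF family] distributed_measurable[OF target] by auto
  have m: "(\<lambda>x. ennreal (expfam_density \<nu> T h \<theta> x)) \<in> borel_measurable \<nu>" by measurable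
  have "AE x in density \<nu> (\<lambda>x. ennreal (expfam_density \<nu> T h \<theta> x)). 0 < h x"
    unfolding AE_density[OF m]
    by (rule AE_I2) (auto simp: expfam_density_def zero_less_mult_iff)
  then have "AE x in distr M \<nu> Y. 0 < h x"
    unfolding distributed_distr_eq_density[OF target] .
  then show ?thesis by (subst (asm) AE_distr_iff) auto
qed

text \<open>In each coordinate the two factors are measurable for independent sigma-algebras, so the
  product of integrable real variables is integrable and its expectation factors; summing over the
  basis gives the inner product.\<close>

lemma (in prob_space) expectation_inner_indep:
  fixes T :: "'x \<Rightarrow> 'e::euclidean_space"
  assumes Y: "Y \<in> measurable M \<nu>" and T: "T \<in> borel_measurable \<nu>" and X: "X \<in> borel_measurable M"
    and indep: "indep_set (sets (generated M \<nu> Y)) (sets (generated M borel X))"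
    and int_X: "integrable M X" and int_T: "integrable M (\<lambda>\<omega>. T (Y \<omega>))"
  shows "integrable M (\<lambda>\<omega>. X \<omega> \<bullet> T (Y \<omega>))"
    and "(\<integral>\<omega>. X \<omega> \<bullet> T (Y \<omega>) \<partial>M) = (\<integral>\<omega>. X \<omega> \<partial>M) \<bullet> (\<integral>\<omega>. T (Y \<omega>) \<partial>M)"
proof -
  have sub: "sigma_sets (space M) {(\<lambda>\<omega>. f (Z \<omega>)) -` A \<inter> space M | A. A \<in> sets borel} \<subseteq> sets (generated M N Z)"
    if Z: "Z \<in> measurable M N" and f: "f \<in> borel_measurable N" for Z :: "'a \<Rightarrow> 'z" and f :: "'z \<Rightarrow> real" and N
  proof -
    have "(\<lambda>\<omega>. f (Z \<omega>)) \<in> borel_measurable (generated M N Z)"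
      using measurable_compose[OF measurable_generated[OF Z] f] .
    then have "{(\<lambda>\<omega>. f (Z \<omega>)) -` A \<inter> space M | A. A \<in> sets borel} \<subseteq> sets (generated M N Z)"
      by (auto dest: measurable_sets simp: generated_def)
    then show ?thesis
      using sets.sigma_sets_subset[of _ "generated M N Z"] by (simp add: generated_def)
  qed
  have Tb: "(\<lambda>x. T x \<bullet> b) \<in> borel_measurable \<nu>" for b using T by simp
  have iv: "indep_var borel (\<lambda>\<omega>. T (Y \<omega>) \<bullet> b) borel (\<lambda>\<omega>. X \<omega> \<bullet> b)" for b
  proof -
    note i = indep[unfolded indep_sets2_eq]
    have inner_b: "(\<lambda>x. x \<bullet> b) \<in> borel_measurable borel" by simp
    note s = sub[OF Y Tb, of b] sub[OF X inner_b]
    show ?thesis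
      unfolding indep_var_eq indep_sets2_eq
    proof (intro conjI ballI)
      show "(\<lambda>\<omega>. T (Y \<omega>) \<bullet> b) \<in> borel_measurable M"
        using measurable_compose[OF Y Tb] .
      show "(\<lambda>\<omega>. X \<omega> \<bullet> b) \<in> borel_measurable M" using X by simp
      show "sigma_sets (space M) {(\<lambda>\<omega>. T (Y \<omega>) \<bullet> b) -` A \<inter> space M |A. A \<in> sets borel} \<subseteq> events"
        by (rule order_trans[OF s(1)]) (use i in blast)
      show "sigma_sets (space M) {(\<lambda>\<omega>. X \<omega> \<bullet> b) -` A \<inter> space M |A. A \<in> sets borel} \<subseteq> events"
        by (rule order_trans[OF s(2)]) (use i in blast)
      fix E E'
      assume "E \<in> sigma_sets (space M) {(\<lambda>\<omega>. T (Y \<omega>) \<bullet> b) -` A \<inter> space M |A. A \<in> sets borel}"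
        "E' \<in> sigma_sets (space M) {(\<lambda>\<omega>. X \<omega> \<bullet> b) -` A \<inter> space M |A. A \<in> sets borel}"
      then have "E \<in> sets (generated M \<nu> Y)" "E' \<in> sets (generated M borel X)"
        using subsetD[OF s(1)] subsetD[OF s(2)] by blast+
      then show "prob (E \<inter> E') = prob E * prob E'" using i by blast
    qed
  qed
  have intb: "integrable M (\<lambda>\<omega>. T (Y \<omega>) \<bullet> b)" "integrable M (\<lambda>\<omega>. X \<omega> \<bullet> b)" for b
    using int_X int_T by simp_all
  have ib: "integrable M (\<lambda>\<omega>. (X \<omega> \<bullet> b) * (T (Y \<omega>) \<bullet> b))" for b
    using indep_var_integrable[OF iv intb] by (simp add: mult.commute)
  have eb: "(\<integral>\<omega>. (X \<omega> \<bullet> b) * (T (Y \<omega>) \<bullet> b) \<partial>M) = (\<integral>\<omega>. X \<omega> \<partial>M) \<bullet> b * ((\<integral>\<omega>. T (Y \<omega>) \<partial>M) \<bullet> b)" for b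
    using indep_var_lebesgue_integral[OF iv intb] int_X int_T by (simp add: mult.commute)
  show "integrable M (\<lambda>\<omega>. X \<omega> \<bullet> T (Y \<omega>))"
    by (subst euclidean_inner) (use ib in simp)
  show "(\<integral>\<omega>. X \<omega> \<bullet> T (Y \<omega>) \<partial>M) = (\<integral>\<omega>. X \<omega> \<partial>M) \<bullet> (\<integral>\<omega>. T (Y \<omega>) \<partial>M)"
    by (subst (1 2) euclidean_inner) (use ib eb in simp)
qed

lemma (in prob_space) expected_nll_eq:
  fixes T :: "'x \<Rightarrow> 'e::euclidean_space"
  assumes family: "exponential_family \<nu> T h \<Theta>"
    and target: "distributed M \<nu> Y (\<lambda>x. ennreal (expfam_density \<nu> T h \<theta> x))"
    and X: "X \<in> borel_measurable M"
    and indep: "indep_set (sets (generated M \<nu> Y)) (sets (generated M borel X))"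
    and int_X: "integrable M X" and int_A: "integrable M (\<lambda>\<omega>. log_partition \<nu> T h (X \<omega>))"
    and int_T: "integrable M (\<lambda>\<omega>. T (Y \<omega>))" and int_h: "integrable M (\<lambda>\<omega>. ln (h (Y \<omega>)))"
  shows "expected_nll M \<nu> T h Y X = (\<integral>\<omega>. log_partition \<nu> T h (X \<omega>) \<partial>M) -
    (\<integral>\<omega>. X \<omega> \<partial>M) \<bullet> (\<integral>\<omega>. T (Y \<omega>) \<partial>M) - (\<integral>\<omega>. ln (h (Y \<omega>)) \<partial>M)"
proof -
  let ?A = "log_partition \<nu> T h"
  have Tm: "T \<in> borel_measurable \<nu>" and hm[measurable]: "h \<in> borel_measurable \<nu>"
    using family by (auto simp: exponential_family_def)
  have Ym[measurable]: "Y \<in> measurable M \<nu>" using target by (rule distributed_measurable)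
  note Tm[measurable] X[measurable]
  note [measurable] = log_partition_measurable[OF family]
  note inner = expectation_inner_indep[OF Ym Tm X indep int_X int_T]
  have "expected_nll M \<nu> T h Y X = (\<integral>\<omega>. ?A (X \<omega>) - X \<omega> \<bullet> T (Y \<omega>) - ln (h (Y \<omega>)) \<partial>M)"
    unfolding expected_nll_def
  proof (rule integral_cong_AE)
    show "AE \<omega> in M. - ln (expfam_density \<nu> T h (X \<omega>) (Y \<omega>)) = ?A (X \<omega>) - X \<omega> \<bullet> T (Y \<omega>) - ln (h (Y \<omega>))"
      using AE_reference_pos[OF family target]
      by eventually_elim (simp add: expfam_density_def ln_mult)
    show "(\<lambda>\<omega>. - ln (expfam_density \<nu> T h (X \<omega>) (Y \<omega>))) \<in> borel_measurable M"
      unfolding expfam_density_def by measurable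
  qed measurable
  also have "\<dots> = (\<integral>\<omega>. ?A (X \<omega>) \<partial>M) - (\<integral>\<omega>. X \<omega> \<partial>M) \<bullet> (\<integral>\<omega>. T (Y \<omega>) \<partial>M) - (\<integral>\<omega>. ln (h (Y \<omega>)) \<partial>M)"
    using int_A int_h inner by simp
  finally show ?thesis .
qed

section \<open>The ensemble theorem\<close>

theorem mainTheorem6:
  fixes M :: "'a measure" and \<nu> :: "'x measure" and SD :: "'d measure" and SW :: "'w measure"
    and T :: "'x \<Rightarrow> 'e::euclidean_space" and h :: "'x \<Rightarrow> real"
    and \<Theta> :: "'e set" and \<theta> :: 'e and A :: "'e \<Rightarrow> real"
    and \<phi> :: "'w \<Rightarrow> 'd \<Rightarrow> 'e"
    and D :: "'a \<Rightarrow> 'd" and W :: "'a \<Rightarrow> 'w" and Ws :: "nat \<Rightarrow> 'a \<Rightarrow> 'w" and Y :: "'a \<Rightarrow> 'x"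
    and F :: "'a measure" and pred :: "'a \<Rightarrow> 'e" and ens :: "nat \<Rightarrow> 'a \<Rightarrow> 'e"
  defines "A \<equiv> log_partition \<nu> T h"
    and "F \<equiv> generated M SD D"
    and "pred \<equiv> (\<lambda>\<omega>. \<phi> (W \<omega>) (D \<omega>))"
    and "ens \<equiv> ensemble \<phi> Ws D"
  assumes prob: "prob_space M"
    and family: "exponential_family \<nu> T h \<Theta>"
    and strict: "strictly_convex_on \<Theta> A"
    and D_meas: "D \<in> measurable M SD"
    and sampling: "cond_iid_copies M F SW W Ws"
    and pred_meas: "case_prod \<phi> \<in> borel_measurable (SW \<Otimes>\<^sub>M SD)"
    and pred_range: "\<And>w d. w \<in> space SW \<Longrightarrow> d \<in> space SD \<Longrightarrow> \<phi> w d \<in> \<Theta>"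
    and param: "\<theta> \<in> \<Theta>"
    and target: "distributed M \<nu> Y (\<lambda>x. ennreal (expfam_density \<nu> T h \<theta> x))"
    and indep: "\<And>n. prob_space.indep_set M (sets (generated M \<nu> Y)) (sets (generated M borel (ens n)))"
    and int_pred: "integrable M pred"
    and int_A: "integrable M (\<lambda>\<omega>. A (pred \<omega>))"
    and int_T: "integrable M (\<lambda>\<omega>. T (Y \<omega>))"
    and int_h: "integrable M (\<lambda>\<omega>. ln (h (Y \<omega>)))"
  shows
    "(\<forall>n. bregman_info M A (ens n) =
            bregman_info M A (vec_cond_exp M F pred) +
            (\<integral>\<omega>. cond_bregman_info M F A (ens n) \<omega> \<partial>M))
     \<and> (\<lambda>n. \<integral>\<omega>. cond_bregman_info M F A (ens n) \<omega> \<partial>M) \<longlonglongrightarrow> 0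
     \<and> (\<theta> \<in> interior \<Theta> \<longrightarrow>
          (\<forall>n. expected_nll M \<nu> T h Y (ens n) =
                 noise_term M h \<Theta> A Y \<theta> + bregman_info M A (ens n) + bias_term M A \<theta> (ens n)))
     \<and> (\<forall>n. bias_term M A \<theta> (ens n) = bias_term M A \<theta> pred)
     \<and> (\<forall>m n. expected_nll M \<nu> T h Y (ens m) - expected_nll M \<nu> T h Y (ens n) =
                (\<integral>\<omega>. cond_bregman_info M F A (ens m) \<omega> \<partial>M) -
                (\<integral>\<omega>. cond_bregman_info M F A (ens n) \<omega> \<partial>M))
     \<and> (\<lambda>n. expected_nll M \<nu> T h Y (ens n)) \<longlonglongrightarrow>
          expected_nll M \<nu> T h Y (ens 0) - (\<integral>\<omega>. cond_bregman_info M F A pred \<omega> \<partial>M)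
     \<and> (true_source M SD \<phi> W D \<longrightarrow>
          (\<forall>n\<ge>1. expected_nll M \<nu> T h Y (ens n) < expected_nll M \<nu> T h Y (ens (n - 1))) \<and>
          (\<forall>n\<ge>1. expected_nll M \<nu> T h Y (ens n) < expected_nll M \<nu> T h Y (ens 0)))"
proof -
  interpret S: conditional_sampling M SD SW D W Ws
    using prob D_meas sampling
    by (simp add: conditional_sampling_def conditional_sampling_axioms_def F_def)
  have A_meas: "A \<in> borel_measurable borel"
    unfolding A_def by (rule log_partition_measurable[OF family])
  define \<mu> where "\<mu> = (\<integral>\<omega>. T (Y \<omega>) \<partial>M)"
  have minorant: "A \<theta> + (\<eta> - \<theta>) \<bullet> \<mu> \<le> A \<eta>" if "\<eta> \<in> \<Theta>" for \<eta>
    unfolding A_def \<mu>_def by (rule log_partition_minorant[OF prob family that target int_T])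
  interpret E: convex_ensemble M SD SW D W Ws "case_prod \<phi>" \<Theta> A "A \<theta> - \<theta> \<bullet> \<mu>" \<mu>
  proof
    show "case_prod \<phi> x \<in> \<Theta>" if "x \<in> space (SW \<Otimes>\<^sub>M SD)" for x
      using that pred_range by (auto simp: space_pair_measure)
    show "A \<theta> - \<theta> \<bullet> \<mu> + \<eta> \<bullet> \<mu> \<le> A \<eta>" if "\<eta> \<in> \<Theta>" for \<eta>
      using minorant[OF that] by (simp add: inner_diff_left)
    show "convex_on \<Theta> A" by (rule strictly_convex_on_imp_convex_on[OF strict])
    show "integrable M (\<lambda>\<omega>. case_prod \<phi> (W \<omega>, D \<omega>))" using int_pred by (simp add: pred_def)
    show "integrable M (\<lambda>\<omega>. A (case_prod \<phi> (W \<omega>, D \<omega>)))" using int_A by (simp add: pred_def)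
  qed (rule pred_meas A_meas)+
  have ens: "ens n = S.sample_mean (case_prod \<phi>) (2 ^ n)" for n
    by (simp add: ens_def fun_eq_iff ensemble_def S.sample_mean_def)
  define f where "f = E.limit_prediction"
  have f: "vec_cond_exp M F pred = f"
    by (simp add: f_def F_def pred_def)
  define EA where "EA n = (\<integral>\<omega>. A (ens n \<omega>) \<partial>M)" for n
  have int_ens: "integrable M (ens n)" for n
    unfolding ens by (rule S.integrable_sample_mean[OF pred_meas E.int_\<Phi>])
  have int_Aens: "integrable M (\<lambda>\<omega>. A (ens n \<omega>))" for n
    unfolding ens by (rule E.integrable_A_mean) simp
  have mean_ens: "(\<integral>\<omega>. ens n \<omega> \<partial>M) = (\<integral>\<omega>. pred \<omega> \<partial>M)" for n
    unfolding ens using S.integral_sample_mean[OF pred_meas E.int_\<Phi>, of "2 ^ n"] by (simp add: pred_def)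
  have mean_f: "(\<integral>\<omega>. f \<omega> \<partial>M) = (\<integral>\<omega>. pred \<omega> \<partial>M)"
    using E.integral_limit_prediction[folded f_def] by (simp add: pred_def)
  have int_Af: "integrable M (\<lambda>\<omega>. A (f \<omega>))"
    and EA_lim: "EA \<longlonglongrightarrow> (\<integral>\<omega>. A (f \<omega>) \<partial>M)"
    using E.expected_A_limit[folded f_def] unfolding EA_def ens by auto
  \<comment> \<open>Kept general in \<open>X\<close> because it serves every ensemble and the single
    prediction \<open>pred\<close>, all of which share the conditional mean \<open>f\<close> almost
    surely.\<close>
  have cbi: "(\<integral>\<omega>. cond_bregman_info M F A X \<omega> \<partial>M) = (\<integral>\<omega>. A (X \<omega>) \<partial>M) - (\<integral>\<omega>. A (f \<omega>) \<partial>M)"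
    if i: "integrable M (\<lambda>\<omega>. A (X \<omega>))" and ae: "AE \<omega> in M. vec_cond_exp M F X \<omega> = f \<omega>" for X
  proof -
    have [measurable]: "vec_cond_exp M F X \<in> borel_measurable M"
      unfolding vec_cond_exp_def[abs_def] by (intro borel_measurable_sum) auto
    have [measurable]: "f \<in> borel_measurable M" unfolding f_def by (rule E.limit_prediction_measurable(2))
    note A_meas[measurable]
    have "(\<integral>\<omega>. cond_bregman_info M F A X \<omega> \<partial>M) = (\<integral>\<omega>. real_cond_exp M F (\<lambda>\<omega>. A (X \<omega>)) \<omega> - A (f \<omega>) \<partial>M)"
      unfolding cond_bregman_info_def
      by (intro integral_cong_AE) (use ae in auto)
    also have "\<dots> = (\<integral>\<omega>. A (X \<omega>) \<partial>M) - (\<integral>\<omega>. A (f \<omega>) \<partial>M)"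
      using S.real_cond_exp_int[OF i] int_Af by (simp add: F_def)
    finally show ?thesis .
  qed
  have cbi_ens: "(\<integral>\<omega>. cond_bregman_info M F A (ens n) \<omega> \<partial>M) = EA n - (\<integral>\<omega>. A (f \<omega>) \<partial>M)" for n
    unfolding EA_def
  proof (rule cbi[OF int_Aens])
    show "AE \<omega> in M. vec_cond_exp M F (ens n) \<omega> = f \<omega>"
      using E.vec_cond_exp_sample_mean[of "2 ^ n", folded f_def] unfolding ens F_def by simp
  qed
  have cbi_pred: "(\<integral>\<omega>. cond_bregman_info M F A pred \<omega> \<partial>M) = (\<integral>\<omega>. A (pred \<omega>) \<partial>M) - (\<integral>\<omega>. A (f \<omega>) \<partial>M)"
    by (rule cbi[OF int_A]) (simp add: f)
  \<comment> \<open>\<open>ens 0\<close> predicts from the copy \<open>Ws 0\<close> and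
    \<open>pred\<close> from \<open>W\<close>. They are different variables and agree only in
    law.\<close>
  have EA_0: "EA 0 = (\<integral>\<omega>. A (pred \<omega>) \<partial>M)"
    using S.integral_Ws[of "\<lambda>x. A (case_prod \<phi> x)" 0] measurable_compose[OF pred_meas A_meas]
    by (simp add: EA_def ens_def ensemble_def pred_def)
  have nll: "expected_nll M \<nu> T h Y (ens n) = EA n - (\<integral>\<omega>. pred \<omega> \<partial>M) \<bullet> \<mu> - (\<integral>\<omega>. ln (h (Y \<omega>)) \<partial>M)" for n
    using S.expected_nll_eq[OF family target _ indep int_ens _ int_T int_h, of n] int_ens[of n] int_Aens[of n]
    by (simp add: A_def EA_def \<mu>_def mean_ens[unfolded ens_def] ens_def)
  have info: "bregman_info M A (ens n) = EA n - A (\<integral>\<omega>. pred \<omega> \<partial>M)" for n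
    by (simp add: bregman_info_def EA_def mean_ens)
  have 1: "\<forall>n. bregman_info M A (ens n) = bregman_info M A (vec_cond_exp M F pred) +
      (\<integral>\<omega>. cond_bregman_info M F A (ens n) \<omega> \<partial>M)"
    unfolding info cbi_ens f by (simp add: bregman_info_def mean_f)
  have 2: "(\<lambda>n. \<integral>\<omega>. cond_bregman_info M F A (ens n) \<omega> \<partial>M) \<longlonglongrightarrow> 0"
    unfolding cbi_ens using EA_lim by (simp add: LIM_zero)
  have 3: "expected_nll M \<nu> T h Y (ens n) =
      noise_term M h \<Theta> A Y \<theta> + bregman_info M A (ens n) + bias_term M A \<theta> (ens n)"
    if \<theta>: "\<theta> \<in> interior \<Theta>" for n
  proof -
    have "grad A \<theta> = \<mu>"
      unfolding A_def \<mu>_def by (intro grad_eqI gderiv_log_partition[OF prob family \<theta> target int_T])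
    moreover have "convex_conjugate \<Theta> A \<mu> = \<theta> \<bullet> \<mu> - A \<theta>"
      by (rule convex_conjugate_eq[OF param minorant])
    ultimately show ?thesis
      unfolding nll info noise_term_def bias_term_def bregman_div_def mean_ens
      by (simp add: inner_diff_right inner_commute)
  qed
  have 4: "\<forall>n. bias_term M A \<theta> (ens n) = bias_term M A \<theta> pred"
    by (simp add: bias_term_def mean_ens)
  have 5: "\<forall>m n. expected_nll M \<nu> T h Y (ens m) - expected_nll M \<nu> T h Y (ens n) =
      (\<integral>\<omega>. cond_bregman_info M F A (ens m) \<omega> \<partial>M) - (\<integral>\<omega>. cond_bregman_info M F A (ens n) \<omega> \<partial>M)"
    by (simp add: nll cbi_ens)
  have 6: "(\<lambda>n. expected_nll M \<nu> T h Y (ens n)) \<longlonglongrightarrow>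
      expected_nll M \<nu> T h Y (ens 0) - (\<integral>\<omega>. cond_bregman_info M F A pred \<omega> \<partial>M)"
  proof -
    have "(\<lambda>n. expected_nll M \<nu> T h Y (ens n)) \<longlonglongrightarrow>
        (\<integral>\<omega>. A (f \<omega>) \<partial>M) - (\<integral>\<omega>. pred \<omega> \<partial>M) \<bullet> \<mu> - (\<integral>\<omega>. ln (h (Y \<omega>)) \<partial>M)"
      unfolding nll by (intro tendsto_intros EA_lim)
    then show ?thesis by (simp add: nll cbi_pred EA_0 algebra_simps)
  qed
  have 7: "expected_nll M \<nu> T h Y (ens n) < expected_nll M \<nu> T h Y (ens (n - 1))"
      "expected_nll M \<nu> T h Y (ens n) < expected_nll M \<nu> T h Y (ens 0)"
    if source: "true_source M SD \<phi> W D" and n: "1 \<le> n" for n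
  proof -
    \<comment> \<open>As \<open>1 \<le> n\<close>, truncated subtraction is harmless; the form
      \<open>Suc (n - 1)\<close> exposes the factor 2 of the doubling step.\<close>
    have "EA (Suc (n - 1)) < EA (n - 1)"
      unfolding EA_def ens power_Suc
      by (rule E.expected_A_doubling_less[OF _ strict]) (use source in \<open>auto simp: true_source_def\<close>)
    then have less: "EA n < EA (n - 1)" using n by simp
    have "EA (n - 1) \<le> EA 0"
      using decseqD[OF E.expected_A_decseq, of 0 "n - 1"] by (simp add: EA_def ens)
    then show "expected_nll M \<nu> T h Y (ens n) < expected_nll M \<nu> T h Y (ens (n - 1))"
      "expected_nll M \<nu> T h Y (ens n) < expected_nll M \<nu> T h Y (ens 0)"
      using less by (simp_all add: nll)
  qed
  show ?thesis
    by (intro conjI impI allI 1[rule_format] 2 3 4[rule_format] 5[rule_format] 6 7) assumption+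
qed

end
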